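(* Let $\delta\in(0,\alpha)$. There are positive constants $C^*$ and $C(\delta)$ such that for $t>\frac{4(1+\sqrt2)^2}{2\delta^2}$, $0<h\le C^*t^{-1/2}$ and $[x,x+h]\subseteq[\delta,\alpha]$, $$\mathbb{E}\left(N_t([x,x+h])^2-N_t([x,x+h])\right)\le C(\delta)h^3t^{3/2}.$$ In particular, $$\mathbb{E}\left(N_t([x,x+h])\,\mathbb{I}(N_t([x,x+h])\ge2)\right)\le C(\delta)h^3t^{3/2}.$$
   Context: Fix $\alpha\in(0,1)$, $\sigma=\sqrt{\alpha(1-\alpha)}$ and $\sigma_t=\sigma/\sqrt t$. Let $W$ be a standard one-dimensional Brownian motion on $[0,1]$. The scaled one-dimensional Conga line at time $t$ is $$u_t(x)=\int_0^1W(1-z)\frac{1}{\sqrt{2\pi}}\,\frac{x+\alpha z}{2\sigma_t z^{3/2}}\exp\left(-\frac{(x-\alpha z)^2}{2\sigma_t^2z}\right)dz,\qquad 0<x\le 1 .$$ For an interval $I\subseteq[\delta,\alpha]$, $N_t(I)$ is the number of critical points of $u_t$ in $I$ (points where $u_t'=0$). $\mathbb{I}$ denotes an indicator. Constants may depend on the fixed parameter $\alpha$. *)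

theory Defs
  imports "HOL-Probability.Probability"
begin

(* The normal_density parameter is a standard deviation, so increments have variance t - s.
   The starting value and path continuity are required almost surely, which also covers the
   convention requiring them for every outcome. *)
definition std_brownian_motion :: "'a measure \<Rightarrow> (real \<Rightarrow> 'a \<Rightarrow> real) \<Rightarrow> bool" where
  "std_brownian_motion M W \<longleftrightarrow>
     prob_space M \<and>
     (\<forall>s\<in>{0..1}. W s \<in> borel_measurable M) \<and>
     (AE \<omega> in M. W 0 \<omega> = 0) \<and>
     (\<forall>s t. 0 \<le> s \<and> s < t \<and> t \<le> 1 \<longrightarrow>
        distributed M lborel (\<lambda>\<omega>. W t \<omega> - W s \<omega>) (normal_density 0 (sqrt (t - s)))) \<and>
     (\<forall>(n::nat) (\<tau>::nat \<Rightarrow> real). mono_on {..n} \<tau> \<and> \<tau> ` {..n} \<subseteq> {0..1} \<longrightarrow>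
        prob_space.indep_vars M (\<lambda>_. borel) (\<lambda>i \<omega>. W (\<tau> (Suc i)) \<omega> - W (\<tau> i) \<omega>) {..<n}) \<and>
     (AE \<omega> in M. continuous_on {0..1} (\<lambda>s. W s \<omega>))"

definition conga_sigma :: "real \<Rightarrow> real \<Rightarrow> real" where
  "conga_sigma \<alpha> t = sqrt (\<alpha> * (1 - \<alpha>)) / sqrt t"

(* The argument w is a single path of the Brownian motion. *)
definition conga_line :: "real \<Rightarrow> real \<Rightarrow> (real \<Rightarrow> real) \<Rightarrow> real \<Rightarrow> real" where
  "conga_line \<alpha> t w x =
     (LBINT z:{0..1}. w (1 - z) * (1 / sqrt (2 * pi)) *
        ((x + \<alpha> * z) / (2 * conga_sigma \<alpha> t * z powr (3/2))) *
        exp (- ((x - \<alpha> * z)\<^sup>2 / (2 * (conga_sigma \<alpha> t)\<^sup>2 * z))))"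

(* Counting measure instead of card: an infinite set of critical points counts as top, not 0. *)
definition num_critical :: "real \<Rightarrow> real \<Rightarrow> (real \<Rightarrow> real) \<Rightarrow> real set \<Rightarrow> ennreal" where
  "num_critical \<alpha> t w I =
     emeasure (count_space UNIV) {y \<in> I. (conga_line \<alpha> t w has_real_derivative 0) (at y)}"

(* Subtraction on ennreal is truncated. This loses nothing in N^2 - N: N is a natural number or
   top, and in the latter case the difference is top. *)
lemma ennreal_top_power2_minus_top: "(\<top>::ennreal)\<^sup>2 - \<top> = \<top>"
  by (simp add: power2_eq_square ennreal_top_mult)

end

theory Submission
  imports Defs
begin

text \<open>Write \<open>s\<close> for the scale \<open>conga_sigma \<alpha> t\<close>, which is \<open>sqrt (\<alpha> (1 - \<alpha>)) / sqrt t\<close>. The critical points are the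
zeros of the smooth Gaussian process \<open>f = u'\<close>, which is called \<open>slope\<close> below. Near \<open>x\<close> this process only sees the Brownian path at
distance of order \<open>s\<close> from the time \<open>1 - x / \<alpha>\<close>, so \<open>f\<close>, \<open>f'\<close> and \<open>f''\<close> have the sizes
\<open>s powr (-1/2)\<close>, \<open>s powr (-3/2)\<close> and \<open>s powr (-5/2)\<close>.

Cut the interval into cells of length \<open>e\<close>. If two different zeros lie in the cells that start at \<open>p < q\<close>,
then \<open>f'\<close> vanishes in between, and with a bound \<open>Q\<close> for \<open>|f''|\<close> this gives \<open>|f p| \<le> 2 e (q - p) Q\<close>
and \<open>|f q - f p| \<le> 4 e (q - p) Q\<close> (\<open>two_zeros_small_values\<close>). For the Gaussian pair \<open>f p\<close>, \<open>f q - f p\<close>,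
whose density is at most of order \<open>s\<^sup>2 / (q - p)\<close>, such an event has probability of order \<open>e\<^sup>2 (q - p) / s\<^sup>3\<close>
(\<open>near_double_zero_probability\<close>). There are about \<open>(h / e)\<^sup>2\<close> pairs of cells and \<open>q - p \<le> h\<close>, hence the
expected number of pairs of occupied cells is of order \<open>h\<^sup>3 / s\<^sup>3\<close>, uniformly in \<open>e\<close>. As \<open>e\<close> tends to \<open>0\<close>,
finitely many zeros end up in different cells, so \<open>N\<^sup>2 - N\<close> is at most the lower limit of the number of ordered
pairs of occupied cells (\<open>factorial_count_le_liminf\<close>), and Fatou's lemma gives the estimate. It remains that
\<open>1 / s\<^sup>3\<close> is a multiple of \<open>t powr (3/2)\<close>.

The bound \<open>Q\<close> is random and not independent of \<open>f p\<close> and \<open>f q\<close>. Instead of conditioning, the probability is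
averaged over a two-parameter family of Cameron--Martin shifts of the path (\<open>gaussian_anticoncentration\<close>).
A shift moves the pair \<open>(f p, f q - f p)\<close> linearly in the parameters and hardly changes \<open>Q\<close>, so for a fixed path the
parameters for which the event occurs fill at most a parallelogram, whose area is the required bound. The determinant of that
linear map is bounded below because the kernel that \<open>f\<close> integrates
against the increments of the path is totally positive up to sign (\<open>determinant_lower_bound\<close>), and
\<open>Q\<close> has a second moment of order \<open>1 / s ^ 5\<close> because it is built from increments of the path near
\<open>1 - x / \<alpha>\<close> (\<open>fluct_second_moment\<close>).\<close>

section \<open>The Cameron--Martin formula for ramps\<close>

lemma normal_density_shift:
  fixes \<tau> c x :: real
  assumes "\<tau> > 0"
  shows "normal_density 0 (sqrt \<tau>) (x + c * \<tau>)
    = exp (- c * x - c\<^sup>2 * \<tau> / 2) * normal_density 0 (sqrt \<tau>) x"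
proof -
  have "- (x + c * \<tau>)\<^sup>2 / (2 * \<tau>) = (- c * x - c\<^sup>2 * \<tau> / 2) + (- x\<^sup>2 / (2 * \<tau>))"
    using assms by (simp add: field_simps power2_eq_square)
  then show ?thesis
    using assms by (simp add: normal_density_def exp_add[symmetric])
qed

lemma (in prob_space) gaussian_shift:
  fixes X :: "'a \<Rightarrow> real"
  assumes D: "distributed M lborel X (normal_density 0 (sqrt \<tau>))" and "\<tau> > 0"
    and [measurable]: "f \<in> borel_measurable borel"
  shows "(\<integral>\<^sup>+\<omega>. f (X \<omega>) \<partial>M)
    = (\<integral>\<^sup>+\<omega>. f (X \<omega> + c * \<tau>) * ennreal (exp (- c * X \<omega> - c\<^sup>2 * \<tau> / 2)) \<partial>M)"
proof -
  have "(\<integral>\<^sup>+\<omega>. f (X \<omega>) \<partial>M) = (\<integral>\<^sup>+x. ennreal (normal_density 0 (sqrt \<tau>) x) * f x \<partial>lborel)"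
    by (subst distributed_nn_integral[OF D]) auto
  also have "\<dots> = (\<integral>\<^sup>+x. ennreal (normal_density 0 (sqrt \<tau>) (c * \<tau> + 1 * x)) * f (c * \<tau> + 1 * x) \<partial>lborel)"
    by (subst nn_integral_real_affine[where t = "c * \<tau>" and c = 1]) auto
  also have "\<dots> = (\<integral>\<^sup>+x. ennreal (normal_density 0 (sqrt \<tau>) x)
      * (f (x + c * \<tau>) * ennreal (exp (- c * x - c\<^sup>2 * \<tau> / 2))) \<partial>lborel)"
    using normal_density_shift[OF \<open>\<tau> > 0\<close>, of _ c]
    by (intro nn_integral_cong) (simp add: ennreal_mult add.commute mult_ac)
  also have "\<dots> = (\<integral>\<^sup>+\<omega>. f (X \<omega> + c * \<tau>) * ennreal (exp (- c * X \<omega> - c\<^sup>2 * \<tau> / 2)) \<partial>M)"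
    by (subst distributed_nn_integral[OF D]) auto
  finally show ?thesis .
qed

lemma emeasure_distr_density:
  assumes [measurable]: "Y \<in> measurable M N" "Z \<in> borel_measurable M" "E \<in> sets N"
  shows "emeasure (distr (density M Z) N Y) E = (\<integral>\<^sup>+\<omega>. Z \<omega> * indicator E (Y \<omega>) \<partial>M)"
proof -
  have "emeasure (distr (density M Z) N Y) E = emeasure (density M Z) (Y -` E \<inter> space M)"
    by (subst emeasure_distr) auto
  also have "\<dots> = (\<integral>\<^sup>+\<omega>. Z \<omega> * indicator (Y -` E \<inter> space M) \<omega> \<partial>M)"
    by (rule emeasure_density) auto
  also have "\<dots> = (\<integral>\<^sup>+\<omega>. Z \<omega> * indicator E (Y \<omega>) \<partial>M)"
    by (intro nn_integral_cong) (auto simp: indicator_def)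
  finally show ?thesis .
qed

lemma emeasure_distr_nn_integral:
  assumes [measurable]: "Y \<in> measurable M N" "E \<in> sets N"
  shows "emeasure (distr M N Y) E = (\<integral>\<^sup>+\<omega>. indicator E (Y \<omega>) \<partial>M)"
  using emeasure_distr_density[of Y M N "\<lambda>_. 1" E] assms by (simp add: density_1)

text \<open>Boxes generate the product \<sigma>-algebra, and on a box independence splits both sides into one-dimensional
factors, which agree by \<open>gaussian_shift\<close>.\<close>
lemma (in prob_space) gaussian_vector_shift:
  fixes X :: "nat \<Rightarrow> 'a \<Rightarrow> real" and \<tau> c :: "nat \<Rightarrow> real"
  assumes ind: "indep_vars (\<lambda>_. borel) X {..<n}"
    and D: "\<And>i. i < n \<Longrightarrow> distributed M lborel (X i) (normal_density 0 (sqrt (\<tau> i)))"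
    and pos: "\<And>i. i < n \<Longrightarrow> \<tau> i > 0"
  shows "distr M (\<Pi>\<^sub>M i\<in>{..<n}. borel) (\<lambda>\<omega>. \<lambda>i\<in>{..<n}. X i \<omega>)
    = distr (density M (\<lambda>\<omega>. \<Prod>i<n. ennreal (exp (- c i * X i \<omega> - (c i)\<^sup>2 * \<tau> i / 2))))
        (\<Pi>\<^sub>M i\<in>{..<n}. borel) (\<lambda>\<omega>. \<lambda>i\<in>{..<n}. X i \<omega> + c i * \<tau> i)"
    (is "?L = ?R")
proof (rule measure_eqI_PiM_finite)
  have X[measurable]: "X i \<in> borel_measurable M" if "i < n" for i
    using ind that by (auto simp: indep_vars_def)
  show "finite {..<n}" "sets ?L = sets (PiM {..<n} (\<lambda>_. borel))" "sets ?R = sets (PiM {..<n} (\<lambda>_. borel))"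
    by simp_all
  have mL: "(\<lambda>\<omega>. \<lambda>i\<in>{..<n}. X i \<omega>) \<in> measurable M (\<Pi>\<^sub>M i\<in>{..<n}. borel)"
    by measurable
  have mR: "(\<lambda>\<omega>. \<lambda>i\<in>{..<n}. X i \<omega> + c i * \<tau> i) \<in> measurable M (\<Pi>\<^sub>M i\<in>{..<n}. borel)"
    by measurable
  have mZ: "(\<lambda>\<omega>. \<Prod>i<n. ennreal (exp (- c i * X i \<omega> - (c i)\<^sup>2 * \<tau> i / 2))) \<in> borel_measurable M"
  proof (rule borel_measurable_prod_ennreal)
    fix i assume "i \<in> {..<n}"
    then have [measurable]: "X i \<in> borel_measurable M" using X by simp
    show "(\<lambda>\<omega>. ennreal (exp (- c i * X i \<omega> - (c i)\<^sup>2 * \<tau> i / 2))) \<in> borel_measurable M"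
      by measurable
  qed
  show "range (\<lambda>_::nat. space (PiM {..<n} (\<lambda>_. borel :: real measure))) \<subseteq> prod_algebra {..<n} (\<lambda>_. borel)"
    unfolding space_PiM by (intro image_subsetI prod_algebraI_finite) auto
  show "(\<Union>i::nat. space (PiM {..<n} (\<lambda>_. borel :: real measure))) = space (PiM {..<n} (\<lambda>_. borel))"
    by simp
  interpret L: prob_space ?L by (rule prob_space_distr[OF mL])
  show "emeasure ?L (space (PiM {..<n} (\<lambda>_. borel))) \<noteq> \<infinity>" 
    using L.emeasure_finite by (metis infinity_ennreal_def)
  fix A :: "nat \<Rightarrow> real set"
  assume "\<And>i. i \<in> {..<n} \<Longrightarrow> A i \<in> sets borel"
  then have A[measurable]: "A i \<in> sets borel" if "i < n" for i using that by auto
  have boxm: "Pi\<^sub>E {..<n} A \<in> sets (PiM {..<n} (\<lambda>_. borel))"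
    by (rule sets_PiM_I_finite) auto
  have ind1: "indep_vars (\<lambda>_. borel) (\<lambda>i \<omega>. indicator (A i) (X i \<omega>) :: ennreal) {..<n}"
    by (rule indep_vars_compose2[OF ind]) auto
  have ind2: "indep_vars (\<lambda>_. borel) (\<lambda>i \<omega>. indicator (A i) (X i \<omega> + c i * \<tau> i)
     * ennreal (exp (- c i * X i \<omega> - (c i)\<^sup>2 * \<tau> i / 2))) {..<n}"
    by (rule indep_vars_compose2[OF ind]) auto
  have "emeasure ?L (Pi\<^sub>E {..<n} A) = (\<integral>\<^sup>+\<omega>. indicator (Pi\<^sub>E {..<n} A) (\<lambda>i\<in>{..<n}. X i \<omega>) \<partial>M)"
    by (rule emeasure_distr_nn_integral[OF mL boxm])
  also have "\<dots> = (\<integral>\<^sup>+\<omega>. (\<Prod>i<n. indicator (A i) (X i \<omega>)) \<partial>M)"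
    by (intro nn_integral_cong) (auto simp: indicator_def PiE_iff)
  also have "\<dots> = (\<Prod>i<n. \<integral>\<^sup>+\<omega>. indicator (A i) (X i \<omega>) \<partial>M)"
    by (rule indep_vars_nn_integral[OF _ ind1]) auto
  also have "\<dots> = (\<Prod>i<n. \<integral>\<^sup>+\<omega>. indicator (A i) (X i \<omega> + c i * \<tau> i)
     * ennreal (exp (- c i * X i \<omega> - (c i)\<^sup>2 * \<tau> i / 2)) \<partial>M)"
    by (intro prod.cong refl gaussian_shift) (auto intro!: D pos)
  also have "\<dots> = (\<integral>\<^sup>+\<omega>. (\<Prod>i<n. indicator (A i) (X i \<omega> + c i * \<tau> i)
     * ennreal (exp (- c i * X i \<omega> - (c i)\<^sup>2 * \<tau> i / 2))) \<partial>M)"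
    by (rule indep_vars_nn_integral[OF _ ind2, symmetric]) auto
  also have "\<dots> = (\<integral>\<^sup>+\<omega>. (\<Prod>i<n. ennreal (exp (- c i * X i \<omega> - (c i)\<^sup>2 * \<tau> i / 2)))
      * indicator (Pi\<^sub>E {..<n} A) (\<lambda>i\<in>{..<n}. X i \<omega> + c i * \<tau> i) \<partial>M)"
    by (intro nn_integral_cong) (auto simp: indicator_def PiE_iff prod.distrib)
  also have "\<dots> = emeasure ?R (Pi\<^sub>E {..<n} A)"
    using emeasure_distr_density[OF mR mZ boxm] by (rule sym)
  finally show "emeasure ?L (Pi\<^sub>E {..<n} A) = emeasure ?R (Pi\<^sub>E {..<n} A)" .
qed

text \<open>The primitive of the indicator of \<open>[a, b]\<close>. A shift of Brownian motion in this direction has a density that only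
depends on the increment over \<open>[a, b]\<close>.\<close>
definition ramp :: "real \<Rightarrow> real \<Rightarrow> real \<Rightarrow> real" where
  "ramp a b r = min b (max a r) - a"

definition clamp01 :: "real \<Rightarrow> real" where
  "clamp01 r = max 0 (min 1 r)"

text \<open>Freezing the path outside \<open>[0, 1]\<close> turns it into a function on the whole line. Paths then form a plain product
space, and continuity on \<open>[0, 1]\<close> becomes continuity everywhere.\<close>
definition path_of :: "(real \<Rightarrow> 'a \<Rightarrow> real) \<Rightarrow> 'a \<Rightarrow> real \<Rightarrow> real" where
  "path_of W \<omega> r = W (clamp01 r) \<omega>"

abbreviation path_space :: "(real \<Rightarrow> real) measure" where
  "path_space \<equiv> \<Pi>\<^sub>M r\<in>UNIV. borel"

lemma clamp01_in [simp]: "0 \<le> clamp01 r" "clamp01 r \<le> 1"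
  by (auto simp: clamp01_def)

lemma clamp01_id [simp]: "r \<in> {0..1} \<Longrightarrow> clamp01 r = r"
  by (auto simp: clamp01_def)

lemma ramp_clamp01: "0 \<le> a \<Longrightarrow> a \<le> b \<Longrightarrow> b \<le> 1 \<Longrightarrow> ramp a b (clamp01 r) = ramp a b r"
  unfolding clamp01_def ramp_def by linarith

lemma path_of_measurable:
  assumes "std_brownian_motion M W"
  shows "path_of W \<in> measurable M path_space"
proof (rule measurable_PiM_single')
  show "(\<lambda>\<omega>. path_of W \<omega> r) \<in> borel_measurable M" for r
    using assms by (auto simp: std_brownian_motion_def path_of_def)
qed auto

lemma finite_grid:
  fixes T :: "real set"
  assumes "finite T" "0 \<in> T" "T \<subseteq> {0..}"
  obtains \<tau> :: "nat \<Rightarrow> real" and n :: nat and idx :: "real \<Rightarrow> nat"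
  where "\<tau> 0 = 0" "strict_mono_on {..n} \<tau>" "\<tau> ` {..n} = T"
    "\<forall>r\<in>T. idx r \<le> n \<and> \<tau> (idx r) = r"
proof -
  define L where "L = sorted_list_of_set T"
  define n where "n = card T - 1"
  define \<tau> where "\<tau> i = L ! i" for i
  have "card T > 0" using assms by (auto simp: card_gt_0_iff)
  then have len: "length L = Suc n" by (simp add: L_def n_def)
  have setL: "set L = T" using assms by (simp add: L_def)
  have "sorted_wrt (<) L" by (simp add: L_def)
  then have less: "\<tau> i < \<tau> j" if "i < j" "j \<le> n" for i j
    using that len unfolding \<tau>_def by (simp add: sorted_wrt_nth_less)
  have im: "\<tau> ` {..n} = T"
    using len unfolding \<tau>_def setL[symmetric] set_conv_nth by (auto simp: less_Suc_eq_le)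
  then have "\<forall>r\<in>T. \<exists>i. i \<le> n \<and> \<tau> i = r" by auto
  then obtain idx where idx: "\<And>r. r \<in> T \<Longrightarrow> idx r \<le> n \<and> \<tau> (idx r) = r" by metis
  have "\<tau> 0 = 0"
  proof (rule ccontr)
    assume "\<tau> 0 \<noteq> 0"
    then have "idx 0 > 0" using idx[OF \<open>0 \<in> T\<close>] by (cases "idx 0") auto
    then have "\<tau> 0 < 0" using less[of 0 "idx 0"] idx[OF \<open>0 \<in> T\<close>] by auto
    moreover have "\<tau> 0 \<in> T" using im by auto
    ultimately show False using assms by auto
  qed
  moreover have "strict_mono_on {..n} \<tau>" using less by (auto simp: strict_mono_on_def)
  ultimately show thesis using that im idx by blast
qed

text \<open>A law on the path space is determined by its finite-dimensional marginals. Adding \<open>0\<close>, \<open>a\<close> and \<open>b\<close> to the given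
times yields a grid on each cell of which the ramp has slope \<open>0\<close> or \<open>1\<close>. The independent increments over the cells
are therefore shifted as in \<open>gaussian_vector_shift\<close>, and the exponents of the densities telescope to the increment
over \<open>[a, b]\<close>.\<close>
theorem cameron_martin:
  fixes W :: "real \<Rightarrow> 'a \<Rightarrow> real"
  assumes W: "std_brownian_motion M W" and ab: "0 \<le> a" "a < b" "b \<le> 1"
  shows "distr M path_space (path_of W)
    = distr (density M (\<lambda>\<omega>. ennreal (exp (- c * (W b \<omega> - W a \<omega>) - c\<^sup>2 * (b - a) / 2))))
        path_space (\<lambda>\<omega> r. path_of W \<omega> r + c * ramp a b r)" (is "?L = ?R")
proof (rule measure_eqI_PiM_infinite)
  interpret prob_space M using W by (simp add: std_brownian_motion_def)
  have Wm[measurable]: "W r \<in> borel_measurable M" if "0 \<le> r" "r \<le> 1" for r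
    using W that by (auto simp: std_brownian_motion_def)
  note [measurable] = path_of_measurable[OF W]
  show "sets ?L = sets path_space" "sets ?R = sets path_space" by simp_all
  show "finite_measure ?L"
    by (intro prob_space.finite_measure prob_space_distr) simp
  have mR: "(\<lambda>\<omega> r. path_of W \<omega> r + c * ramp a b r) \<in> measurable M path_space"
  proof (rule measurable_PiM_single')
    show "(\<lambda>\<omega>. path_of W \<omega> r + c * ramp a b r) \<in> borel_measurable M" for r
      by (simp add: path_of_def)
  qed auto
  fix A :: "real \<Rightarrow> real set" and J :: "real set"
  assume J: "finite J" and "\<And>i. i \<in> J \<Longrightarrow> A i \<in> sets (borel :: real measure)"
  then have A[measurable]: "\<And>i. i \<in> J \<Longrightarrow> A i \<in> sets borel" by simp
  let ?E = "prod_emb UNIV (\<lambda>_. borel) J (Pi\<^sub>E J A) :: (real \<Rightarrow> real) set"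
  have E: "?E = {w. \<forall>j\<in>J. w j \<in> A j}"
    by (auto simp: prod_emb_def PiE_iff)
  have Em: "?E \<in> sets path_space"
    by (rule sets_PiM_I) (use J A in auto)
  \<comment> \<open>The time \<open>0\<close> is included because \<open>W\<close> starts there almost surely, which recovers values of the path from its increments.\<close>
  define T where "T = clamp01 ` J \<union> {0, a, b}"
  have T: "finite T" "0 \<in> T" "T \<subseteq> {0..}" "T \<subseteq> {0..1}" using J ab by (auto simp: T_def)
  obtain \<tau> :: "nat \<Rightarrow> real" and n and idx where \<tau>0: "\<tau> 0 = 0" and sm: "strict_mono_on {..n} \<tau>"
    and im: "\<tau> ` {..n} = T" and idx': "\<forall>r\<in>T. idx r \<le> n \<and> \<tau> (idx r) = r"
    using finite_grid[OF T(1-3)] by blast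
  have less: "\<tau> i < \<tau> j" if "i < j" "j \<le> n" for i j
    using sm that by (auto simp: strict_mono_on_def)
  have idx: "idx r \<le> n \<and> \<tau> (idx r) = r" if "r \<in> T" for r
    using idx' that by blast
  have \<tau>01: "0 \<le> \<tau> i" "\<tau> i \<le> 1" if "i \<le> n" for i
    using im that T(4) by auto
  have le: "\<tau> i \<le> \<tau> j" if "i \<le> j" "j \<le> n" for i j
    using less[of i j] that by (cases "i = j") auto
  define X where "X i \<omega> = W (\<tau> (Suc i)) \<omega> - W (\<tau> i) \<omega>" for i \<omega>
  define u where "u i = ramp a b (\<tau> (Suc i)) - ramp a b (\<tau> i)" for i
  define \<Delta> where "\<Delta> i = \<tau> (Suc i) - \<tau> i" for i
  define k where "k i = c * (u i / \<Delta> i)" for i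
  have \<Delta>: "\<Delta> i > 0" if "i < n" for i using less[of i "Suc i"] that by (simp add: \<Delta>_def)
  have ind: "indep_vars (\<lambda>_. borel) X {..<n}"
  proof -
    have "mono_on {..n} \<tau>" by (auto simp: mono_on_def intro: le)
    moreover have "\<tau> ` {..n} \<subseteq> {0..1}" using im T(4) by simp
    ultimately show ?thesis using W unfolding std_brownian_motion_def X_def[abs_def] by blast
  qed
  have D: "distributed M lborel (X i) (normal_density 0 (sqrt (\<Delta> i)))" if "i < n" for i
    using W \<tau>01[of i] \<tau>01[of "Suc i"] less[of i "Suc i"] that
    unfolding std_brownian_motion_def X_def[abs_def] \<Delta>_def by auto
  note shift = gaussian_vector_shift[OF ind D \<Delta>, of k, simplified]
  have ia: "idx a \<le> n" "\<tau> (idx a) = a" and ib: "idx b \<le> n" "\<tau> (idx b) = b"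
    using idx by (auto simp: T_def)
  have iab: "idx a \<le> idx b"
    using le[of "idx b" "idx a"] ia ib ab by (cases "idx a \<le> idx b") auto
  have slope: "u i / \<Delta> i = (if i \<in> {idx a..<idx b} then 1 else 0)" if "i < n" for i
  proof -
    consider "i < idx a" | "i \<in> {idx a..<idx b}" | "idx b \<le> i" by fastforce
    then show ?thesis
    proof cases
      case 1
      then have "\<tau> (Suc i) \<le> a" "\<tau> i \<le> a" using le[of "Suc i" "idx a"] le[of i "idx a"] ia by auto
      then show ?thesis using 1 by (simp add: u_def ramp_def min_def max_def)
    next
      case 2
      then have "\<tau> (Suc i) \<le> b" "a \<le> \<tau> i" "\<tau> i < \<tau> (Suc i)"
        using le[of "Suc i" "idx b"] le[of "idx a" i] less[of i "Suc i"] that ia ib by auto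
      then show ?thesis using 2 by (simp add: u_def \<Delta>_def ramp_def min_def max_def)
    next
      case 3
      then have "b \<le> \<tau> (Suc i)" "b \<le> \<tau> i"
        using le[of "idx b" "Suc i"] le[of "idx b" i] that ib by auto
      then show ?thesis using 3 ab by (simp add: u_def ramp_def min_def max_def)
    qed
  qed
  have restr: "{..<n} \<inter> {idx a..<idx b} = {idx a..<idx b}" using ib by auto
  have sumX: "(\<Sum>i<n. k i * X i \<omega>) = c * (W b \<omega> - W a \<omega>)" for \<omega>
  proof -
    have "(\<Sum>i<n. k i * X i \<omega>) = c * (\<Sum>i<n. if i \<in> {idx a..<idx b} then X i \<omega> else 0)"
      unfolding sum_distrib_left k_def by (intro sum.cong) (auto simp: slope)
    also have "\<dots> = c * (\<Sum>i\<in>{idx a..<idx b}. X i \<omega>)"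
      by (subst sum.inter_restrict[symmetric]) (simp_all add: restr)
    also have "\<dots> = c * (W b \<omega> - W a \<omega>)"
      unfolding X_def using sum_Suc_diff'[OF iab, of "\<lambda>i. W (\<tau> i) \<omega>"] ia ib by simp
    finally show ?thesis .
  qed
  have sumk: "(\<Sum>i<n. (k i)\<^sup>2 * \<Delta> i) = c\<^sup>2 * (b - a)"
  proof -
    have "(\<Sum>i<n. (k i)\<^sup>2 * \<Delta> i) = c\<^sup>2 * (\<Sum>i<n. if i \<in> {idx a..<idx b} then \<Delta> i else 0)"
      unfolding sum_distrib_left k_def by (intro sum.cong) (auto simp: slope)
    also have "\<dots> = c\<^sup>2 * (\<Sum>i\<in>{idx a..<idx b}. \<Delta> i)"
      by (subst sum.inter_restrict[symmetric]) (simp_all add: restr)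
    also have "\<dots> = c\<^sup>2 * (b - a)"
      unfolding \<Delta>_def using sum_Suc_diff'[OF iab, of \<tau>] ia ib by simp
    finally show ?thesis .
  qed
  have Z: "(\<Prod>i<n. ennreal (exp (- (k i * X i \<omega>) - (k i)\<^sup>2 * \<Delta> i / 2)))
      = ennreal (exp (- c * (W b \<omega> - W a \<omega>) - c\<^sup>2 * (b - a) / 2))" for \<omega>
  proof -
    have "(\<Sum>i<n. - (k i * X i \<omega>) - (k i)\<^sup>2 * \<Delta> i / 2)
        = - (\<Sum>i<n. k i * X i \<omega>) - (\<Sum>i<n. (k i)\<^sup>2 * \<Delta> i) / 2"
      by (simp add: sum_subtractf sum_negf sum_divide_distrib)
    then show ?thesis by (simp add: prod_ennreal exp_sum[symmetric] sumX sumk)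
  qed
  have kD: "k i * \<Delta> i = c * u i" if "i < n" for i
    using \<Delta>[OF that] by (simp add: k_def)
  define B where "B = {x \<in> space (\<Pi>\<^sub>M i\<in>{..<n}. borel :: real measure).
      \<forall>j\<in>J. (\<Sum>i<idx (clamp01 j). x i) \<in> A j}"
  have jn: "idx (clamp01 j) \<le> n" "\<tau> (idx (clamp01 j)) = clamp01 j" if "j \<in> J" for j
    using idx[of "clamp01 j"] that by (auto simp: T_def)
  have Bm: "B \<in> sets (\<Pi>\<^sub>M i\<in>{..<n}. borel)"
    unfolding B_def
  proof (intro sets.sets_Collect_finite_All J)
    fix j assume j: "j \<in> J"
    have "(\<lambda>x. \<Sum>i<idx (clamp01 j). x i) \<in> borel_measurable (\<Pi>\<^sub>M i\<in>{..<n}. borel :: real measure)"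
      using jn[OF j] by (intro borel_measurable_sum measurable_component_singleton) auto
    then show "{x \<in> space (\<Pi>\<^sub>M i\<in>{..<n}. borel). (\<Sum>i<idx (clamp01 j). x i) \<in> A j} \<in> sets (\<Pi>\<^sub>M i\<in>{..<n}. borel)"
      using A[OF j] by (simp add: measurable_sets_Collect pred_def) 
  qed
  have Xm[measurable]: "X i \<in> borel_measurable M" if "i < n" for i
    unfolding X_def[abs_def] using \<tau>01[of i] \<tau>01[of "Suc i"] that by simp
  have XB: "(\<lambda>\<omega>. \<lambda>i\<in>{..<n}. X i \<omega>) \<in> measurable M (\<Pi>\<^sub>M i\<in>{..<n}. borel)"
    "(\<lambda>\<omega>. \<lambda>i\<in>{..<n}. X i \<omega> + k i * \<Delta> i) \<in> measurable M (\<Pi>\<^sub>M i\<in>{..<n}. borel)"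
    by measurable
  have AE0: "AE \<omega> in M. W 0 \<omega> = 0" using W by (simp add: std_brownian_motion_def)
  have tel: "(\<Sum>i<idx (clamp01 j). X i \<omega>) = path_of W \<omega> j" if "j \<in> J" "W 0 \<omega> = 0" for j \<omega>
    unfolding X_def using sum_lessThan_telescope[of "\<lambda>i. W (\<tau> i) \<omega>" "idx (clamp01 j)"] jn[OF that(1)] that(2) \<tau>0
    by (simp add: path_of_def)
  have telu: "(\<Sum>i<idx (clamp01 j). u i) = ramp a b j" if "j \<in> J" for j
    unfolding u_def using sum_lessThan_telescope[of "\<lambda>i. ramp a b (\<tau> i)" "idx (clamp01 j)"] jn[OF that(1)] \<tau>0 ab
    by (simp add: ramp_clamp01) (simp add: ramp_def)
  have inB1: "(\<lambda>i\<in>{..<n}. X i \<omega>) \<in> B \<longleftrightarrow> path_of W \<omega> \<in> ?E" if "W 0 \<omega> = 0" for \<omega>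
  proof -
    have "(\<Sum>i<idx (clamp01 j). (\<lambda>i\<in>{..<n}. X i \<omega>) i) = path_of W \<omega> j" if "j \<in> J" for j
      using jn[OF that] tel[OF that \<open>W 0 \<omega> = 0\<close>] by (subst tel[symmetric]) (auto intro!: sum.cong that \<open>W 0 \<omega> = 0\<close>)
    then show ?thesis unfolding B_def E by (simp add: space_PiM)
  qed
  have inB2: "(\<lambda>i\<in>{..<n}. X i \<omega> + k i * \<Delta> i) \<in> B \<longleftrightarrow> (\<lambda>r. path_of W \<omega> r + c * ramp a b r) \<in> ?E"
    if "W 0 \<omega> = 0" for \<omega>
  proof -
    have "(\<Sum>i<idx (clamp01 j). (\<lambda>i\<in>{..<n}. X i \<omega> + k i * \<Delta> i) i) = path_of W \<omega> j + c * ramp a b j" if "j \<in> J" for j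
    proof -
      have "(\<Sum>i<idx (clamp01 j). (\<lambda>i\<in>{..<n}. X i \<omega> + k i * \<Delta> i) i) = (\<Sum>i<idx (clamp01 j). X i \<omega> + c * u i)"
        using jn[OF that] by (intro sum.cong) (auto simp: kD)
      then show ?thesis
        by (simp add: sum.distrib sum_distrib_left[symmetric] tel[OF that \<open>W 0 \<omega> = 0\<close>] telu[OF that])
    qed
    then show ?thesis unfolding B_def E by (simp add: space_PiM)
  qed
  have "emeasure ?L ?E = (\<integral>\<^sup>+\<omega>. indicator ?E (path_of W \<omega>) \<partial>M)"
    by (rule emeasure_distr_nn_integral[OF path_of_measurable[OF W] Em])
  also have "\<dots> = (\<integral>\<^sup>+\<omega>. indicator B (\<lambda>i\<in>{..<n}. X i \<omega>) \<partial>M)"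
    by (rule nn_integral_cong_AE, rule AE_mp[OF AE0 AE_I2]) (simp add: indicator_def inB1)
  also have "\<dots> = emeasure (distr M (\<Pi>\<^sub>M i\<in>{..<n}. borel) (\<lambda>\<omega>. \<lambda>i\<in>{..<n}. X i \<omega>)) B"
    by (rule emeasure_distr_nn_integral[OF XB(1) Bm, symmetric])
  also have "\<dots> = (\<integral>\<^sup>+\<omega>. (\<Prod>i<n. ennreal (exp (- (k i * X i \<omega>) - (k i)\<^sup>2 * \<Delta> i / 2)))
      * indicator B (\<lambda>i\<in>{..<n}. X i \<omega> + k i * \<Delta> i) \<partial>M)"
    unfolding shift by (intro emeasure_distr_density[OF XB(2) _ Bm] borel_measurable_prod_ennreal) simp
  also have "\<dots> = (\<integral>\<^sup>+\<omega>. ennreal (exp (- c * (W b \<omega> - W a \<omega>) - c\<^sup>2 * (b - a) / 2))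
      * indicator ?E (\<lambda>r. path_of W \<omega> r + c * ramp a b r) \<partial>M)"
    unfolding Z by (rule nn_integral_cong_AE, rule AE_mp[OF AE0 AE_I2]) (simp add: indicator_def inB2)
  also have "\<dots> = emeasure ?R ?E"
    using ab by (intro emeasure_distr_density[symmetric, OF mR _ Em]) simp
  finally show "emeasure ?L ?E = emeasure ?R ?E" .
qed

lemma cameron_martin_nn_integral:
  fixes W :: "real \<Rightarrow> 'a \<Rightarrow> real"
  assumes W: "std_brownian_motion M W" and ab: "0 \<le> a" "a < b" "b \<le> 1"
    and [measurable]: "\<Psi> \<in> borel_measurable path_space"
  shows "(\<integral>\<^sup>+\<omega>. \<Psi> (path_of W \<omega>) \<partial>M)
    = (\<integral>\<^sup>+\<omega>. \<Psi> (\<lambda>r. path_of W \<omega> r + c * ramp a b r)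
        * ennreal (exp (- c * (W b \<omega> - W a \<omega>) - c\<^sup>2 * (b - a) / 2)) \<partial>M)"
proof -
  have Wm[measurable]: "W r \<in> borel_measurable M" if "0 \<le> r" "r \<le> 1" for r
    using W that by (auto simp: std_brownian_motion_def)
  note [measurable] = path_of_measurable[OF W]
  have mR[measurable]: "(\<lambda>\<omega> r. path_of W \<omega> r + c * ramp a b r) \<in> measurable M path_space"
  proof (rule measurable_PiM_single')
    show "(\<lambda>\<omega>. path_of W \<omega> r + c * ramp a b r) \<in> borel_measurable M" for r
      by (simp add: path_of_def)
  qed auto
  have "(\<integral>\<^sup>+\<omega>. \<Psi> (path_of W \<omega>) \<partial>M) = (\<integral>\<^sup>+w. \<Psi> w \<partial>distr M path_space (path_of W))"
    by (subst nn_integral_distr) auto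
  also have "\<dots> = (\<integral>\<^sup>+\<omega>. \<Psi> (\<lambda>r. path_of W \<omega> r + c * ramp a b r)
        * ennreal (exp (- c * (W b \<omega> - W a \<omega>) - c\<^sup>2 * (b - a) / 2)) \<partial>M)"
    unfolding cameron_martin[OF W ab, of c] using ab
    by (subst nn_integral_distr) (auto simp: nn_integral_density mult.commute)
  finally show ?thesis .
qed

section \<open>Anticoncentration by averaging over shifts\<close>

lemma nn_integral_strip:
  fixes x a U :: real
  assumes "a \<noteq> 0" "0 \<le> U"
  shows "(\<integral>\<^sup>+s. indicator {-U..U} (x + a * s) \<partial>lborel) = ennreal (2 * U / \<bar>a\<bar>)"
proof -
  have "ennreal (2 * U) = (\<integral>\<^sup>+t. indicator {-U..U} t \<partial>lborel)"
    using assms by (simp add: nn_integral_indicator)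
  also have "\<dots> = ennreal \<bar>a\<bar> * (\<integral>\<^sup>+s. indicator {-U..U} (x + a * s) \<partial>lborel)"
    using assms by (subst nn_integral_real_affine[where t = x and c = a]) auto
  finally have "ennreal \<bar>a\<bar> * (\<integral>\<^sup>+s. indicator {-U..U} (x + a * s) \<partial>lborel)
      = ennreal \<bar>a\<bar> * ennreal (2 * U / \<bar>a\<bar>)"
    using assms by (simp add: ennreal_mult[symmetric])
  then show ?thesis
    using assms by (subst (asm) ennreal_mult_cancel_left) auto
qed

text \<open>Fubini in the form of a shear: a translation of the first coordinate by a multiple of the second removes the second
coordinate from the first strip condition.\<close>
lemma parallelogram_area:
  fixes x y a1 a2 b1 b2 U V :: real
  assumes "a1 \<noteq> 0" and D: "a1 * b2 - a2 * b1 \<noteq> 0" and UV: "0 \<le> U" "0 \<le> V"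
  shows "(\<integral>\<^sup>+p. indicator {-U..U} (x + fst p * a1 + snd p * a2)
            * indicator {-V..V} (y + fst p * b1 + snd p * b2) \<partial>(lborel \<Otimes>\<^sub>M lborel))
         = ennreal (4 * U * V / \<bar>a1 * b2 - a2 * b1\<bar>)"
    (is "?I = _")
proof -
  let ?F = "\<lambda>s t. indicator {-U..U} (x + s * a1 + t * a2) * indicator {-V..V} (y + s * b1 + t * b2) :: ennreal"
  let ?D = "a1 * b2 - a2 * b1"
  have "?I = (\<integral>\<^sup>+t. \<integral>\<^sup>+s. ?F s t \<partial>lborel \<partial>lborel)"
    by (subst lborel_pair.nn_integral_snd[symmetric]) (auto simp: case_prod_beta')
  also have "\<dots> = (\<integral>\<^sup>+t. \<integral>\<^sup>+s. ?F (- t * a2 / a1 + 1 * s) t \<partial>lborel \<partial>lborel)"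
  proof (rule nn_integral_cong)
    fix t :: real
    show "(\<integral>\<^sup>+s. ?F s t \<partial>lborel) = (\<integral>\<^sup>+s. ?F (- t * a2 / a1 + 1 * s) t \<partial>lborel)"
      by (subst nn_integral_real_affine[where t = "- t * a2 / a1" and c = 1]) auto
  qed
  also have "\<dots> = (\<integral>\<^sup>+s. \<integral>\<^sup>+t. ?F (- t * a2 / a1 + 1 * s) t \<partial>lborel \<partial>lborel)"
    by (rule lborel_pair.Fubini') measurable
  also have "\<dots> = (\<integral>\<^sup>+s. \<integral>\<^sup>+t. indicator {-U..U} (x + a1 * s)
      * indicator {-V..V} ((y + s * b1) + (?D / a1) * t) \<partial>lborel \<partial>lborel)"
  proof (intro nn_integral_cong)
    fix s t :: real
    have "x + (- t * a2 / a1 + 1 * s) * a1 + t * a2 = x + a1 * s"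
      using \<open>a1 \<noteq> 0\<close> by (simp add: field_simps)
    moreover have "y + (- t * a2 / a1 + 1 * s) * b1 + t * b2 = (y + s * b1) + (?D / a1) * t"
      using \<open>a1 \<noteq> 0\<close> by (simp add: field_simps)
    ultimately show "?F (- t * a2 / a1 + 1 * s) t = indicator {-U..U} (x + a1 * s)
      * indicator {-V..V} ((y + s * b1) + (?D / a1) * t)" by (simp only:)
  qed
  also have "\<dots> = (\<integral>\<^sup>+s. indicator {-U..U} (x + a1 * s) * ennreal (2 * V / \<bar>?D / a1\<bar>) \<partial>lborel)"
  proof (rule nn_integral_cong)
    fix s :: real
    have D': "?D / a1 \<noteq> 0" using assms by simp
    have strip_m: "(\<lambda>t. indicator {-V..V} ((y + s * b1) + (?D / a1) * t) :: ennreal) \<in> borel_measurable lborel"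
      by measurable
    show "(\<integral>\<^sup>+t. indicator {-U..U} (x + a1 * s) * indicator {-V..V} ((y + s * b1) + (?D / a1) * t) \<partial>lborel)
      = indicator {-U..U} (x + a1 * s) * ennreal (2 * V / \<bar>?D / a1\<bar>)"
      by (simp only: nn_integral_cmult[OF strip_m] nn_integral_strip[OF D' UV(2)])
  qed
  also have "\<dots> = ennreal (2 * U / \<bar>a1\<bar>) * ennreal (2 * V / \<bar>?D / a1\<bar>)"
    using assms by (simp add: nn_integral_multc nn_integral_strip)
  also have "\<dots> = ennreal (4 * U * V / \<bar>?D\<bar>)"
    using assms by (subst ennreal_mult[symmetric]) (auto simp: abs_divide field_simps)
  finally show ?thesis .
qed

lemma path_shift_measurable:
  fixes f :: "real \<Rightarrow> real"
  shows "(\<lambda>w r. w r + f r) \<in> measurable path_space path_space"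
  by (rule measurable_PiM_single') auto

text \<open>The intervals do not overlap, so the second shift leaves the increment over the first interval unchanged and the two densities
simply multiply.\<close>
lemma cameron_martin_two:
  fixes W :: "real \<Rightarrow> 'a \<Rightarrow> real"
  assumes W: "std_brownian_motion M W"
    and lr: "0 \<le> l1" "l1 < r1" "r1 \<le> l2" "l2 < r2" "r2 \<le> 1"
    and [measurable]: "\<Psi> \<in> borel_measurable path_space"
  shows "(\<integral>\<^sup>+\<omega>. \<Psi> (path_of W \<omega>) \<partial>M)
    = (\<integral>\<^sup>+\<omega>. \<Psi> (\<lambda>r. path_of W \<omega> r + (c1 * ramp l1 r1 r + c2 * ramp l2 r2 r))
        * (ennreal (exp (- c1 * (W r1 \<omega> - W l1 \<omega>) - c1\<^sup>2 * (r1 - l1) / 2))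
          * ennreal (exp (- c2 * (W r2 \<omega> - W l2 \<omega>) - c2\<^sup>2 * (r2 - l2) / 2))) \<partial>M)"
proof -
  define \<Phi> where "\<Phi> w = \<Psi> (\<lambda>r. w r + c1 * ramp l1 r1 r)
    * ennreal (exp (- c1 * (w r1 - w l1) - c1\<^sup>2 * (r1 - l1) / 2))" for w
  note [measurable] = path_shift_measurable[of "\<lambda>r. c1 * ramp l1 r1 r"]
  have [measurable]: "(\<lambda>w. w r) \<in> borel_measurable path_space" for r :: real
    by (rule measurable_component_singleton) simp
  have \<Phi>m: "\<Phi> \<in> borel_measurable path_space"
    unfolding \<Phi>_def by measurable
  have p: "path_of W \<omega> r = W r \<omega>" if "0 \<le> r" "r \<le> 1" for \<omega> r
    using that by (simp add: path_of_def)
  have "(\<integral>\<^sup>+\<omega>. \<Psi> (path_of W \<omega>) \<partial>M) = (\<integral>\<^sup>+\<omega>. \<Phi> (path_of W \<omega>) \<partial>M)"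
    using lr unfolding \<Phi>_def by (subst cameron_martin_nn_integral[OF W, of l1 r1 \<Psi> c1]) (simp_all add: p)
  also have "\<dots> = (\<integral>\<^sup>+\<omega>. \<Phi> (\<lambda>r. path_of W \<omega> r + c2 * ramp l2 r2 r)
      * ennreal (exp (- c2 * (W r2 \<omega> - W l2 \<omega>) - c2\<^sup>2 * (r2 - l2) / 2)) \<partial>M)"
    using lr by (intro cameron_martin_nn_integral[OF W] \<Phi>m) auto
  also have "\<dots> = (\<integral>\<^sup>+\<omega>. \<Psi> (\<lambda>r. path_of W \<omega> r + (c1 * ramp l1 r1 r + c2 * ramp l2 r2 r))
        * (ennreal (exp (- c1 * (W r1 \<omega> - W l1 \<omega>) - c1\<^sup>2 * (r1 - l1) / 2))
          * ennreal (exp (- c2 * (W r2 \<omega> - W l2 \<omega>) - c2\<^sup>2 * (r2 - l2) / 2))) \<partial>M)"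
    using lr by (intro nn_integral_cong) (simp add: \<Phi>_def p ramp_def mult.assoc add_ac)
  finally show ?thesis .
qed

lemma AE_path_continuous:
  assumes "std_brownian_motion M W"
  shows "AE \<omega> in M. continuous_on UNIV (path_of W \<omega>)"
proof -
  have "AE \<omega> in M. continuous_on {0..1} (\<lambda>s. W s \<omega>)"
    using assms by (simp add: std_brownian_motion_def)
  then show ?thesis
  proof (rule AE_mp, intro AE_I2 impI)
    fix \<omega> assume c: "continuous_on {0..1} (\<lambda>s. W s \<omega>)"
    have "continuous_on UNIV clamp01" unfolding clamp01_def by (intro continuous_intros)
    then show "continuous_on UNIV (path_of W \<omega>)"
      unfolding path_of_def by (intro continuous_on_compose2[OF c]) auto
  qed
qed

lemma ramp_continuous: "continuous_on UNIV (ramp a b)"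
  unfolding ramp_def by (intro continuous_intros)

text \<open>The density of the shift with parameter \<open>s\<close> is dominated by a combination of the densities for \<open>s = 0\<close> and \<open>s = 1\<close>. The weight
that is left after averaging over \<open>s\<close> is thus again a combination of shift densities and disappears when the path is
shifted back.\<close>
lemma exp_interpolate:
  fixes s x :: real
  assumes "0 \<le> s" "s \<le> 1"
  shows "exp (- s * x - s\<^sup>2 / 2) \<le> 1 + exp (1/2) * exp (- x - 1/2)"
proof (cases "0 \<le> x")
  case True
  then have "0 \<le> s * x" using assms by simp
  then have "- s * x - s\<^sup>2 / 2 \<le> 0" using zero_le_power2[of s] by linarith
  then have "exp (- s * x - s\<^sup>2 / 2) \<le> 1" by simp
  then show ?thesis by (smt (verit) exp_gt_zero mult_pos_pos)
next
  case False
  then have "s * (- x) \<le> 1 * (- x)" using assms by (intro mult_right_mono) auto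
  then have "- s * x - s\<^sup>2 / 2 \<le> - x" by (smt (verit) minus_mult_commute mult_cancel_right1 zero_le_power2 divide_nonneg_pos)
  then have "exp (- s * x - s\<^sup>2 / 2) \<le> exp (1/2) * exp (- x - 1/2)"
    by (simp add: exp_add[symmetric])
  then show ?thesis by simp
qed

text \<open>For every \<open>(s1, s2)\<close> in the unit square the probability equals the weighted probability of the shifted event.
Integrate over the square and exchange the integrals. For a fixed path, \<open>X\<close> and \<open>Y\<close> move along an affine map with
determinant \<open>a1 b2 - a2 b1\<close> while \<open>Q\<close> stays below \<open>Q + m\<close>, so the inner integral is at most the area of a
parallelogram, of order \<open>A B (Q + m)\<^sup>2 / |a1 b2 - a2 b1|\<close>. The remaining weight is dominated by shift densities for
parameters in \<open>{0, 1}\<close>. Shifting back turns each of them into \<open>1\<close> at the cost of replacing \<open>m\<close> by \<open>2 m\<close>.\<close>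
theorem gaussian_anticoncentration:
  fixes W :: "real \<Rightarrow> 'a \<Rightarrow> real" and X Y Q :: "(real \<Rightarrow> real) \<Rightarrow> real"
  assumes W: "std_brownian_motion M W"
    and lr: "0 \<le> l1" "l1 < r1" "r1 \<le> l2" "l2 < r2" "r2 \<le> 1"
    and c: "c\<^sup>2 * (r1 - l1) = 1" "c\<^sup>2 * (r2 - l2) = 1"
    and XYQ[measurable]: "X \<in> borel_measurable path_space" "Y \<in> borel_measurable path_space"
      "Q \<in> borel_measurable path_space"
    and X: "\<And>w s1 s2. continuous_on UNIV w \<Longrightarrow>
      X (\<lambda>r. w r + (s1 * c * ramp l1 r1 r + s2 * c * ramp l2 r2 r)) = X w + s1 * a1 + s2 * a2"
    and Y: "\<And>w s1 s2. continuous_on UNIV w \<Longrightarrow>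
      Y (\<lambda>r. w r + (s1 * c * ramp l1 r1 r + s2 * c * ramp l2 r2 r)) = Y w + s1 * b1 + s2 * b2"
    and Q: "\<And>w s1 s2. continuous_on UNIV w \<Longrightarrow> \<bar>s1\<bar> \<le> 1 \<Longrightarrow> \<bar>s2\<bar> \<le> 1 \<Longrightarrow>
      Q (\<lambda>r. w r + (s1 * c * ramp l1 r1 r + s2 * c * ramp l2 r2 r)) \<le> Q w + m"
    and Q0: "\<And>w. continuous_on UNIV w \<Longrightarrow> 0 \<le> Q w" and m: "0 \<le> m"
    and a1: "a1 \<noteq> 0" and D: "a1 * b2 - a2 * b1 \<noteq> 0" and AB: "0 \<le> A" "0 \<le> B"
  shows "emeasure M {\<omega> \<in> space M. \<bar>X (path_of W \<omega>)\<bar> \<le> A * Q (path_of W \<omega>) \<and> \<bar>Y (path_of W \<omega>)\<bar> \<le> B * Q (path_of W \<omega>)}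
    \<le> ennreal (4 * (1 + exp (1/2))\<^sup>2 * A * B / \<bar>a1 * b2 - a2 * b1\<bar>)
        * (\<integral>\<^sup>+\<omega>. ennreal ((Q (path_of W \<omega>) + 2 * m)\<^sup>2) \<partial>M)"
    (is "emeasure M ?S \<le> _")
proof -
  interpret prob_space M using W by (simp add: std_brownian_motion_def)
  note [measurable] = path_of_measurable[OF W]
  have [measurable]: "W r1 \<in> borel_measurable M" "W l1 \<in> borel_measurable M"
    "W r2 \<in> borel_measurable M" "W l2 \<in> borel_measurable M"
    using W lr by (auto simp: std_brownian_motion_def)
  let ?\<psi> = "\<lambda>s1 s2 r. s1 * c * ramp l1 r1 r + s2 * c * ramp l2 r2 r"
  let ?p = "path_of W"
  define d where "d = (\<lambda>i::bool. \<lambda>\<omega>. c * (if i then W r2 \<omega> - W l2 \<omega> else W r1 \<omega> - W l1 \<omega>))"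
  define z where "z i s \<omega> = exp (- s * d i \<omega> - s\<^sup>2 / 2)" for i s \<omega>
  have dm[measurable]: "d i \<in> borel_measurable M" for i
    unfolding d_def by (cases i) auto
  have zm[measurable]: "z i s \<in> borel_measurable M" for i s
    unfolding z_def by measurable
  have z0: "z i s \<omega> \<ge> 0" for i s \<omega> by (simp add: z_def)
  have zz: "ennreal (exp (- (s1 * c) * (W r1 \<omega> - W l1 \<omega>) - (s1 * c)\<^sup>2 * (r1 - l1) / 2))
          * ennreal (exp (- (s2 * c) * (W r2 \<omega> - W l2 \<omega>) - (s2 * c)\<^sup>2 * (r2 - l2) / 2))
      = ennreal (z False s1 \<omega> * z True s2 \<omega>)" for s1 s2 \<omega>
  proof -
    have "(s1 * c)\<^sup>2 * (r1 - l1) = s1\<^sup>2" "(s2 * c)\<^sup>2 * (r2 - l2) = s2\<^sup>2"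
      using c by (simp_all add: power_mult_distrib mult.assoc)
    then show ?thesis
      by (simp add: ennreal_mult z_def d_def mult.assoc)
  qed
  have cm: "(\<integral>\<^sup>+\<omega>. \<Psi> (?p \<omega>) \<partial>M) = (\<integral>\<^sup>+\<omega>. \<Psi> (\<lambda>r. ?p \<omega> r + ?\<psi> s1 s2 r) * ennreal (z False s1 \<omega> * z True s2 \<omega>) \<partial>M)"
    if "\<Psi> \<in> borel_measurable path_space" for \<Psi> s1 s2
    using cameron_martin_two[OF W lr that, of "s1 * c" "s2 * c"] by (simp only: zz)
  note AEc = AE_path_continuous[OF W]
  define R where "R \<omega> = Q (?p \<omega>) + m" for \<omega>
  have Rm[measurable]: "R \<in> borel_measurable M" unfolding R_def by measurable
  define E where "E = (\<integral>\<^sup>+\<omega>. ennreal ((Q (?p \<omega>) + 2 * m)\<^sup>2) \<partial>M)"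
  have RZ: "(\<integral>\<^sup>+\<omega>. ennreal ((R \<omega>)\<^sup>2) * ennreal (z False s1 \<omega> * z True s2 \<omega>) \<partial>M) \<le> E"
    if s: "s1 \<in> {0, 1}" "s2 \<in> {0, 1}" for s1 s2
  proof -
    define \<Psi> where "\<Psi> w = ennreal ((Q (\<lambda>r. w r + ?\<psi> (-s1) (-s2) r) + m)\<^sup>2)" for w
    note [measurable] = path_shift_measurable[of "?\<psi> (-s1) (-s2)"]
    have "\<Psi> \<in> borel_measurable path_space" unfolding \<Psi>_def by measurable
    from cm[OF this, of s1 s2]
    have "(\<integral>\<^sup>+\<omega>. ennreal ((R \<omega>)\<^sup>2) * ennreal (z False s1 \<omega> * z True s2 \<omega>) \<partial>M) = (\<integral>\<^sup>+\<omega>. \<Psi> (?p \<omega>) \<partial>M)"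
      by (simp add: \<Psi>_def R_def)
    also have "\<dots> \<le> E"
      unfolding E_def
    proof (rule nn_integral_mono_AE, rule AE_mp[OF AEc AE_I2], intro impI)
      fix \<omega> assume co: "continuous_on UNIV (?p \<omega>)"
      have "continuous_on UNIV (\<lambda>r. ?p \<omega> r + ?\<psi> (-s1) (-s2) r)"
        by (intro continuous_intros co ramp_continuous)
      from Q0[OF this] Q[OF co, of "-s1" "-s2"] s m
      show "\<Psi> (?p \<omega>) \<le> ennreal ((Q (?p \<omega>) + 2 * m)\<^sup>2)"
        unfolding \<Psi>_def by (intro ennreal_leI power_mono) auto
    qed
    finally show ?thesis .
  qed
  define e where "e = exp (1/2 :: real)"
  have e0: "e \<ge> 0" by (simp add: e_def)
  \<comment> \<open>The factor \<open>e = exp (1/2)\<close> compensates the normalisation \<open>- s\<^sup>2 / 2\<close> of the density at \<open>s = 1\<close>.\<close>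
  define \<zeta> where "\<zeta> \<omega> = (1 + e * z False 1 \<omega>) * (1 + e * z True 1 \<omega>)" for \<omega>
  have \<zeta>m[measurable]: "\<zeta> \<in> borel_measurable M" unfolding \<zeta>_def by measurable
  have \<zeta>0: "\<zeta> \<omega> \<ge> 0" for \<omega> using e0 z0 by (simp add: \<zeta>_def)
  have R\<zeta>: "(\<integral>\<^sup>+\<omega>. ennreal ((R \<omega>)\<^sup>2) * ennreal (\<zeta> \<omega>) \<partial>M) \<le> ennreal ((1 + e)\<^sup>2) * E"
  proof -
    let ?T = "\<lambda>s1 s2 \<omega>. ennreal ((R \<omega>)\<^sup>2) * ennreal (z False s1 \<omega> * z True s2 \<omega>)"
    have z00: "z i 0 \<omega> = 1" for i \<omega> by (simp add: z_def)
    have "(\<integral>\<^sup>+\<omega>. ennreal ((R \<omega>)\<^sup>2) * ennreal (\<zeta> \<omega>) \<partial>M)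
      = (\<integral>\<^sup>+\<omega>. ?T 0 0 \<omega> + ennreal e * ?T 1 0 \<omega> + ennreal e * ?T 0 1 \<omega> + ennreal (e * e) * ?T 1 1 \<omega> \<partial>M)"
    proof (rule nn_integral_cong)
      fix \<omega>
      have "ennreal (\<zeta> \<omega>) = ennreal (z False 0 \<omega> * z True 0 \<omega>) + ennreal e * ennreal (z False 1 \<omega> * z True 0 \<omega>)
        + ennreal e * ennreal (z False 0 \<omega> * z True 1 \<omega>) + ennreal (e * e) * ennreal (z False 1 \<omega> * z True 1 \<omega>)"
        unfolding \<zeta>_def z00 using e0 z0
        by (simp add: ennreal_mult[symmetric] ennreal_plus[symmetric] del: ennreal_plus) (simp add: algebra_simps)
      then show "ennreal ((R \<omega>)\<^sup>2) * ennreal (\<zeta> \<omega>) = ?T 0 0 \<omega> + ennreal e * ?T 1 0 \<omega> + ennreal e * ?T 0 1 \<omega> + ennreal (e * e) * ?T 1 1 \<omega>"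
        by (simp only: distrib_left) (simp only: mult_ac)
    qed
    also have "\<dots> = (\<integral>\<^sup>+\<omega>. ?T 0 0 \<omega> \<partial>M) + ennreal e * (\<integral>\<^sup>+\<omega>. ?T 1 0 \<omega> \<partial>M)
        + ennreal e * (\<integral>\<^sup>+\<omega>. ?T 0 1 \<omega> \<partial>M) + ennreal (e * e) * (\<integral>\<^sup>+\<omega>. ?T 1 1 \<omega> \<partial>M)"
      by (simp add: nn_integral_add nn_integral_cmult del: ennreal_mult')
    also have "\<dots> \<le> E + ennreal e * E + ennreal e * E + ennreal (e * e) * E"
      by (intro add_mono mult_left_mono RZ) auto
    also have "\<dots> = (ennreal 1 + ennreal e + ennreal e + ennreal (e * e)) * E"
      by (simp add: distrib_right)
    also have "ennreal 1 + ennreal e + ennreal e + ennreal (e * e) = ennreal ((1 + e)\<^sup>2)"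
    proof -
      have "(1 + e)\<^sup>2 = 1 + e + e + e * e" by (simp add: power2_eq_square algebra_simps)
      then have "ennreal ((1 + e)\<^sup>2) = ennreal (1 + e + e + e * e)" by (simp only:)
      then show ?thesis
        using e0 by (simp only: ennreal_plus add_nonneg_nonneg mult_nonneg_nonneg zero_le_one)
    qed
    finally show ?thesis .
  qed
  define J where "J p \<omega> = indicator {- (A * R \<omega>)..A * R \<omega>} (X (?p \<omega>) + fst p * a1 + snd p * a2)
      * indicator {- (B * R \<omega>)..B * R \<omega>} (Y (?p \<omega>) + fst p * b1 + snd p * b2) * ennreal (\<zeta> \<omega>)" for p \<omega>
  have Jm: "(\<lambda>(p, \<omega>). J p \<omega>) \<in> borel_measurable ((lborel \<Otimes>\<^sub>M lborel) \<Otimes>\<^sub>M M)"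
    unfolding J_def atLeastAtMost_iff indicator_def by measurable
  define \<Psi> where "\<Psi> w = (if \<bar>X w\<bar> \<le> A * Q w \<and> \<bar>Y w\<bar> \<le> B * Q w then 1 else 0 :: ennreal)" for w
  have \<Psi>m: "\<Psi> \<in> borel_measurable path_space"
  proof -
    have "{w \<in> space path_space. \<bar>X w\<bar> \<le> A * Q w} \<in> sets path_space"
      "{w \<in> space path_space. \<bar>Y w\<bar> \<le> B * Q w} \<in> sets path_space"
      by (intro borel_measurable_le borel_measurable_abs borel_measurable_times borel_measurable_const XYQ)+
    then show ?thesis unfolding \<Psi>_def
      by (intro measurable_If measurable_const sets.sets_Collect_conj) auto
  qed
  have S: "emeasure M ?S = (\<integral>\<^sup>+\<omega>. \<Psi> (?p \<omega>) \<partial>M)"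
  proof -
    have "?S \<in> sets M" by measurable
    then have "emeasure M ?S = (\<integral>\<^sup>+\<omega>. indicator ?S \<omega> \<partial>M)" by simp
    also have "\<dots> = (\<integral>\<^sup>+\<omega>. \<Psi> (?p \<omega>) \<partial>M)"
      by (intro nn_integral_cong) (auto simp: \<Psi>_def indicator_def)
    finally show ?thesis .
  qed
  have pt: "emeasure M ?S \<le> (\<integral>\<^sup>+\<omega>. J p \<omega> \<partial>M)" if p: "p \<in> {0..1} \<times> {0..1}" for p
  proof -
    obtain s1 s2 where ps: "p = (s1, s2)" by (cases p)
    have s: "0 \<le> s1" "s1 \<le> 1" "0 \<le> s2" "s2 \<le> 1" using p ps by auto
    have "emeasure M ?S = (\<integral>\<^sup>+\<omega>. \<Psi> (\<lambda>r. ?p \<omega> r + ?\<psi> s1 s2 r) * ennreal (z False s1 \<omega> * z True s2 \<omega>) \<partial>M)"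
      unfolding S by (rule cm[OF \<Psi>m])
    also have "\<dots> \<le> (\<integral>\<^sup>+\<omega>. J p \<omega> \<partial>M)"
    proof (rule nn_integral_mono_AE, rule AE_mp[OF AEc AE_I2], intro impI)
      fix \<omega> assume co: "continuous_on UNIV (?p \<omega>)"
      have Qle: "Q (\<lambda>r. ?p \<omega> r + ?\<psi> s1 s2 r) \<le> R \<omega>"
        unfolding R_def by (rule Q[OF co]) (use s in auto)
      have AQ: "A * Q (\<lambda>r. ?p \<omega> r + ?\<psi> s1 s2 r) \<le> A * R \<omega>" "B * Q (\<lambda>r. ?p \<omega> r + ?\<psi> s1 s2 r) \<le> B * R \<omega>"
        using Qle AB by (auto intro: mult_left_mono)
      have "z False s1 \<omega> * z True s2 \<omega> \<le> \<zeta> \<omega>"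
        unfolding \<zeta>_def z_def e_def using s exp_interpolate[of s1 "d False \<omega>"] exp_interpolate[of s2 "d True \<omega>"]
        by (intro mult_mono) auto
      then show "\<Psi> (\<lambda>r. ?p \<omega> r + ?\<psi> s1 s2 r) * ennreal (z False s1 \<omega> * z True s2 \<omega>) \<le> J p \<omega>"
        using AQ unfolding \<Psi>_def J_def ps X[OF co] Y[OF co] by (auto simp: indicator_def intro!: ennreal_leI)
    qed
    finally show ?thesis .
  qed
  interpret lb: sigma_finite_measure "lborel \<Otimes>\<^sub>M lborel :: (real \<times> real) measure"
    by (simp add: lborel_prod sigma_finite_lborel)
  interpret pr: pair_sigma_finite "lborel \<Otimes>\<^sub>M lborel :: (real \<times> real) measure" M
    by unfold_locales
  have sq: "emeasure (lborel \<Otimes>\<^sub>M lborel) ({0..1 :: real} \<times> {0..1 :: real}) = 1"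
    by (subst lborel.emeasure_pair_measure_Times) auto
  have sqm: "({0..1 :: real} \<times> {0..1 :: real}) \<in> sets (lborel \<Otimes>\<^sub>M lborel)"
    by simp
  have "emeasure M ?S = (\<integral>\<^sup>+p. indicator ({0..1 :: real} \<times> {0..1 :: real}) p * emeasure M ?S \<partial>(lborel \<Otimes>\<^sub>M lborel))"
    by (simp only: nn_integral_multc[OF borel_measurable_indicator[OF sqm]] nn_integral_indicator[OF sqm] sq mult_1)
  also have "\<dots> \<le> (\<integral>\<^sup>+p. \<integral>\<^sup>+\<omega>. J p \<omega> \<partial>M \<partial>(lborel \<Otimes>\<^sub>M lborel))"
    using pt by (intro nn_integral_mono) (auto simp: indicator_def)
  also have "\<dots> = (\<integral>\<^sup>+\<omega>. \<integral>\<^sup>+p. J p \<omega> \<partial>(lborel \<Otimes>\<^sub>M lborel) \<partial>M)"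
    by (rule pr.Fubini'[symmetric, OF Jm])
  also have "\<dots> \<le> (\<integral>\<^sup>+\<omega>. ennreal (4 * A * B / \<bar>a1 * b2 - a2 * b1\<bar>) * (ennreal ((R \<omega>)\<^sup>2) * ennreal (\<zeta> \<omega>)) \<partial>M)"
  proof (rule nn_integral_mono_AE, rule AE_mp[OF AEc AE_I2], intro impI)
    fix \<omega> assume "continuous_on UNIV (?p \<omega>)"
    then have R0: "0 \<le> R \<omega>" using Q0 m by (auto simp: R_def)
    have "(\<integral>\<^sup>+p. J p \<omega> \<partial>(lborel \<Otimes>\<^sub>M lborel)) = ennreal (4 * (A * R \<omega>) * (B * R \<omega>) / \<bar>a1 * b2 - a2 * b1\<bar>) * ennreal (\<zeta> \<omega>)"
      unfolding J_def using a1 D AB R0 by (subst nn_integral_multc) (auto simp: parallelogram_area)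
    also have "4 * (A * R \<omega>) * (B * R \<omega>) / \<bar>a1 * b2 - a2 * b1\<bar> = (4 * A * B / \<bar>a1 * b2 - a2 * b1\<bar>) * (R \<omega>)\<^sup>2"
      by (simp add: power2_eq_square)
    also have "ennreal ((4 * A * B / \<bar>a1 * b2 - a2 * b1\<bar>) * (R \<omega>)\<^sup>2)
        = ennreal (4 * A * B / \<bar>a1 * b2 - a2 * b1\<bar>) * ennreal ((R \<omega>)\<^sup>2)"
      using AB by (intro ennreal_mult) auto
    finally show "(\<integral>\<^sup>+p. J p \<omega> \<partial>(lborel \<Otimes>\<^sub>M lborel))
        \<le> ennreal (4 * A * B / \<bar>a1 * b2 - a2 * b1\<bar>) * (ennreal ((R \<omega>)\<^sup>2) * ennreal (\<zeta> \<omega>))"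
      by (simp only: mult.assoc order_refl)
  qed
  also have "\<dots> = ennreal (4 * A * B / \<bar>a1 * b2 - a2 * b1\<bar>) * (\<integral>\<^sup>+\<omega>. ennreal ((R \<omega>)\<^sup>2) * ennreal (\<zeta> \<omega>) \<partial>M)"
    by (rule nn_integral_cmult) measurable
  also have "\<dots> \<le> ennreal (4 * A * B / \<bar>a1 * b2 - a2 * b1\<bar>) * (ennreal ((1 + e)\<^sup>2) * E)"
    by (intro mult_left_mono R\<zeta>) auto
  also have "\<dots> = ennreal (4 * (1 + e)\<^sup>2 * A * B / \<bar>a1 * b2 - a2 * b1\<bar>) * E"
    using AB by (simp add: mult.assoc[symmetric] ennreal_mult[symmetric]) (simp add: mult_ac)
  finally show ?thesis unfolding E_def e_def .
qed

section \<open>The kernels of the Conga line\<close>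

text \<open>The parameter \<open>s\<close> stands for \<open>\<sigma> / sqrt t\<close>; the dependence on \<open>t\<close> enters only through it.\<close>
locale conga_kernel =
  fixes \<alpha> s :: real
  assumes \<alpha>: "0 < \<alpha>" "\<alpha> < 1" and s: "0 < s" "s \<le> 1"
begin

text \<open>The quotient \<open>V y z / sqrt z\<close> is the argument of the Gaussian factor. Keeping \<open>sqrt z\<close> apart leaves all remaining
factors polynomial in \<open>y\<close> and \<open>z\<close>.\<close>
definition V :: "real \<Rightarrow> real \<Rightarrow> real" where
  "V y z = (y - \<alpha> * z) / s"

definition E :: "real \<Rightarrow> real \<Rightarrow> real" where
  "E y z = exp (- (V y z)\<^sup>2 / (2 * z))"

text \<open>All kernels have this form, which is preserved by differentiation in \<open>y\<close>. At \<open>z = 0\<close> the division by zero gives the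
value \<open>0\<close>, which is the continuous extension for \<open>y > 0\<close>.\<close>
definition kern :: "nat \<Rightarrow> (real \<Rightarrow> real \<Rightarrow> real) \<Rightarrow> real \<Rightarrow> real \<Rightarrow> real" where
  "kern m R y z = 1 / (2 * s * sqrt (2 * pi)) * R y z / (z ^ m * sqrt z) * E y z"

lemma kern_0 [simp]: "kern m R y 0 = 0"
  by (simp add: kern_def)

lemma kern_has_derivative:
  assumes R: "((\<lambda>y. R y z) has_real_derivative R' y z) (at y within U)" and z: "0 \<le> z"
  shows "((\<lambda>y. kern m R y z) has_real_derivative kern (Suc m) (\<lambda>y z. z * R' y z - R y z * V y z / s) y z) (at y within U)"
proof (cases "z = 0")
  case True
  then show ?thesis by simp
next
  case False
  with z have z: "0 < z" by simp
  have V: "((\<lambda>y. V y z) has_real_derivative 1 / s) (at y within U)"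
    unfolding V_def using s by (auto intro!: derivative_eq_intros)
  have E: "((\<lambda>y. E y z) has_real_derivative - V y z / (s * z) * E y z) (at y within U)"
    unfolding E_def using z s by (auto intro!: derivative_eq_intros V simp: field_simps)
  show ?thesis
    unfolding kern_def using z s
    by (auto intro!: derivative_eq_intros R E simp: field_simps)
qed

lemma le_power_exp:
  fixes x :: real
  assumes "0 \<le> x" "0 < n"
  shows "(x / real n) ^ n \<le> exp x"
proof -
  have "x / real n \<le> exp (x / real n)" using exp_ge_add_one_self[of "x / real n"] by linarith
  then have "(x / real n) ^ n \<le> exp (x / real n) ^ n" using assms by (intro power_mono) auto
  also have "\<dots> = exp x" using assms by (simp add: exp_of_nat_mult[symmetric])
  finally show ?thesis .
qed

text \<open>For small \<open>z\<close> the exponent is at most \<open>- c / z\<close>, which beats every power of \<open>z\<close>; for the other \<open>z\<close> a power of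
\<open>z\<close> is bounded below.\<close>
lemma E_le_power:
  assumes a: "0 < a" and n: "0 < n"
  shows "\<exists>C\<ge>0. \<forall>y z :: real. a \<le> y \<and> 0 < z \<longrightarrow> E y z \<le> C * z ^ n"
proof (intro exI conjI allI impI)
  define c where "c = a\<^sup>2 / (8 * s\<^sup>2)"
  have c: "c > 0" using a s by (simp add: c_def)
  let ?C = "(real n / c) ^ n + (2 * \<alpha> / a) ^ n"
  have C: "0 \<le> (real n / c) ^ n" "0 \<le> (2 * \<alpha> / a) ^ n" using a c \<alpha> by auto
  then show "0 \<le> ?C" by simp
  fix y z :: real assume "a \<le> y \<and> 0 < z"
  then have y: "a \<le> y" and z: "0 < z" by auto
  show "E y z \<le> ?C * z ^ n"
  proof (cases "\<alpha> * z \<le> a / 2")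
    case True
    then have "a / (2 * s) \<le> V y z" using y s by (simp add: V_def field_simps)
    moreover have "0 \<le> a / (2 * s)" using a s by simp
    ultimately have "(a / (2 * s))\<^sup>2 \<le> (V y z)\<^sup>2" by (rule power_mono)
    then have "(a / (2 * s))\<^sup>2 / (2 * z) \<le> (V y z)\<^sup>2 / (2 * z)" using z by (intro divide_right_mono) auto
    moreover have "(a / (2 * s))\<^sup>2 / (2 * z) = c / z" by (simp add: c_def power_divide power_mult_distrib)
    ultimately have "E y z \<le> exp (- (c / z))" by (simp add: E_def)
    also have "\<dots> \<le> 1 / ((c / z) / real n) ^ n"
      using le_power_exp[of "c / z" n] c z n by (simp add: exp_minus inverse_eq_divide frac_le)
    also have "\<dots> = (real n / c) ^ n * z ^ n"
      using c z n by (simp add: power_divide power_mult_distrib field_simps)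
    also have "\<dots> \<le> ?C * z ^ n" using C z by (intro mult_right_mono) auto
    finally show ?thesis .
  next
    case False
    then have "1 \<le> 2 * \<alpha> / a * z" using a by (simp add: field_simps)
    then have "1 \<le> (2 * \<alpha> / a * z) ^ n" by (rule one_le_power)
    moreover have "E y z \<le> 1" using z by (simp add: E_def)
    ultimately have "E y z \<le> (2 * \<alpha> / a) ^ n * z ^ n" by (simp only: power_mult_distrib)
    also have "\<dots> \<le> ?C * z ^ n" using C z by (intro mult_right_mono) auto
    finally show ?thesis .
  qed
qed

lemma kern_continuous:
  assumes a: "0 < a" and R: "continuous_on UNIV (\<lambda>p. R (fst p) (snd p))"
  shows "continuous_on ({a..b} \<times> {0..1}) (\<lambda>(y, z). kern m R y z)"
  unfolding continuous_on_eq_continuous_within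
proof
  let ?S = "{a..b} \<times> {0..1 :: real}"
  fix p assume p: "p \<in> ?S"
  obtain y z where pyz: "p = (y, z)" by (cases p)
  show "continuous (at p within ?S) (\<lambda>(y, z). kern m R y z)"
  proof (cases "z = 0")
    case False
    then have z: "0 < snd p" using p pyz by auto
    have R': "isCont (\<lambda>p. R (fst p) (snd p)) p"
      using R continuous_on_eq_continuous_at[OF open_UNIV] by blast
    have "isCont (\<lambda>p. kern m R (fst p) (snd p)) p"
      unfolding kern_def E_def V_def using z s by (intro continuous_intros R') auto
    then show ?thesis by (simp add: case_prod_beta' continuous_at_imp_continuous_at_within)
  next
    case True
    have "compact ?S" by (intro compact_Times compact_Icc)
    moreover have "continuous_on ?S (\<lambda>p. R (fst p) (snd p))" using R by (rule continuous_on_subset) auto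
    ultimately have "bounded ((\<lambda>p. R (fst p) (snd p)) ` ?S)"
      by (intro compact_imp_bounded compact_continuous_image)
    then obtain B where "\<forall>x\<in>(\<lambda>p. R (fst p) (snd p)) ` ?S. norm x \<le> B"
      unfolding bounded_iff by blast
    then have B: "\<bar>R (fst q) (snd q)\<bar> \<le> B" if "q \<in> ?S" for q
      using that by fastforce
    obtain C where C: "0 \<le> C" "\<And>y z. a \<le> y \<Longrightarrow> 0 < z \<Longrightarrow> E y z \<le> C * z ^ (m + 2)"
      using E_le_power[OF a, of "m + 2"] by auto
    define c where "c = 1 / (2 * s * sqrt (2 * pi))"
    have c: "c \<ge> 0" using s by (simp add: c_def)
    have bd: "\<bar>kern m R (fst q) (snd q)\<bar> \<le> c * B * C * snd q" if q: "q \<in> ?S" for q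
    proof (cases "snd q = 0")
      case False
      then have z: "0 < snd q" "snd q \<le> 1" "a \<le> fst q" using q by auto
      have B0: "0 \<le> B" using B[OF q] by linarith
      have "\<bar>kern m R (fst q) (snd q)\<bar> = c * \<bar>R (fst q) (snd q)\<bar> * (E (fst q) (snd q) / (snd q ^ m * sqrt (snd q)))"
        using z c by (simp add: kern_def c_def[symmetric] abs_mult E_def)
      also have "\<dots> \<le> c * B * (C * snd q ^ (m + 2) / (snd q ^ m * sqrt (snd q)))"
        using z c B[OF q] C B0 by (intro mult_mono divide_right_mono) (auto simp: E_def)
      also have "C * snd q ^ (m + 2) / (snd q ^ m * sqrt (snd q)) = C * snd q * sqrt (snd q)"
        using z by (simp add: power_add field_simps power2_eq_square)
      also have "c * B * (C * snd q * sqrt (snd q)) \<le> c * B * (C * snd q * 1)"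
        using z c B0 C(1) by (intro mult_left_mono) auto
      finally show ?thesis by (simp add: mult.assoc)
    qed auto
    have "((\<lambda>q. c * B * C * snd q) \<longlongrightarrow> c * B * C * snd p) (at p within ?S)"
      by (intro tendsto_intros)
    then have "((\<lambda>q. c * B * C * snd q) \<longlongrightarrow> 0) (at p within ?S)"
      using True pyz by simp
    then have "((\<lambda>q. kern m R (fst q) (snd q)) \<longlongrightarrow> 0) (at p within ?S)"
      by (rule Lim_null_comparison[rotated]) (auto simp: eventually_at_filter bd)
    then show ?thesis
      using True pyz by (simp add: continuous_within case_prod_beta')
  qed
qed

text \<open>The polynomials of the kernel \<open>g0\<close> of the Conga line and of its first three derivatives \<open>g1\<close>, \<open>g2\<close>, \<open>g3\<close> in \<open>y\<close>.\<close>
definition R0 where "R0 y z = y + \<alpha> * z"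
definition R1 where "R1 y z = z - R0 y z * V y z / s"
definition R2 where "R2 y z = - 2 * z * V y z / s + R0 y z * ((V y z)\<^sup>2 - z) / s\<^sup>2"
definition R3 where "R3 y z = 3 * z * ((V y z)\<^sup>2 - z) / s\<^sup>2 - R0 y z * ((V y z) ^ 3 - 3 * V y z * z) / s ^ 3"

text \<open>With the standard normal distribution function \<open>\<Phi>\<close>, the kernel \<open>g0\<close> is the \<open>z\<close>-derivative of
\<open>\<Phi> ((\<alpha> z - y) / (s sqrt z))\<close> and \<open>k0\<close> is the \<open>y\<close>-derivative of the same function. Therefore \<open>k0\<close> is a
primitive of \<open>g1\<close> in \<open>z\<close>; \<open>k1\<close> and \<open>k2\<close> are its derivatives in \<open>y\<close>.\<close>
definition "g0 = kern 1 R0"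
definition "g1 = kern 2 R1"
definition "g2 = kern 3 R2"
definition "g3 = kern 4 R3"
definition "k0 = kern 0 (\<lambda>_ _. - 2)"
definition "k1 = kern 1 (\<lambda>y z. 2 * V y z / s)"
definition "k2 = kern 2 (\<lambda>y z. 2 * (z - (V y z)\<^sup>2) / s\<^sup>2)"

lemmas g_defs = g0_def g1_def g2_def g3_def k0_def k1_def k2_def

lemma V_continuous: "continuous_on UNIV (\<lambda>p. V (fst p) (snd p))"
  unfolding V_def using s by (intro continuous_intros) auto

lemma R_continuous:
  "continuous_on UNIV (\<lambda>p. R0 (fst p) (snd p))"
  "continuous_on UNIV (\<lambda>p. R1 (fst p) (snd p))"
  "continuous_on UNIV (\<lambda>p. R2 (fst p) (snd p))"
  "continuous_on UNIV (\<lambda>p. R3 (fst p) (snd p))"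
  unfolding R0_def R1_def R2_def R3_def using s by (intro continuous_intros V_continuous; simp)+

lemma V_deriv: "((\<lambda>y. V y z) has_real_derivative 1 / s) (at y within U)"
  unfolding V_def using s by (auto intro!: derivative_eq_intros)

lemma g_derivs:
  assumes "0 \<le> z"
  shows "((\<lambda>y. g0 y z) has_real_derivative g1 y z) (at y within U)"
    "((\<lambda>y. g1 y z) has_real_derivative g2 y z) (at y within U)"
    "((\<lambda>y. g2 y z) has_real_derivative g3 y z) (at y within U)"
    "((\<lambda>y. k0 y z) has_real_derivative k1 y z) (at y within U)"
    "((\<lambda>y. k1 y z) has_real_derivative k2 y z) (at y within U)"
proof -
  have R0': "((\<lambda>y. R0 y z) has_real_derivative 1) (at y within U)"
    unfolding R0_def by (auto intro!: derivative_eq_intros)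
  have R1': "((\<lambda>y. R1 y z) has_real_derivative (- V y z / s - R0 y z / s\<^sup>2)) (at y within U)"
    unfolding R1_def using s
    by (auto intro!: derivative_eq_intros R0' V_deriv simp: field_simps power2_eq_square)
  have R2': "((\<lambda>y. R2 y z) has_real_derivative
      (- 2 * z / s\<^sup>2 + ((V y z)\<^sup>2 - z) / s\<^sup>2 + 2 * R0 y z * V y z / s ^ 3)) (at y within U)"
    unfolding R2_def using s
    by (auto intro!: derivative_eq_intros R0' V_deriv simp: field_simps power2_eq_square power3_eq_cube)
  have eq: "kern m R y z = kern m' R' y z" if "R y z = R' y z" "m = m'" for m m' R R'
    using that by (simp add: kern_def)
  have "kern (Suc 1) (\<lambda>y z. z * 1 - R0 y z * V y z / s) y z = g1 y z"
    unfolding g1_def by (rule eq) (simp_all add: R1_def)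
  then show "((\<lambda>y. g0 y z) has_real_derivative g1 y z) (at y within U)"
    unfolding g0_def using kern_has_derivative[where R = R0 and R' = "\<lambda>_ _. 1", OF R0' assms, of 1] by simp
  have "kern (Suc 2) (\<lambda>y z. z * (- V y z / s - R0 y z / s\<^sup>2) - R1 y z * V y z / s) y z = g2 y z"
    unfolding g2_def using s
    by (intro eq) (simp_all add: R1_def R2_def field_simps power2_eq_square)
  then show "((\<lambda>y. g1 y z) has_real_derivative g2 y z) (at y within U)"
    unfolding g1_def using kern_has_derivative[where R = R1 and R' = "\<lambda>y z. - V y z / s - R0 y z / s\<^sup>2", OF R1' assms, of 2] by simp
  have "kern (Suc 3) (\<lambda>y z. z * (- 2 * z / s\<^sup>2 + ((V y z)\<^sup>2 - z) / s\<^sup>2 + 2 * R0 y z * V y z / s ^ 3)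
      - R2 y z * V y z / s) y z = g3 y z"
    unfolding g3_def using s
    by (intro eq) (simp_all add: R2_def R3_def field_simps power2_eq_square power3_eq_cube)
  then show "((\<lambda>y. g2 y z) has_real_derivative g3 y z) (at y within U)"
    unfolding g2_def using kern_has_derivative[where R = R2 and R' = "\<lambda>y z. - 2 * z / s\<^sup>2 + ((V y z)\<^sup>2 - z) / s\<^sup>2 + 2 * R0 y z * V y z / s ^ 3", OF R2' assms, of 3] by simp
  have "kern (Suc 0) (\<lambda>y z. z * 0 - (-2) * V y z / s) y z = k1 y z"
    unfolding k1_def by (rule eq) simp_all
  then show "((\<lambda>y. k0 y z) has_real_derivative k1 y z) (at y within U)"
    unfolding k0_def using kern_has_derivative[where R = "\<lambda>_ _. - 2" and R' = "\<lambda>_ _. 0", OF _ assms, of y U 0] by simp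
  have V2: "((\<lambda>y. 2 * V y z / s) has_real_derivative 2 / s\<^sup>2) (at y within U)"
    using s by (auto intro!: derivative_eq_intros V_deriv simp: power2_eq_square)
  have "kern (Suc 1) (\<lambda>y z. z * (2 / s\<^sup>2) - (2 * V y z / s) * V y z / s) y z = k2 y z"
    unfolding k2_def using s by (intro eq) (simp_all add: field_simps power2_eq_square)
  then show "((\<lambda>y. k1 y z) has_real_derivative k2 y z) (at y within U)"
    unfolding k1_def using kern_has_derivative[where R = "\<lambda>y z. 2 * V y z / s" and R' = "\<lambda>_ _. 2 / s\<^sup>2", OF V2 assms, of 1] by simp
qed

lemma k0_deriv_z:
  assumes z: "0 < z"
  shows "((\<lambda>z. k0 y z) has_real_derivative g1 y z) (at z)"
proof -
  have V: "((\<lambda>z. V y z) has_real_derivative - \<alpha> / s) (at z)"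
    unfolding V_def using s by (auto intro!: derivative_eq_intros)
  have E: "((\<lambda>z. E y z) has_real_derivative (V y z * \<alpha> / (s * z) + (V y z)\<^sup>2 / (2 * z\<^sup>2)) * E y z) (at z)"
    unfolding E_def using z s
    by (auto intro!: derivative_eq_intros V simp: field_simps power2_eq_square)
  define c where "c = 1 / (2 * s * sqrt (2 * pi))"
  have k: "k0 y = (\<lambda>z. c * (-2) / sqrt z * E y z)"
    by (auto simp: k0_def kern_def c_def fun_eq_iff)
  have y: "y = s * V y z + \<alpha> * z" using s by (simp add: V_def)
  define r where "r = sqrt z"
  have r: "0 < r" "z = r * r" using z by (simp_all add: r_def)
  let ?e = "V y z * \<alpha> / (s * z) + (V y z)\<^sup>2 / (2 * z\<^sup>2)"
  have q: "((\<lambda>z. c * (-2) / sqrt z) has_real_derivative c / (z * sqrt z)) (at z)"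
  proof -
    have "((\<lambda>z. c * (-2) / sqrt z) has_real_derivative
        (0 * r - c * (-2) * (inverse r / 2)) / (r * r)) (at z)"
      using z unfolding r_def by (intro DERIV_divide DERIV_const DERIV_real_sqrt) auto
    then show ?thesis
      unfolding r_def[symmetric] using r by (simp add: field_simps)
  qed
  have "((\<lambda>z. c * (-2) / sqrt z * E y z) has_real_derivative
      (c / (z * r)) * E y z + ?e * E y z * (c * (-2) / r)) (at z)"
    unfolding r_def by (rule DERIV_mult[OF q E])
  moreover have "(c / (z * r)) * E y z + ?e * E y z * (c * (-2) / r) = g1 y z"
  proof -
    have "R0 y z = s * V y z + 2 * \<alpha> * z" using y by (simp add: R0_def)
    then have R: "R1 y z = z - (s * V y z + 2 * \<alpha> * z) * V y z / s" by (simp add: R1_def)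
    have "g1 y z = c * R1 y z / (z\<^sup>2 * r) * E y z"
      by (simp add: g1_def kern_def c_def r_def)
    also have "\<dots> = (c / (z * r)) * E y z + ?e * E y z * (c * (-2) / r)"
      unfolding R using z s r(1) by (simp add: field_simps power2_eq_square)
    finally show ?thesis by simp
  qed
  ultimately show ?thesis unfolding k by simp
qed

end

text \<open>The factors come from the proof of \<open>g3_le_G\<close>: \<open>704\<close> is \<open>11 \<cdot> 4 ^ 3\<close>, and \<open>9 \<cdot> 14 ^ 7\<close> bounds
\<open>(3 T)\<^sup>2 T ^ 5 exp (- T / 2)\<close>.\<close>
definition kernel_const :: "real \<Rightarrow> real" where
  "kernel_const \<delta> = 9 * 704 * 14 ^ 7 * exp (1/2) / \<delta> ^ 6"

context conga_kernel
begin

lemma g_continuous: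
  assumes "0 < a"
  shows "continuous_on ({a..b} \<times> {0..1}) (\<lambda>(y, z). g0 y z)"
    "continuous_on ({a..b} \<times> {0..1}) (\<lambda>(y, z). g1 y z)"
    "continuous_on ({a..b} \<times> {0..1}) (\<lambda>(y, z). g2 y z)"
    "continuous_on ({a..b} \<times> {0..1}) (\<lambda>(y, z). g3 y z)"
    "continuous_on ({a..b} \<times> {0..1}) (\<lambda>(y, z). k0 y z)"
  unfolding g_defs by (intro kern_continuous assms R_continuous continuous_on_const)+

lemma slice_continuous:
  assumes "\<And>b. continuous_on ({y..b} \<times> {0..1}) (\<lambda>(y, z). g y z)"
  shows "continuous_on {0..1 :: real} (g (y :: real) :: real \<Rightarrow> real)"
proof -
  have "continuous_on {0..1} (\<lambda>z. (\<lambda>(y, z). g y z) (y, z))"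
    by (rule continuous_on_compose2[OF assms[of y]]) (auto intro!: continuous_intros)
  then show ?thesis by simp
qed

lemma g_continuous_z:
  assumes "0 < y"
  shows "continuous_on {0..1} (g0 y)" "continuous_on {0..1} (g1 y)" "continuous_on {0..1} (g2 y)"
    "continuous_on {0..1} (g3 y)" "continuous_on {0..1} (k0 y)"
  by (rule slice_continuous, rule g_continuous[OF assms])+

text \<open>Joint continuity down to \<open>z = 0\<close> lets the derivative pass under the integral.\<close>
lemma leibniz:
  fixes q :: "real \<Rightarrow> real"
  assumes q: "continuous_on {0..1} q" and y: "0 < y"
    and d: "\<And>y z. 0 \<le> z \<Longrightarrow> ((\<lambda>y. ga y z) has_real_derivative gb y z) (at y)"
    and ca: "\<And>a b. 0 < a \<Longrightarrow> continuous_on ({a..b} \<times> {0..1}) (\<lambda>(y, z). ga y z)"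
    and cb: "\<And>a b. 0 < a \<Longrightarrow> continuous_on ({a..b} \<times> {0..1}) (\<lambda>(y, z). gb y z)"
  shows "((\<lambda>y. integral {0..1} (\<lambda>z. q z * ga y z)) has_real_derivative
    integral {0..1} (\<lambda>z. q z * gb y z)) (at y)"
proof -
  let ?U = "{y/2..2*y}"
  have "((\<lambda>y. integral (cbox 0 1) (\<lambda>z. q z * ga y z)) has_real_derivative
    integral (cbox 0 1) (\<lambda>z. q z * gb y z)) (at y within ?U)"
  proof (rule leibniz_rule_field_derivative)
    show "((\<lambda>y. q z * ga y z) has_real_derivative q z * gb u z) (at u within ?U)"
      if "z \<in> cbox 0 1" for u z
      using that by (intro DERIV_cmult has_field_derivative_at_within[OF d]) auto
    show "(\<lambda>z. q z * ga u z) integrable_on cbox 0 1" if "u \<in> ?U" for u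
    proof -
      have "0 < u" using that y by auto
      then have "continuous_on {0..1} (ga u)" by (intro slice_continuous ca)
      then show ?thesis using q
        by (simp add: integrable_continuous_interval continuous_on_mult)
    qed
    have "continuous_on (?U \<times> cbox 0 1) (\<lambda>p. q (snd p))"
      by (rule continuous_on_compose2[OF q]) (auto intro!: continuous_intros)
    moreover have "continuous_on (?U \<times> cbox 0 1) (\<lambda>p. gb (fst p) (snd p))"
      using cb[of "y/2" "2*y"] y by (simp add: case_prod_beta')
    ultimately show "continuous_on (?U \<times> cbox 0 1) (\<lambda>(u, z). q z * gb u z)"
      by (simp add: case_prod_beta' continuous_on_mult)
    show "y \<in> ?U" using y by auto
  qed auto
  moreover have "at y within ?U = at y"
    using y by (intro at_within_interior) simp
  ultimately show ?thesis unfolding cbox_interval by simp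
qed

definition slope :: "(real \<Rightarrow> real) \<Rightarrow> real \<Rightarrow> real" where
  "slope w y = integral {0..1} (\<lambda>z. w (1 - z) * g1 y z)"

lemma reflect_continuous:
  assumes "continuous_on {0..1} w"
  shows "continuous_on {0..1 :: real} (\<lambda>z. w (1 - z) :: real)"
  by (rule continuous_on_compose2[OF assms]) (auto intro!: continuous_intros)

lemma conga_line_eq_integral:
  assumes w: "continuous_on {0..1} w" and y: "0 < y" and t: "conga_sigma \<alpha> t = s"
  shows "conga_line \<alpha> t w y = integral {0..1} (\<lambda>z. w (1 - z) * g0 y z)"
proof -
  have c: "continuous_on {0..1} (\<lambda>z. w (1 - z) * g0 y z)"
    by (intro continuous_on_mult reflect_continuous w g_continuous_z y)
  have "conga_line \<alpha> t w y = (LBINT z:{0..1}. w (1 - z) * g0 y z)"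
    unfolding conga_line_def
  proof (rule set_lebesgue_integral_cong)
    show "\<forall>z. z \<in> {0..1} \<longrightarrow> w (1 - z) * (1 / sqrt (2 * pi)) * ((y + \<alpha> * z) / (2 * conga_sigma \<alpha> t * z powr (3 / 2))) *
        exp (- ((y - \<alpha> * z)\<^sup>2 / (2 * (conga_sigma \<alpha> t)\<^sup>2 * z))) = w (1 - z) * g0 y z"
    proof (intro allI impI)
      fix z :: real assume z: "z \<in> {0..1}"
      have "z powr (3/2) = z * sqrt z"
      proof (cases "z = 0")
        case False
        then have "z powr (1 + 1/2) = z powr 1 * z powr (1/2)" using z by (intro powr_add)
        then show ?thesis using z False by (simp add: powr_half_sqrt)
      qed simp
      moreover have "(y - \<alpha> * z)\<^sup>2 / (2 * s\<^sup>2 * z) = (V y z)\<^sup>2 / (2 * z)"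
        by (simp add: V_def power_divide)
      ultimately show "w (1 - z) * (1 / sqrt (2 * pi)) * ((y + \<alpha> * z) / (2 * conga_sigma \<alpha> t * z powr (3 / 2))) *
        exp (- ((y - \<alpha> * z)\<^sup>2 / (2 * (conga_sigma \<alpha> t)\<^sup>2 * z))) = w (1 - z) * g0 y z"
        unfolding t g0_def kern_def R0_def E_def by (simp add: mult_ac)
    qed
  qed simp
  also have "\<dots> = integral {0..1} (\<lambda>z. w (1 - z) * g0 y z)"
    by (intro set_borel_integral_eq_integral(2) borel_integrable_atLeastAtMost' c)
  finally show ?thesis .
qed

lemma conga_line_derivative:
  assumes w: "continuous_on {0..1} w" and y: "0 < y" and t: "conga_sigma \<alpha> t = s"
  shows "(conga_line \<alpha> t w has_real_derivative slope w y) (at y)"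
proof (rule DERIV_cong_ev[THEN iffD1])
  show "\<forall>\<^sub>F u in nhds y. integral {0..1} (\<lambda>z. w (1 - z) * g0 u z) = conga_line \<alpha> t w u"
    using eventually_nhds_in_open[of "{0<..}" y] y
    by (auto elim!: eventually_mono simp: conga_line_eq_integral[OF w _ t])
  show "((\<lambda>u. integral {0..1} (\<lambda>z. w (1 - z) * g0 u z)) has_real_derivative slope w y) (at y)"
    unfolding slope_def
    by (rule leibniz[OF reflect_continuous[OF w] y g_derivs(1)]) (auto intro: g_continuous)
qed auto

lemma integral_g1:
  assumes "0 < y"
  shows "integral {0..1} (g1 y) = k0 y 1"
proof -
  have "(g1 y has_integral (k0 y 1 - k0 y 0)) {0..1}"
    using assms by (intro fundamental_theorem_of_calculus_interior g_continuous_z)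
      (auto simp: has_real_derivative_iff_has_vector_derivative[symmetric] intro: k0_deriv_z)
  then show ?thesis by (simp add: integral_unique k0_def)
qed

text \<open>Only the fluctuation of the path around a reference value \<open>w0\<close> is integrated against the kernel; the reference value
itself contributes a boundary term at \<open>z = 1\<close>. With \<open>w0\<close> the value of the path at \<open>1 - x / \<alpha>\<close> this gains a factor
\<open>sqrt s\<close> over the crude bound by the supremum of the path.\<close>
lemma slope_centred:
  assumes w: "continuous_on {0..1} w" and y: "0 < y"
  shows "slope w y = integral {0..1} (\<lambda>z. (w (1 - z) - w0) * g1 y z) + w0 * k0 y 1"
proof -
  have "integral {0..1} (\<lambda>z. (w (1 - z) - w0) * g1 y z)
      = integral {0..1} (\<lambda>z. w (1 - z) * g1 y z - w0 * g1 y z)"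
    by (simp add: left_diff_distrib)
  also have "\<dots> = slope w y - w0 * integral {0..1} (g1 y)"
    unfolding slope_def
    by (subst integral_diff)
      (auto intro!: integrable_continuous_interval continuous_on_mult reflect_continuous w g_continuous_z y continuous_on_const)
  finally show ?thesis by (simp add: integral_g1[OF y])
qed

definition slope' :: "(real \<Rightarrow> real) \<Rightarrow> real \<Rightarrow> real \<Rightarrow> real" where
  "slope' w w0 y = integral {0..1} (\<lambda>z. (w (1 - z) - w0) * g2 y z) + w0 * k1 y 1"

definition slope'' :: "(real \<Rightarrow> real) \<Rightarrow> real \<Rightarrow> real \<Rightarrow> real" where
  "slope'' w w0 y = integral {0..1} (\<lambda>z. (w (1 - z) - w0) * g3 y z) + w0 * k2 y 1"

lemma slope_derivs:
  assumes w: "continuous_on {0..1} w" and y: "0 < y"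
  shows "(slope w has_real_derivative slope' w w0 y) (at y)"
    "(slope' w w0 has_real_derivative slope'' w w0 y) (at y)"
proof -
  have q: "continuous_on {0..1} (\<lambda>z. w (1 - z) - w0)"
    by (intro continuous_intros reflect_continuous w)
  show "(slope w has_real_derivative slope' w w0 y) (at y)"
  proof (rule DERIV_cong_ev[THEN iffD1])
    show "\<forall>\<^sub>F u in nhds y. integral {0..1} (\<lambda>z. (w (1 - z) - w0) * g1 u z) + w0 * k0 u 1 = slope w u"
      using eventually_nhds_in_open[of "{0<..}" y] y
      by (auto elim!: eventually_mono simp: slope_centred[OF w, of _ w0])
    show "((\<lambda>u. integral {0..1} (\<lambda>z. (w (1 - z) - w0) * g1 u z) + w0 * k0 u 1) has_real_derivative slope' w w0 y) (at y)"
      unfolding slope'_def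
      by (intro DERIV_add DERIV_cmult leibniz[OF q y] g_derivs g_continuous) auto
  qed auto
  show "(slope' w w0 has_real_derivative slope'' w w0 y) (at y)"
    unfolding slope'_def slope''_def
    by (intro DERIV_add DERIV_cmult leibniz[OF q y] g_derivs g_continuous) auto
qed

text \<open>Envelopes of \<open>g3\<close> and of the boundary term on \<open>[x, x + s]\<close>. The polynomial decay is integrable against
\<open>|z - x / \<alpha>|\<close> and has an elementary primitive.\<close>
definition G :: "real \<Rightarrow> real \<Rightarrow> real \<Rightarrow> real" where
  "G K x z = K / s ^ 4 / (1 + ((\<alpha> * z - x) / s)\<^sup>2)\<^sup>2"

definition H :: "real \<Rightarrow> real \<Rightarrow> real" where
  "H K x = K / s ^ 3 / (1 + ((\<alpha> - x) / s)\<^sup>2)"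

lemma const_le: "1 / (2 * s * sqrt (2 * pi)) \<le> 1 / s"
proof -
  have "1 \<le> 2 * pi" using pi_gt3 by simp
  then have "1 \<le> sqrt (2 * pi)" by (rule real_sqrt_ge_one)
  then have "1 \<le> 2 * sqrt (2 * pi)" by linarith
  then have "s * 1 \<le> s * (2 * sqrt (2 * pi))" using s by (intro mult_left_mono) auto
  then show ?thesis using s by (intro divide_left_mono) auto
qed

text \<open>Moving \<open>y\<close> within \<open>[x, x + s]\<close> changes \<open>V y z\<close> by at most \<open>1\<close>, so decay in \<open>V y z\<close> turns into decay in
the distance of \<open>\<alpha> z\<close> from the fixed point \<open>x\<close>.\<close>
lemma shift_le_T:
  assumes z: "0 < z" "z \<le> 1" and xy: "x \<le> y" "y \<le> x + s"
  shows "1 + ((\<alpha> * z - x) / s)\<^sup>2 \<le> 3 * (1 + (V y z)\<^sup>2 / z)"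
proof -
  define \<zeta> where "\<zeta> = (\<alpha> * z - x) / s"
  define d where "d = (y - x) / s"
  define u where "u = V y z"
  have d: "0 \<le> d" "d \<le> 1" using xy s by (auto simp: d_def)
  have e: "\<zeta> = d - u" using s by (simp add: \<zeta>_def d_def u_def V_def field_simps)
  have "\<zeta>\<^sup>2 + (d + u)\<^sup>2 = 2 * d\<^sup>2 + 2 * u\<^sup>2" unfolding e by (simp add: power2_eq_square algebra_simps)
  moreover have "d\<^sup>2 \<le> 1" using d by (simp add: power_le_one)
  moreover have "u\<^sup>2 \<le> u\<^sup>2 / z"
    using z by (simp add: pos_le_divide_eq mult_left_le)
  moreover have "0 \<le> (d + u)\<^sup>2" "0 \<le> u\<^sup>2 / z" using z by simp_all
  moreover have "1 + a \<le> 3 * (1 + e)" if "a + b = 2 * c + 2 * f" "c \<le> 1" "f \<le> e" "0 \<le> b" "0 \<le> e"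
    for a b c e f :: real using that unfolding distrib_left by linarith
  ultimately have "1 + \<zeta>\<^sup>2 \<le> 3 * (1 + u\<^sup>2 / z)" by blast
  then show ?thesis by (simp only: \<zeta>_def u_def)
qed

text \<open>Negative powers of \<open>z\<close> are paid for by the Gaussian: for \<open>z < \<delta> / 2\<close> the numerator \<open>V y z\<close> is at least
\<open>\<delta> / 2\<close>, so \<open>1 / z\<close> is controlled by the squared argument of the Gaussian factor.\<close>
lemma inverse_z_le_T:
  assumes z: "0 < z" "z \<le> 1" and y: "0 < \<delta>" "\<delta> \<le> 1" "\<delta> \<le> y"
  shows "1 / z \<le> 4 / \<delta>\<^sup>2 * (1 + (V y z)\<^sup>2 / z)"
proof (cases "\<delta> / 2 \<le> z")
  case True
  then have "1 / z \<le> 1 / (\<delta> / 2)" using y z by (intro divide_left_mono) auto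
  also have "\<dots> = 2 * \<delta> / \<delta>\<^sup>2" using y by (simp add: power2_eq_square)
  also have "\<dots> \<le> 4 / \<delta>\<^sup>2" using y by (intro divide_right_mono) auto
  also have "\<dots> = 4 / \<delta>\<^sup>2 * 1" by simp
  also have "\<dots> \<le> 4 / \<delta>\<^sup>2 * (1 + (V y z)\<^sup>2 / z)" using z by (intro mult_left_mono) auto
  finally show ?thesis .
next
  case False
  have "\<alpha> * z \<le> 1 * z" using \<alpha> z by (intro mult_right_mono) auto
  then have "\<delta> / 2 \<le> y - \<alpha> * z" using False y by linarith
  moreover from this have "s * (y - \<alpha> * z) \<le> 1 * (y - \<alpha> * z)"
    using s y by (intro mult_right_mono) auto
  then have "y - \<alpha> * z \<le> V y z" using s by (simp add: V_def pos_le_divide_eq mult.commute)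
  ultimately have "\<delta> / 2 \<le> V y z" by linarith
  then have V: "(\<delta> / 2)\<^sup>2 \<le> (V y z)\<^sup>2" using y by (intro power_mono) auto
  have "1 / z = 4 / \<delta>\<^sup>2 * ((\<delta> / 2)\<^sup>2 / z)" using y by (simp add: power_divide)
  also have "\<dots> \<le> 4 / \<delta>\<^sup>2 * ((V y z)\<^sup>2 / z)" using V z by (intro mult_left_mono divide_right_mono) auto
  finally have "1 / z \<le> 4 / \<delta>\<^sup>2 * ((V y z)\<^sup>2 / z)" .
  also have "\<dots> \<le> 4 / \<delta>\<^sup>2 * (1 + (V y z)\<^sup>2 / z)" using y by (intro mult_left_mono) auto
  finally show ?thesis .
qed

text \<open>In terms of \<open>v = V y z / sqrt z\<close> and \<open>T = 1 + v\<^sup>2\<close>, every factor of \<open>g3\<close> except the Gaussian is bounded by a power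
of \<open>T\<close>, and \<open>exp (- T / 2)\<close> absorbs all powers of \<open>T\<close>, including those of \<open>1 + ((\<alpha> z - x) / s)\<^sup>2\<close>.\<close>
lemma g3_le_G:
  assumes z: "0 \<le> z" "z \<le> 1" and y: "0 < \<delta>" "\<delta> \<le> 1" "\<delta> \<le> y" "y \<le> 1" and xy: "x \<le> y" "y \<le> x + s"
  shows "\<bar>g3 y z\<bar> \<le> G (kernel_const \<delta>) x z"
proof (cases "z = 0")
  case True
  then show ?thesis using y s by (simp add: g3_def G_def kernel_const_def)
next
  case False
  then have z0: "0 < z" using z by simp
  define r where "r = sqrt z"
  define v where "v = V y z / r"
  define T where "T = 1 + v\<^sup>2"
  have r: "0 < r" "z = r\<^sup>2" "r \<le> 1" using z0 z by (simp_all add: r_def)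
  have Vv: "V y z = v * r" using r by (simp add: v_def)
  have "(V y z)\<^sup>2 = v\<^sup>2 * z" unfolding Vv using r(2) by (simp add: power_mult_distrib)
  then have v2: "(V y z)\<^sup>2 / z = v\<^sup>2" using z0 by simp
  have T1: "1 \<le> T" by (simp add: T_def)
  have Ev: "E y z = exp (1/2) * exp (- (T / 2))"
  proof -
    have "- (V y z)\<^sup>2 / (2 * z) = 1/2 + - (T / 2)" using v2 by (simp add: T_def field_simps)
    then show ?thesis unfolding E_def by (simp only: exp_add)
  qed
  have vT: "\<bar>v\<bar> \<le> T" unfolding T_def
  proof -
    have "0 \<le> (\<bar>v\<bar> - 1)\<^sup>2" by simp
    then have "2 * \<bar>v\<bar> \<le> 1 + v\<^sup>2" by (simp add: power2_eq_square algebra_simps)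
    then show "\<bar>v\<bar> \<le> 1 + v\<^sup>2" by linarith
  qed
  have "\<bar>v\<bar> ^ 3 = \<bar>v\<bar> * v\<^sup>2" by (simp add: power3_eq_cube power2_eq_square)
  also have "\<dots> \<le> T * T" using vT by (intro mult_mono) (auto simp: T_def)
  finally have v3: "\<bar>v\<bar> ^ 3 \<le> T\<^sup>2" by (simp add: power2_eq_square)
  have TT: "T \<le> T\<^sup>2" using T1 by (simp add: power2_eq_square)
  have R0b: "\<bar>R0 y z\<bar> \<le> 2"
  proof -
    have "\<alpha> * z \<le> 1 * 1" using \<alpha> z by (intro mult_mono) auto
    moreover have "0 \<le> \<alpha> * z" using \<alpha> z by simp
    ultimately show ?thesis using y by (simp add: R0_def)
  qed
  have R3: "\<bar>R3 y z\<bar> \<le> r ^ 3 / s ^ 3 * (11 * T\<^sup>2)"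
  proof -
    have e1: "3 * z * ((V y z)\<^sup>2 - z) / s\<^sup>2 = r ^ 3 / s ^ 3 * (3 * (s * r) * (v\<^sup>2 - 1))"
      using s unfolding Vv unfolding r(2) by (simp add: power_mult_distrib field_simps eval_nat_numeral)
    have e2: "R0 y z * ((V y z) ^ 3 - 3 * V y z * z) / s ^ 3 = r ^ 3 / s ^ 3 * (R0 y z * (v ^ 3 - 3 * v))"
      unfolding Vv unfolding r(2) by (simp add: power_mult_distrib field_simps eval_nat_numeral)
    have "\<bar>3 * (s * r) * (v\<^sup>2 - 1)\<bar> \<le> 3 * 1 * T"
      unfolding abs_mult using s r by (intro mult_mono) (auto simp: T_def mult_le_one abs_if)
    moreover have "\<bar>R0 y z * (v ^ 3 - 3 * v)\<bar> \<le> 2 * (T\<^sup>2 + 3 * T)"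
      unfolding abs_mult
    proof (intro mult_mono R0b)
      have "\<bar>v ^ 3 - 3 * v\<bar> \<le> \<bar>v\<bar> ^ 3 + 3 * \<bar>v\<bar>"
        using abs_triangle_ineq4[of "v ^ 3" "3 * v"] by (simp add: abs_mult power_abs)
      then show "\<bar>v ^ 3 - 3 * v\<bar> \<le> T\<^sup>2 + 3 * T" using v3 vT by linarith
    qed auto
    ultimately have "\<bar>3 * (s * r) * (v\<^sup>2 - 1) - R0 y z * (v ^ 3 - 3 * v)\<bar> \<le> 11 * T\<^sup>2"
      using TT unfolding distrib_left by linarith
    then show ?thesis
      unfolding R3_def e1 e2 right_diff_distrib[symmetric] abs_mult
      using r s by (intro mult_mono) auto
  qed
  have c: "0 \<le> 1 / (2 * s * sqrt (2 * pi))" using s by simp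
  have "\<bar>g3 y z\<bar> = 1 / (2 * s * sqrt (2 * pi)) * (\<bar>R3 y z\<bar> / (z ^ 4 * r)) * E y z"
    unfolding g3_def kern_def r_def[symmetric] using r s z0 by (simp add: abs_mult E_def)
  also have "\<dots> \<le> 1 / s * ((r ^ 3 / s ^ 3 * (11 * T\<^sup>2)) / (z ^ 4 * r)) * E y z"
    using c const_le R3 r s z0 by (intro mult_mono divide_right_mono mult_nonneg_nonneg) (auto simp: E_def)
  also have "\<dots> = 1 / s ^ 4 * (11 * T\<^sup>2) * (1 / z) ^ 3 * E y z"
  proof -
    have "r ^ 3 / (z ^ 4 * r) = (1 / z) ^ 3"
      using r(1) unfolding r(2) by (simp add: field_simps eval_nat_numeral)
    moreover have "1 / s * (1 / s ^ 3) = 1 / s ^ 4" by (simp add: eval_nat_numeral)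
    moreover have "1 / s * ((r ^ 3 / s ^ 3 * (11 * T\<^sup>2)) / (z ^ 4 * r)) * E y z
        = 1 / s * (1 / s ^ 3) * (11 * T\<^sup>2) * (r ^ 3 / (z ^ 4 * r)) * E y z" by (simp add: mult_ac)
    ultimately show ?thesis by (simp only:)
  qed
  also have "\<dots> \<le> 1 / s ^ 4 * (11 * T\<^sup>2) * (4 / \<delta>\<^sup>2 * T) ^ 3 * E y z"
    using inverse_z_le_T[OF z0 z(2) y(1-3)] z0 s T1 unfolding v2 T_def[symmetric]
    by (intro mult_right_mono mult_left_mono power_mono) (auto simp: E_def)
  also have "\<dots> = 704 * exp (1/2) / (\<delta> ^ 6 * s ^ 4) * T ^ 5 * exp (- (T / 2))"
  proof -
    have "(4 / \<delta>\<^sup>2 * T) ^ 3 = 64 / \<delta> ^ 6 * T ^ 3"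
      by (simp add: power_mult_distrib power_divide power_mult[symmetric])
    moreover have "T\<^sup>2 * T ^ 3 = T ^ 5" by (simp add: power_add[symmetric])
    moreover have "1 / s ^ 4 * (11 * T\<^sup>2) * (64 / \<delta> ^ 6 * T ^ 3) * (exp (1/2) * exp (- (T / 2)))
      = 704 * exp (1/2) / (\<delta> ^ 6 * s ^ 4) * (T\<^sup>2 * T ^ 3) * exp (- (T / 2))" by (simp add: mult_ac)
    ultimately show ?thesis unfolding Ev by (simp only:)
  qed
  finally have g: "\<bar>g3 y z\<bar> \<le> 704 * exp (1/2) / (\<delta> ^ 6 * s ^ 4) * T ^ 5 * exp (- (T / 2))" .
  let ?Z = "1 + ((\<alpha> * z - x) / s)\<^sup>2"
  have Z: "0 < ?Z" by (smt (verit) zero_le_power2)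
  have Z3: "?Z \<le> 3 * T" using shift_le_T[OF z0 z(2) xy] by (simp add: v2 T_def)
  have "\<bar>g3 y z\<bar> * ?Z\<^sup>2 \<le> (704 * exp (1/2) / (\<delta> ^ 6 * s ^ 4) * T ^ 5 * exp (- (T / 2))) * (3 * T)\<^sup>2"
    using g Z Z3 by (intro mult_mono power_mono) auto
  also have "\<dots> = 9 * 704 * exp (1/2) / (\<delta> ^ 6 * s ^ 4) * (T ^ 7 * exp (- (T / 2)))"
  proof -
    have "T ^ 5 * T\<^sup>2 = T ^ 7" by (simp add: power_add[symmetric])
    moreover have "a * T ^ 5 * b * (3 * T)\<^sup>2 = 9 * a * (T ^ 5 * T\<^sup>2 * b)" for a b
      by (simp add: power_mult_distrib)
    ultimately show ?thesis by simp
  qed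
  also have "\<dots> \<le> 9 * 704 * exp (1/2) / (\<delta> ^ 6 * s ^ 4) * 14 ^ 7"
  proof (rule mult_left_mono)
    have "(T / 2 / real 7) ^ 7 \<le> exp (T / 2)" using T1 by (intro le_power_exp) auto
    then have "T ^ 7 \<le> 14 ^ 7 * exp (T / 2)" by (simp add: power_divide)
    then show "T ^ 7 * exp (- (T / 2)) \<le> 14 ^ 7" by (simp add: exp_minus field_simps)
  qed (use y s in auto)
  also have "\<dots> = kernel_const \<delta> / s ^ 4" by (simp add: kernel_const_def)
  finally show ?thesis
    unfolding G_def pos_le_divide_eq[OF zero_less_power[OF Z]] .
qed

lemma k2_le_H:
  assumes y: "0 < \<delta>" "\<delta> \<le> 1" and xy: "x \<le> y" "y \<le> x + s"
  shows "\<bar>k2 y 1\<bar> \<le> H (kernel_const \<delta>) x"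
proof -
  define v where "v = V y 1"
  define T where "T = 1 + v\<^sup>2"
  have T1: "1 \<le> T" by (simp add: T_def)
  have Ev: "E y 1 = exp (1/2) * exp (- (T / 2))"
  proof -
    have "- (V y 1)\<^sup>2 / (2 * 1) = 1/2 + - (T / 2)" by (simp add: T_def v_def field_simps)
    then show ?thesis unfolding E_def by (simp only: exp_add)
  qed
  let ?Z = "1 + ((\<alpha> - x) / s)\<^sup>2"
  have Z: "0 < ?Z" by (smt (verit) zero_le_power2)
  have Z3: "?Z \<le> 3 * T" using shift_le_T[OF _ _ xy, of 1] by (simp add: v_def T_def)
  have "\<bar>1 - v\<^sup>2\<bar> \<le> T" by (simp add: T_def abs_if)
  then have b: "\<bar>2 * (1 - v\<^sup>2) / s\<^sup>2\<bar> \<le> 2 * T / s\<^sup>2" using s by (simp add: abs_mult divide_right_mono)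
  have "\<bar>k2 y 1\<bar> = 1 / (2 * s * sqrt (2 * pi)) * \<bar>2 * (1 - v\<^sup>2) / s\<^sup>2\<bar> * E y 1"
    unfolding k2_def kern_def v_def using s by (simp add: abs_mult E_def)
  also have "\<dots> \<le> 1 / s * (2 * T / s\<^sup>2) * E y 1"
    using const_le b s T1 by (intro mult_mono mult_nonneg_nonneg) (auto simp: E_def)
  finally have k: "\<bar>k2 y 1\<bar> \<le> 1 / s * (2 * T / s\<^sup>2) * E y 1" .
  have "\<bar>k2 y 1\<bar> * ?Z \<le> (1 / s * (2 * T / s\<^sup>2) * E y 1) * (3 * T)"
    using k Z Z3 by (intro mult_mono) auto
  also have "\<dots> = 6 * exp (1/2) / s ^ 3 * (T\<^sup>2 * exp (- (T / 2)))"
    unfolding Ev by (simp add: eval_nat_numeral)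
  also have "\<dots> \<le> 6 * exp (1/2) / s ^ 3 * 16"
  proof (rule mult_left_mono)
    have "(T / 2 / real 2) ^ 2 \<le> exp (T / 2)" using T1 by (intro le_power_exp) auto
    then have "T\<^sup>2 \<le> 16 * exp (T / 2)" by (simp add: power_divide)
    then show "T\<^sup>2 * exp (- (T / 2)) \<le> 16" by (simp add: exp_minus field_simps)
  qed (use s in auto)
  also have "\<dots> \<le> kernel_const \<delta> / s ^ 3"
  proof -
    have "\<delta> ^ 6 \<le> 1" using y by (simp add: power_le_one)
    then have "96 * exp (1/2 :: real) * \<delta> ^ 6 \<le> 96 * exp (1/2) * 1" by (intro mult_left_mono) auto
    also have "\<dots> \<le> 9 * 704 * 14 ^ 7 * exp (1/2)" by simp
    finally have "96 * exp (1/2) \<le> kernel_const \<delta>"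
      unfolding kernel_const_def using y by (subst pos_le_divide_eq) auto
    then show ?thesis using s by (simp add: divide_right_mono)
  qed
  finally show ?thesis
    unfolding H_def pos_le_divide_eq[OF Z] .
qed

end

section \<open>Response of the slope to shifts of the path\<close>

definition det_const :: "real \<Rightarrow> real" where
  "det_const \<delta> = \<delta> * exp (- 16 / \<delta>) ^ 3 / (2 * pi)"

context conga_kernel
begin

lemma k0_neg: "0 < z \<Longrightarrow> k0 y z < 0"
  using s by (simp add: k0_def kern_def E_def)

lemma slope_add:
  assumes "continuous_on {0..1} w" "continuous_on {0..1} d" "0 < y"
  shows "slope (\<lambda>r. w r + d r) y = slope w y + slope d y"
  unfolding slope_def distrib_right using assms
  by (intro integral_add integrable_continuous_interval continuous_on_mult reflect_continuous g_continuous_z)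

lemma slope_cmult: "slope (\<lambda>r. c * w r) y = c * slope w y"
  unfolding slope_def by (simp add: mult.assoc)

text \<open>Integration by parts: the slope is an integral of \<open>k0\<close> against the increments of the path.\<close>
lemma slope_ramp:
  assumes y: "0 < y" and lh: "0 \<le> lo" "lo < hi" "hi \<le> 1"
  shows "slope (ramp (1 - hi) (1 - lo)) y = integral {lo..hi} (k0 y)"
proof -
  let ?f = "\<lambda>z. ramp (1 - hi) (1 - lo) (1 - z) * g1 y z"
  have d: "(k0 y has_vector_derivative g1 y z) (at z)" if "0 < z" for z
    using k0_deriv_z[OF that] by (simp add: has_real_derivative_iff_has_vector_derivative)
  have c: "continuous_on {a..b} (k0 y)" if "0 \<le> a" "b \<le> 1" for a b
    using continuous_on_subset[OF g_continuous_z(5)[OF y], of "{a..b}"] that by auto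
  have k00: "k0 y 0 = 0" by (simp add: k0_def)
  have "((\<lambda>z. (hi - lo) * g1 y z) has_integral ((hi - lo) * (k0 y lo - k0 y 0))) {0..lo}"
    using lh by (intro has_integral_mult_right fundamental_theorem_of_calculus_interior c d) auto
  then have i1: "(?f has_integral ((hi - lo) * k0 y lo)) {0..lo}"
    unfolding k00 by (rule has_integral_eq[rotated, OF has_integral_eq_rhs]) (use lh in \<open>auto simp: ramp_def\<close>)
  let ?K = "\<lambda>z. integral {lo..z} (k0 y)"
  let ?P = "\<lambda>z. (hi - z) * k0 y z + ?K z"
  have "((\<lambda>z. (hi - z) * g1 y z) has_integral (?P hi - ?P lo)) {lo..hi}"
  proof (rule fundamental_theorem_of_calculus_interior)
    have "continuous_on {lo..hi} ?K"
      by (intro indefinite_integral_continuous_1 integrable_continuous_interval c lh)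
    then show "continuous_on {lo..hi} ?P" by (intro continuous_intros c lh) 
    fix z assume z: "z \<in> {lo<..<hi}"
    have "(?K has_real_derivative k0 y z) (at z within {lo..hi})"
      using z by (intro integral_has_real_derivative c lh) auto
    then have K: "(?K has_real_derivative k0 y z) (at z)"
      using z by (simp add: at_within_interior[of z "{lo..hi}"])
    have "(?P has_real_derivative ((0 - 1) * k0 y z + g1 y z * (hi - z) + k0 y z)) (at z)"
      using z lh by (intro DERIV_add DERIV_mult DERIV_diff DERIV_const DERIV_ident K k0_deriv_z) auto
    then show "(?P has_vector_derivative (hi - z) * g1 y z) (at z)"
      by (simp add: has_real_derivative_iff_has_vector_derivative mult.commute)
  qed (use lh in auto)
  then have i2: "(?f has_integral (?K hi - (hi - lo) * k0 y lo)) {lo..hi}"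
    by (rule has_integral_eq[rotated, OF has_integral_eq_rhs]) (use lh in \<open>auto simp: ramp_def\<close>)
  have i3: "(?f has_integral 0) {hi..1}"
    by (rule has_integral_eq[OF _ has_integral_0]) (use lh in \<open>auto simp: ramp_def\<close>)
  have "(?f has_integral ((hi - lo) * k0 y lo + (?K hi - (hi - lo) * k0 y lo))) {0..hi}"
    by (rule has_integral_combine[OF _ _ i1 i2]) (use lh in auto)
  from has_integral_combine[OF _ _ this i3]
  have "(?f has_integral ?K hi) {0..1}" using lh by simp
  then show ?thesis unfolding slope_def by (rule integral_unique)
qed

lemma k0_ratio:
  assumes "0 < z"
  shows "k0 q z = exp ((q - p) * \<alpha> / s\<^sup>2 - (q\<^sup>2 - p\<^sup>2) / (2 * s\<^sup>2 * z)) * k0 p z"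
proof -
  have "- (V q z)\<^sup>2 / (2 * z) = (q - p) * \<alpha> / s\<^sup>2 - (q\<^sup>2 - p\<^sup>2) / (2 * s\<^sup>2 * z) + - (V p z)\<^sup>2 / (2 * z)"
    unfolding V_def power_divide using assms s
    by (simp add: field_simps power2_eq_square)
  then have "E q z = exp ((q - p) * \<alpha> / s\<^sup>2 - (q\<^sup>2 - p\<^sup>2) / (2 * s\<^sup>2 * z)) * E p z"
    unfolding E_def by (simp only: exp_add)
  then show ?thesis by (simp add: k0_def kern_def)
qed

text \<open>Uniform lower bounds on the part of the kernel that the two shift directions see, \<open>z\<close> within \<open>3 s\<close> to the left of
\<open>x / \<alpha>\<close>.\<close>
lemma k0_bound:
  assumes \<delta>: "0 < \<delta>" "6 * s \<le> \<delta>" and x: "\<delta> \<le> x" "x \<le> \<alpha>" and y: "x \<le> y" "y \<le> x + s"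
    and z: "x / \<alpha> - 3 * s \<le> z" "z \<le> x / \<alpha>"
  shows "0 < z" "z \<le> 1" "exp (- 16 / \<delta>) \<le> E y z" "exp (- 16 / \<delta>) / (s * sqrt (2 * pi)) \<le> - k0 y z"
proof -
  have "x \<le> x / \<alpha>" using \<alpha> \<delta> x by (simp add: pos_le_divide_eq mult_left_le)
  then have z2: "\<delta> / 2 \<le> z" using \<delta> x z by linarith
  then show z0: "0 < z" using \<delta> by linarith
  show z1: "z \<le> 1" using z x \<alpha> by (smt (verit) divide_le_eq_1_pos)
  have "\<alpha> * z \<le> x" using z \<alpha> by (simp add: pos_le_divide_eq mult.commute)
  moreover have "x - 3 * s \<le> \<alpha> * z"
  proof -
    have "\<alpha> * (x / \<alpha> - 3 * s) \<le> \<alpha> * z" using z \<alpha> by (intro mult_left_mono) auto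
    moreover have "\<alpha> * (3 * s) \<le> 1 * (3 * s)" using \<alpha> s by (intro mult_right_mono) auto
    ultimately show ?thesis using \<alpha> by (simp add: right_diff_distrib)
  qed
  ultimately have V: "0 \<le> V y z" "V y z \<le> 4"
    using y s by (auto simp: V_def pos_divide_le_eq)
  then have "(V y z)\<^sup>2 \<le> 4\<^sup>2" by (intro power_mono) auto
  then have "(V y z)\<^sup>2 / (2 * z) \<le> 16 / \<delta>"
    using z2 \<delta> by (intro frac_le) auto
  then show E: "exp (- 16 / \<delta>) \<le> E y z" by (simp add: E_def)
  have "1 \<le> 1 / sqrt z" using z0 z1 by simp
  then have "exp (- 16 / \<delta>) * 1 \<le> E y z * (1 / sqrt z)" using E by (intro mult_mono) (auto simp: E_def)
  then have "exp (- 16 / \<delta>) / (s * sqrt (2 * pi)) \<le> (E y z * (1 / sqrt z)) / (s * sqrt (2 * pi))"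
    using s by (intro divide_right_mono) auto
  also have "\<dots> = - k0 y z" by (simp add: k0_def kern_def mult_ac)
  finally show "exp (- 16 / \<delta>) / (s * sqrt (2 * pi)) \<le> - k0 y z" .
qed

text \<open>The ratio \<open>k0 q z / k0 p z\<close> increases in \<open>z\<close> when \<open>p < q\<close>, so \<open>k0\<close> is totally positive up to sign. Passing
from the first interval to the second, the ratio grows at least by the factor \<open>1 + (q - p) \<delta> / s\<close> because
the intervals are separated by a gap of length \<open>s\<close>; this is what makes the determinant at least of order
\<open>q - p\<close>.\<close>
lemma determinant_lower_bound:
  fixes \<delta> x p q :: real
  defines "z0 \<equiv> x / \<alpha>"
  defines "A1 \<equiv> \<lambda>y. integral {z0 - 3 * s..z0 - 2 * s} (k0 y)"
    and "A2 \<equiv> \<lambda>y. integral {z0 - s..z0} (k0 y)"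
  assumes \<delta>: "0 < \<delta>" "6 * s \<le> \<delta>" and x: "\<delta> \<le> x" "x \<le> \<alpha>" and pq: "x \<le> p" "p < q" "q \<le> x + s"
  shows "A2 p \<noteq> 0" "det_const \<delta> * (q - p) / s \<le> A1 p * A2 q - A2 p * A1 q"
proof -
  define e where "e = exp (- 16 / \<delta>)"
  define \<kappa> where "\<kappa> = e / sqrt (2 * pi)"
  define zh where "zh = z0 - 2 * s"
  define \<rho> where "\<rho> z = exp ((q - p) * \<alpha> / s\<^sup>2 - (q\<^sup>2 - p\<^sup>2) / (2 * s\<^sup>2 * z))" for z
  define \<tau> where "\<tau> = (q - p) * \<delta> / s"
  have bd: "0 < z" "z \<le> 1" "e \<le> E y z" "\<kappa> / s \<le> - k0 y z"
    if "z0 - 3 * s \<le> z" "z \<le> z0" "x \<le> y" "y \<le> x + s" for y z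
    using k0_bound[OF \<delta> x that(3,4) that(1,2)[unfolded z0_def]] s by (simp_all add: e_def \<kappa>_def mult.commute)
  have e0: "0 < e" "0 < \<kappa>" by (simp_all add: e_def \<kappa>_def)
  have zh: "0 < zh" "zh \<le> 1" using bd[of zh p] pq s by (auto simp: zh_def)
  have c: "k0 y integrable_on {a..b}" if "z0 - 3 * s \<le> a" "b \<le> z0" "x \<le> y" "y \<le> x + s" for a b y
  proof (cases "a \<le> b")
    case True
    have "0 \<le> a" "b \<le> 1" using bd[of a y] bd[of b y] that True by auto
    then show ?thesis using x \<delta> that
      by (intro integrable_continuous_interval continuous_on_subset[OF g_continuous_z(5)]) auto
  qed auto
  have lower: "\<kappa> \<le> - integral {a..a + s} (k0 p)" if "z0 - 3 * s \<le> a" "a + s \<le> z0" for a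
  proof -
    have "integral {a..a + s} (\<lambda>_. \<kappa> / s) \<le> integral {a..a + s} (\<lambda>z. - k0 p z)"
      using that pq by (intro integral_le integrable_neg c bd) auto
    then show ?thesis using s by simp
  qed
  have A1p: "\<kappa> \<le> - A1 p" using lower[of "z0 - 3 * s"] s by (simp add: A1_def)
  have A2p: "\<kappa> \<le> - A2 p" using lower[of "z0 - s"] s by (simp add: A2_def)
  show "A2 p \<noteq> 0" using A2p e0 by auto
  have qp2: "0 \<le> q\<^sup>2 - p\<^sup>2" using pq x \<delta> by (simp add: power_mono)
  have r1: "\<rho> z \<le> \<rho> zh" if "0 < z" "z \<le> zh" for z
  proof -
    have "(q\<^sup>2 - p\<^sup>2) / (2 * s\<^sup>2 * zh) \<le> (q\<^sup>2 - p\<^sup>2) / (2 * s\<^sup>2 * z)"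
      using that qp2 s by (intro divide_left_mono mult_left_mono mult_pos_pos) auto
    then show ?thesis by (simp add: \<rho>_def)
  qed
  have r2: "\<rho> zh * (1 + \<tau>) \<le> \<rho> z" if z: "zh + s \<le> z" "z \<le> 1" for z
  proof -
    have z0: "0 < z" using z zh s by linarith
    have "zh * z \<le> 1 * 1" using zh z z0 by (intro mult_mono) auto
    then have "s / 1 \<le> (z - zh) / (zh * z)" using z zh z0 s by (intro frac_le) auto
    then have sz: "s \<le> 1 / zh - 1 / z" using zh z0 by (simp add: diff_frac_eq)
    have "\<delta> * (q - p) * 2 \<le> (p + q) * (q - p)" using pq x by (simp add: mult.commute mult_mono)
    then have "\<delta> * (q - p) * 2 / (2 * s\<^sup>2) * s \<le> (p + q) * (q - p) / (2 * s\<^sup>2) * s"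
      using s by (intro mult_right_mono divide_right_mono) auto
    moreover have "\<tau> = \<delta> * (q - p) * 2 / (2 * s\<^sup>2) * s"
      using s by (simp add: \<tau>_def power2_eq_square)
    ultimately have "\<tau> \<le> (p + q) * (q - p) / (2 * s\<^sup>2) * s" by simp
    also have "\<dots> \<le> (p + q) * (q - p) / (2 * s\<^sup>2) * (1 / zh - 1 / z)"
      using sz pq x \<delta> by (intro mult_left_mono) auto
    also have "\<dots> = (q\<^sup>2 - p\<^sup>2) / (2 * s\<^sup>2 * zh) - (q\<^sup>2 - p\<^sup>2) / (2 * s\<^sup>2 * z)"
    proof -
      have "q\<^sup>2 - p\<^sup>2 = (p + q) * (q - p)" by (simp add: power2_eq_square algebra_simps)
      then show ?thesis by (simp add: right_diff_distrib)
    qed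
    finally have "1 + \<tau> \<le> exp ((q\<^sup>2 - p\<^sup>2) / (2 * s\<^sup>2 * zh) - (q\<^sup>2 - p\<^sup>2) / (2 * s\<^sup>2 * z))"
      using exp_ge_add_one_self order_trans by (smt (verit))
    then have "\<rho> zh * (1 + \<tau>) \<le> \<rho> zh * exp ((q\<^sup>2 - p\<^sup>2) / (2 * s\<^sup>2 * zh) - (q\<^sup>2 - p\<^sup>2) / (2 * s\<^sup>2 * z))"
      by (intro mult_left_mono) (auto simp: \<rho>_def)
    also have "\<dots> = \<rho> z" unfolding \<rho>_def exp_add[symmetric] by simp
    finally show ?thesis .
  qed
  have k0q: "k0 q z = \<rho> z * k0 p z" if "0 < z" for z using k0_ratio[OF that] by (simp add: \<rho>_def)
  have A1q: "- A1 q \<le> \<rho> zh * - A1 p"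
  proof -
    have "integral {z0 - 3 * s..z0 - 2 * s} (\<lambda>z. - k0 q z) \<le> integral {z0 - 3 * s..z0 - 2 * s} (\<lambda>z. \<rho> zh * - k0 p z)"
    proof (intro integral_le integrable_neg integrable_on_mult_right c)
      fix z assume z: "z \<in> {z0 - 3 * s..z0 - 2 * s}"
      then have "0 < z" using bd[of z p] pq s by auto
      moreover have "0 \<le> - k0 p z" using k0_neg[OF \<open>0 < z\<close>, of p] by simp
      ultimately show "- k0 q z \<le> \<rho> zh * - k0 p z"
        using r1[of z] z mult_right_mono[of "\<rho> z" "\<rho> zh" "- k0 p z"] by (simp add: k0q zh_def)
    qed (use pq s in auto)
    then show ?thesis by (simp add: A1_def)
  qed
  have A2q: "\<rho> zh * (1 + \<tau>) * - A2 p \<le> - A2 q"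
  proof -
    have "integral {z0 - s..z0} (\<lambda>z. \<rho> zh * (1 + \<tau>) * - k0 p z) \<le> integral {z0 - s..z0} (\<lambda>z. - k0 q z)"
    proof (intro integral_le integrable_neg integrable_on_mult_right c)
      fix z assume z: "z \<in> {z0 - s..z0}"
      then have "0 < z" "z \<le> 1" using bd[of z p] pq s by auto
      moreover have "0 \<le> - k0 p z" using k0_neg[OF \<open>0 < z\<close>, of p] by simp
      ultimately show "\<rho> zh * (1 + \<tau>) * - k0 p z \<le> - k0 q z"
        using r2[of z] z mult_right_mono[of "\<rho> zh * (1 + \<tau>)" "\<rho> z" "- k0 p z"] by (simp add: k0q zh_def)
    qed (use pq s in auto)
    then show ?thesis by (simp add: A2_def)
  qed
  have rho: "e \<le> \<rho> zh"
  proof -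
    have "E q zh = \<rho> zh * E p zh"
      using k0q[OF zh(1)] zh s by (simp add: k0_def kern_def)
    moreover have "e \<le> E q zh" using pq s by (intro bd) (auto simp: zh_def)
    moreover have "\<rho> zh * E p zh \<le> \<rho> zh * 1"
      using zh by (intro mult_left_mono) (auto simp: E_def \<rho>_def)
    ultimately show ?thesis by simp
  qed
  have \<tau>0: "0 \<le> \<tau>" using pq \<delta> s by (simp add: \<tau>_def)
  have "\<kappa> * \<kappa> * (e * \<tau>) \<le> (- A1 p) * (- A2 p) * (\<rho> zh * \<tau>)"
  proof -
    have "0 \<le> (- A1 p) * (- A2 p)" using A1p A2p e0 by (intro mult_nonneg_nonneg) auto
    then show ?thesis using A1p A2p rho \<tau>0 e0 by (intro mult_mono) auto
  qed
  also have "\<dots> = (- A1 p) * (\<rho> zh * (1 + \<tau>) * - A2 p) - (- A2 p) * (\<rho> zh * - A1 p)"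
    by (simp add: algebra_simps)
  also have "\<dots> \<le> (- A1 p) * (- A2 q) - (- A2 p) * (- A1 q)"
    using A1q A2q A1p A2p e0 by (intro diff_mono mult_left_mono) auto
  also have "\<dots> = A1 p * A2 q - A2 p * A1 q" by simp
  finally have "\<kappa> * \<kappa> * (e * \<tau>) \<le> A1 p * A2 q - A2 p * A1 q" .
  moreover have "\<kappa> * \<kappa> * (e * \<tau>) = det_const \<delta> * (q - p) / s"
    by (simp add: \<kappa>_def \<tau>_def det_const_def e_def eval_nat_numeral)
  ultimately show "det_const \<delta> * (q - p) / s \<le> A1 p * A2 q - A2 p * A1 q" by simp
qed

end

section \<open>Size of the third derivative\<close>

definition riemann_sum :: "(real \<Rightarrow> real) \<Rightarrow> nat \<Rightarrow> real" where
  "riemann_sum F n = (\<Sum>i<Suc n. F (real i / real (Suc n)) / real (Suc n))"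

text \<open>Functionals of a path are written as limits of Riemann sums: these make sense and are measurable on the whole path space, where
the set of continuous paths is not measurable, and they agree with the integral on continuous integrands.\<close>
definition riemann_lim :: "(real \<Rightarrow> real) \<Rightarrow> real" where
  "riemann_lim F = lim (riemann_sum F)"

lemma riemann_sum_tendsto:
  assumes F: "continuous_on {0..1} F"
  shows "riemann_sum F \<longlonglongrightarrow> integral {0..1} F"
proof (rule LIMSEQ_I)
  fix e :: real assume e: "0 < e"
  have "uniformly_continuous_on {0..1} F"
    using F compact_Icc by (rule compact_uniformly_continuous)
  moreover have "0 < e / 2" using e by simp
  ultimately obtain d where d: "0 < d"
    "\<And>u v. u \<in> {0..1} \<Longrightarrow> v \<in> {0..1} \<Longrightarrow> dist v u < d \<Longrightarrow> dist (F v) (F u) < e / 2"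
    unfolding uniformly_continuous_on_def by blast
  obtain n0 where n0: "inverse (real (Suc n0)) < d" using reals_Archimedean[OF d(1)] by blast
  have "norm (riemann_sum F n - integral {0..1} F) < e" if "n \<ge> n0" for n
  proof -
    define N where "N = real (Suc n)"
    have N: "0 < N" "1 / N < d"
    proof -
      show "0 < N" by (simp add: N_def)
      have "inverse N \<le> inverse (real (Suc n0))" unfolding N_def using that by (intro le_imp_inverse_le) auto
      then show "1 / N < d" using n0 by (simp add: inverse_eq_divide)
    qed
    have int: "F integrable_on {a..b}" if "0 \<le> a" "b \<le> 1" for a b
      using that by (intro integrable_continuous_interval continuous_on_subset[OF F]) auto
    have sum: "integral {0..real k / N} F = (\<Sum>i<k. integral {real i / N..real (Suc i) / N} F)" if "k \<le> Suc n" for k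
      using that
    proof (induction k)
      case (Suc k)
      have "real (Suc k) / N \<le> 1" using Suc.prems N by (simp add: N_def)
      then have "integral {0..real k / N} F + integral {real k / N..real (Suc k) / N} F = integral {0..real (Suc k) / N} F"
        using N by (intro Henstock_Kurzweil_Integration.integral_combine int) (auto simp: divide_right_mono)
      then show ?case using Suc by simp
    qed simp
    have cell: "\<bar>F (real i / N) / N - integral {real i / N..real (Suc i) / N} F\<bar> \<le> e / 2 / N" if i: "i < Suc n" for i
    proof -
      let ?a = "real i / N" and ?b = "real (Suc i) / N"
      have ab: "0 \<le> ?a" "?a \<le> ?b" "?b \<le> 1" "?b - ?a = 1 / N"
        using i N by (auto simp: N_def divide_right_mono diff_divide_distrib[symmetric])
      have "integral {?a..?b} (\<lambda>_. F ?a) = F ?a / N" using ab by simp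
      then have "F ?a / N - integral {?a..?b} F = integral {?a..?b} (\<lambda>z. F ?a - F z)"
        using ab by (subst integral_diff) (auto intro: int)
      also have "\<bar>\<dots>\<bar> \<le> e / 2 * (?b - ?a)"
        unfolding real_norm_def[symmetric]
      proof (rule integral_bound)
        show "continuous_on {?a..?b} (\<lambda>z. F ?a - F z)"
          using ab by (intro continuous_intros continuous_on_subset[OF F]) auto
        fix z assume z: "z \<in> {?a..?b}"
        then have "dist ?a z \<le> 1 / N" using ab by (simp add: dist_real_def)
        moreover have "?a \<in> {0..1}" "z \<in> {0..1}" using z ab(1-3) unfolding atLeastAtMost_iff by linarith+
        ultimately have "dist (F ?a) (F z) < e / 2" using N by (intro d(2)) linarith+
        then show "norm (F ?a - F z) \<le> e / 2" by (simp add: dist_norm)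
      qed (use ab in auto)
      finally show ?thesis using ab by simp
    qed
    have "real (Suc n) / N = 1" by (simp add: N_def)
    then have "riemann_sum F n - integral {0..1} F
        = (\<Sum>i<Suc n. F (real i / N) / N - integral {real i / N..real (Suc i) / N} F)"
      using sum[of "Suc n"] by (simp add: riemann_sum_def N_def[symmetric] sum_subtractf del: sum.lessThan_Suc of_nat_Suc)
    also have "\<bar>\<dots>\<bar> \<le> (\<Sum>i<Suc n. e / 2 / N)"
      by (rule order_trans[OF sum_abs sum_mono]) (use cell in auto)
    also have "\<dots> = real (Suc n) * (e / 2 / N)" by (simp only: sum_constant card_lessThan)
    also have "\<dots> = e / 2" using N by (simp add: N_def[symmetric] del: of_nat_Suc)
    finally show ?thesis using e by simp
  qed
  then show "\<exists>no. \<forall>n\<ge>no. norm (riemann_sum F n - integral {0..1} F) < e" by blast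
qed

lemma riemann_lim_eq_integral:
  "continuous_on {0..1} F \<Longrightarrow> riemann_lim F = integral {0..1} F"
  unfolding riemann_lim_def by (intro limI riemann_sum_tendsto)

lemma riemann_lim_measurable:
  assumes "\<And>z. (\<lambda>w. F w z) \<in> borel_measurable N"
  shows "(\<lambda>w. riemann_lim (F w)) \<in> borel_measurable N"
  unfolding riemann_lim_def riemann_sum_def
  by (intro borel_measurable_lim_metric borel_measurable_sum borel_measurable_divide assms borel_measurable_const)

lemma brownian_increment_second_moment:
  assumes W: "std_brownian_motion M W" and ab: "a \<in> {0..1}" "b \<in> {0..1}"
  shows "integrable M (\<lambda>\<omega>. (W a \<omega> - W b \<omega>)\<^sup>2)" "(\<integral>\<omega>. (W a \<omega> - W b \<omega>)\<^sup>2 \<partial>M) = \<bar>a - b\<bar>"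
proof -
  interpret prob_space M using W by (simp add: std_brownian_motion_def)
  have less: "integrable M (\<lambda>\<omega>. (W r \<omega> - W q \<omega>)\<^sup>2) \<and> (\<integral>\<omega>. (W r \<omega> - W q \<omega>)\<^sup>2 \<partial>M) = r - q"
    if "0 \<le> q" "q < r" "r \<le> 1" for q r
  proof -
    have D: "distributed M lborel (\<lambda>\<omega>. W r \<omega> - W q \<omega>) (normal_density 0 (sqrt (r - q)))"
      using W that by (auto simp: std_brownian_motion_def)
    have pos: "0 < sqrt (r - q)" using that by simp
    have "expectation (\<lambda>\<omega>. W r \<omega> - W q \<omega>) = 0" by (rule normal_distributed_expectation[OF pos D])
    then have "(\<integral>\<omega>. (W r \<omega> - W q \<omega>)\<^sup>2 \<partial>M) = r - q"
      using normal_distributed_variance[OF pos D] that by simp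
    moreover have "integrable M (\<lambda>\<omega>. (W r \<omega> - W q \<omega>)\<^sup>2)"
      using distributed_integrable[OF D, of "\<lambda>x. x\<^sup>2"] integrable_normal_moment[OF pos, of 0 2] by simp
    ultimately show ?thesis by simp
  qed
  have "integrable M (\<lambda>\<omega>. (W a \<omega> - W b \<omega>)\<^sup>2) \<and> (\<integral>\<omega>. (W a \<omega> - W b \<omega>)\<^sup>2 \<partial>M) = \<bar>a - b\<bar>"
  proof (rule linorder_cases[of a b])
    assume "a < b" then show ?thesis using less[of a b] ab by (simp add: power2_commute[of "W a _"])
  next
    assume "a > b" then show ?thesis using less[of b a] ab by simp
  qed simp
  then show "integrable M (\<lambda>\<omega>. (W a \<omega> - W b \<omega>)\<^sup>2)" "(\<integral>\<omega>. (W a \<omega> - W b \<omega>)\<^sup>2 \<partial>M) = \<bar>a - b\<bar>" by auto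
qed

lemma weighted_sum_squared_le:
  fixes a g :: "'i \<Rightarrow> real"
  assumes "\<And>i. i \<in> I \<Longrightarrow> 0 \<le> g i"
  shows "(\<Sum>i\<in>I. \<bar>a i\<bar> * g i)\<^sup>2 \<le> (\<Sum>i\<in>I. g i) * (\<Sum>i\<in>I. (a i)\<^sup>2 * g i)"
proof -
  have "(\<Sum>i\<in>I. \<bar>a i\<bar> * g i) = (\<Sum>i\<in>I. sqrt (g i) * (\<bar>a i\<bar> * sqrt (g i)))"
    using assms by (intro sum.cong) (auto simp: mult.left_commute)
  then have "(\<Sum>i\<in>I. \<bar>a i\<bar> * g i)\<^sup>2 \<le> (\<Sum>i\<in>I. (sqrt (g i))\<^sup>2) * (\<Sum>i\<in>I. (\<bar>a i\<bar> * sqrt (g i))\<^sup>2)"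
    using Cauchy_Schwarz_ineq_sum[of "\<lambda>i. sqrt (g i)" "\<lambda>i. \<bar>a i\<bar> * sqrt (g i)" I] by simp
  also have "\<dots> = (\<Sum>i\<in>I. g i) * (\<Sum>i\<in>I. (a i)\<^sup>2 * g i)"
    using assms by (intro arg_cong2[where f = "(*)"] sum.cong) (auto simp: power_mult_distrib)
  finally show ?thesis .
qed

context conga_kernel
begin

text \<open>The random bound for \<open>|slope''|\<close> on \<open>[x, x + s]\<close>. On continuous paths it is a seminorm of the path, so that a shift of the path increases it
by at most a deterministic amount.\<close>
definition fluct :: "real \<Rightarrow> real \<Rightarrow> (real \<Rightarrow> real) \<Rightarrow> real" where
  "fluct K x w = riemann_lim (\<lambda>z. \<bar>w (1 - z) - w (1 - x / \<alpha>)\<bar> * G K x z) + \<bar>w (1 - x / \<alpha>)\<bar> * H K x"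

definition slope_fun :: "real \<Rightarrow> (real \<Rightarrow> real) \<Rightarrow> real" where
  "slope_fun y w = riemann_lim (\<lambda>z. w (1 - z) * g1 y z)"

lemma coordinate_measurable: "(\<lambda>w. w r) \<in> borel_measurable path_space"
  by (rule measurable_component_singleton) simp

lemma slope_fun_measurable: "slope_fun y \<in> borel_measurable path_space"
  unfolding slope_fun_def
  by (intro riemann_lim_measurable borel_measurable_times borel_measurable_const coordinate_measurable)

lemma fluct_measurable: "fluct K x \<in> borel_measurable path_space"
  unfolding fluct_def
  by (intro riemann_lim_measurable borel_measurable_times borel_measurable_const borel_measurable_add
      borel_measurable_abs borel_measurable_diff coordinate_measurable)

lemma slope_fun_eq:
  assumes "continuous_on UNIV w" "0 < y"
  shows "slope_fun y w = slope w y"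
  unfolding slope_fun_def slope_def using assms
  by (intro riemann_lim_eq_integral continuous_on_mult reflect_continuous g_continuous_z)
    (auto intro: continuous_on_subset)

lemma G_continuous: "continuous_on A (G K x)"
proof -
  have "1 + ((\<alpha> * z - x) / s)\<^sup>2 \<noteq> 0" for z by (smt (verit) zero_le_power2)
  then show ?thesis
    unfolding G_def using s by (intro continuous_intros) auto
qed

lemma fluct_integrand_continuous:
  assumes "continuous_on UNIV w"
  shows "continuous_on {0..1} (\<lambda>z. \<bar>w (1 - z) - w (1 - x / \<alpha>)\<bar> * G K x z)"
  by (intro continuous_on_mult continuous_on_rabs continuous_on_diff continuous_on_const G_continuous
      reflect_continuous continuous_on_subset[OF assms]) auto

lemma fluct_eq:
  assumes "continuous_on UNIV w"
  shows "fluct K x w = integral {0..1} (\<lambda>z. \<bar>w (1 - z) - w (1 - x / \<alpha>)\<bar> * G K x z) + \<bar>w (1 - x / \<alpha>)\<bar> * H K x"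
  unfolding fluct_def by (simp add: riemann_lim_eq_integral fluct_integrand_continuous[OF assms])

lemma G_nonneg: "0 \<le> K \<Longrightarrow> 0 \<le> G K x z"
  using s by (simp add: G_def)

lemma H_nonneg: "0 \<le> K \<Longrightarrow> 0 \<le> H K x"
  using s by (simp add: H_def add_nonneg_nonneg)

lemma fluct_nonneg:
  assumes "continuous_on UNIV w" "0 \<le> K"
  shows "0 \<le> fluct K x w"
  unfolding fluct_eq[OF assms(1)]
  by (intro add_nonneg_nonneg Henstock_Kurzweil_Integration.integral_nonneg mult_nonneg_nonneg G_nonneg H_nonneg assms
      integrable_continuous_interval fluct_integrand_continuous) auto

lemma slope''_le_fluct:
  assumes w: "continuous_on UNIV w" and \<delta>: "0 < \<delta>" "\<delta> \<le> 1" and y: "\<delta> \<le> y" "y \<le> 1" "x \<le> y" "y \<le> x + s"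
  shows "\<bar>slope'' w (w (1 - x / \<alpha>)) y\<bar> \<le> fluct (kernel_const \<delta>) x w"
proof -
  let ?K = "kernel_const \<delta>" and ?d = "\<lambda>z. w (1 - z) - w (1 - x / \<alpha>)"
  have w01: "continuous_on {0..1} w" using w by (rule continuous_on_subset) auto
  have y0: "0 < y" using \<delta> y by simp
  have "norm (integral {0..1} (\<lambda>z. ?d z * g3 y z)) \<le> integral {0..1} (\<lambda>z. \<bar>?d z\<bar> * G ?K x z)"
  proof (rule Henstock_Kurzweil_Integration.integral_norm_bound_integral)
    show "(\<lambda>z. ?d z * g3 y z) integrable_on {0..1}"
      by (intro integrable_continuous_interval continuous_on_mult continuous_on_diff continuous_on_const
          reflect_continuous w01 g_continuous_z y0)
    show "(\<lambda>z. \<bar>?d z\<bar> * G ?K x z) integrable_on {0..1}"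
      by (intro integrable_continuous_interval fluct_integrand_continuous w)
    show "norm (?d z * g3 y z) \<le> \<bar>?d z\<bar> * G ?K x z" if "z \<in> {0..1}" for z
      using g3_le_G[of z \<delta> y x] that \<delta> y by (auto simp: abs_mult intro!: mult_left_mono)
  qed
  moreover have "\<bar>w (1 - x / \<alpha>) * k2 y 1\<bar> \<le> \<bar>w (1 - x / \<alpha>)\<bar> * H ?K x"
    using k2_le_H[OF \<delta> y(3,4)] by (auto simp: abs_mult intro!: mult_left_mono)
  ultimately show ?thesis
    unfolding slope''_def fluct_eq[OF w] by (simp add: order_trans[OF abs_triangle_ineq])
qed

lemma integral_cauchy_kernel_le:
  "integral {0..1} (\<lambda>z. 1 / (1 + ((\<alpha> * z - x) / s)\<^sup>2)) \<le> pi * s / \<alpha>"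
    "(\<lambda>z. 1 / (1 + ((\<alpha> * z - x) / s)\<^sup>2)) integrable_on {0..1}"
proof -
  let ?A = "\<lambda>z. s / \<alpha> * arctan ((\<alpha> * z - x) / s)"
  have "((\<lambda>z. 1 / (1 + ((\<alpha> * z - x) / s)\<^sup>2)) has_integral (?A 1 - ?A 0)) {0..1}"
  proof (rule fundamental_theorem_of_calculus)
    fix z :: real
    have "(?A has_real_derivative (s / \<alpha> * (inverse (1 + ((\<alpha> * z - x) / s)\<^sup>2) * (\<alpha> / s)))) (at z within {0..1})"
      using s by (auto intro!: derivative_eq_intros)
    moreover have "s / \<alpha> * (inverse (1 + ((\<alpha> * z - x) / s)\<^sup>2) * (\<alpha> / s)) = 1 / (1 + ((\<alpha> * z - x) / s)\<^sup>2)"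
      using s \<alpha> by (simp add: inverse_eq_divide)
    ultimately show "(?A has_vector_derivative 1 / (1 + ((\<alpha> * z - x) / s)\<^sup>2)) (at z within {0..1})"
      by (simp add: has_real_derivative_iff_has_vector_derivative)
  qed simp
  moreover have "?A 1 - ?A 0 \<le> s / \<alpha> * pi"
  proof -
    have "arctan ((\<alpha> * 1 - x) / s) - arctan ((\<alpha> * 0 - x) / s) \<le> pi"
      using arctan_ubound[of "(\<alpha> * 1 - x) / s"] arctan_lbound[of "(\<alpha> * 0 - x) / s"] by linarith
    then have "s / \<alpha> * (arctan ((\<alpha> * 1 - x) / s) - arctan ((\<alpha> * 0 - x) / s)) \<le> s / \<alpha> * pi"
      using s \<alpha> by (intro mult_left_mono) auto
    then show ?thesis by (simp add: right_diff_distrib)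
  qed
  ultimately show "integral {0..1} (\<lambda>z. 1 / (1 + ((\<alpha> * z - x) / s)\<^sup>2)) \<le> pi * s / \<alpha>"
    "(\<lambda>z. 1 / (1 + ((\<alpha> * z - x) / s)\<^sup>2)) integrable_on {0..1}"
    by (auto simp: integral_unique mult.commute)
qed

lemma integral_G_le:
  assumes K: "0 \<le> K"
  shows "integral {0..1} (G K x) \<le> K * pi / (\<alpha> * s ^ 3)"
    "integral {0..1} (\<lambda>z. \<bar>z - x / \<alpha>\<bar> * G K x z) \<le> K * pi / (\<alpha>\<^sup>2 * s\<^sup>2)"
proof -
  define c where "c z = 1 / (1 + ((\<alpha> * z - x) / s)\<^sup>2)" for z
  have c: "0 \<le> c z" "c z \<le> 1" "\<bar>(\<alpha> * z - x) / s\<bar> * c z \<le> 1" for z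
  proof -
    define u where "u = (\<alpha> * z - x) / s"
    have p: "0 < 1 + u\<^sup>2" by (smt (verit) zero_le_power2)
    have cu: "c z = 1 / (1 + u\<^sup>2)" by (simp add: c_def u_def)
    show "0 \<le> c z" "c z \<le> 1" using p by (simp_all add: cu)
    have "0 \<le> (\<bar>u\<bar> - 1)\<^sup>2" by simp
    then have "2 * \<bar>u\<bar> \<le> 1 + u\<^sup>2" by (simp add: power2_eq_square algebra_simps)
    then have "\<bar>u\<bar> \<le> 1 + u\<^sup>2" by linarith
    then show "\<bar>(\<alpha> * z - x) / s\<bar> * c z \<le> 1" unfolding u_def[symmetric] cu using p by simp
  qed
  have Gc: "G K x z = K / s ^ 4 * (c z)\<^sup>2" for z by (simp add: G_def c_def power_divide)
  note ci = integral_cauchy_kernel_le[of x, folded c_def]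
  have "integral {0..1} (G K x) \<le> integral {0..1} (\<lambda>z. K / s ^ 4 * c z)"
  proof (intro integral_le integrable_on_mult_right ci(2) integrable_continuous_interval G_continuous)
    fix z
    have "(c z)\<^sup>2 \<le> c z" using c[of z] by (simp add: power2_eq_square mult_left_le)
    then show "G K x z \<le> K / s ^ 4 * c z" unfolding Gc using K s by (intro mult_left_mono) auto
  qed
  also have "\<dots> \<le> K / s ^ 4 * (pi * s / \<alpha>)"
    using ci(1) K s by (simp add: mult_left_mono del: times_divide_eq_left times_divide_eq_right)
  also have "\<dots> = K * pi / (\<alpha> * s ^ 3)" using s by (simp add: eval_nat_numeral)
  finally show "integral {0..1} (G K x) \<le> K * pi / (\<alpha> * s ^ 3)" .
  have "integral {0..1} (\<lambda>z. \<bar>z - x / \<alpha>\<bar> * G K x z) \<le> integral {0..1} (\<lambda>z. K / (\<alpha> * s ^ 3) * c z)"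
  proof (intro integral_le integrable_on_mult_right ci(2) integrable_continuous_interval continuous_on_mult G_continuous)
    fix z
    have "z - x / \<alpha> = (s / \<alpha>) * ((\<alpha> * z - x) / s)" using s \<alpha> by (simp add: field_simps)
    then have "\<bar>z - x / \<alpha>\<bar> = (s / \<alpha>) * \<bar>(\<alpha> * z - x) / s\<bar>" using s \<alpha> by (simp add: abs_mult)
    then have "\<bar>z - x / \<alpha>\<bar> * G K x z = (s / \<alpha> * (K / s ^ 4)) * (\<bar>(\<alpha> * z - x) / s\<bar> * c z) * c z"
      unfolding Gc power2_eq_square by (simp only: mult_ac)
    also have "\<dots> \<le> (s / \<alpha> * (K / s ^ 4)) * 1 * c z"
      using c[of z] s \<alpha> K by (intro mult_right_mono mult_left_mono) auto
    also have "s / \<alpha> * (K / s ^ 4) = K / (\<alpha> * s ^ 3)" using s by (simp add: eval_nat_numeral)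
    finally show "\<bar>z - x / \<alpha>\<bar> * G K x z \<le> K / (\<alpha> * s ^ 3) * c z" by simp
  qed (auto intro!: continuous_intros)
  also have "\<dots> \<le> K / (\<alpha> * s ^ 3) * (pi * s / \<alpha>)"
    using ci(1) K s \<alpha> by (simp add: mult_left_mono del: times_divide_eq_left times_divide_eq_right)
  also have "\<dots> = K * pi / (\<alpha>\<^sup>2 * s\<^sup>2)" using s by (simp add: eval_nat_numeral)
  finally show "integral {0..1} (\<lambda>z. \<bar>z - x / \<alpha>\<bar> * G K x z) \<le> K * pi / (\<alpha>\<^sup>2 * s\<^sup>2)" .
qed

text \<open>The reference value of the path has variance \<open>1 - x / \<alpha>\<close>, which is small where the envelope \<open>H\<close> is large,
namely for \<open>x\<close> within a few \<open>s\<close> of \<open>\<alpha>\<close>.\<close>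
lemma H_sq_le:
  assumes K: "0 \<le> K" and x: "x \<le> \<alpha>"
  shows "(1 - x / \<alpha>) * (H K x)\<^sup>2 \<le> K\<^sup>2 / (\<alpha> * s ^ 5)"
proof -
  define u where "u = (\<alpha> - x) / s"
  have u: "0 \<le> u" using x s by (simp add: u_def)
  have p: "1 \<le> 1 + u\<^sup>2" by simp
  have "0 \<le> (u - 1)\<^sup>2" by simp
  then have "2 * u \<le> 1 + u\<^sup>2" by (simp add: power2_eq_square algebra_simps)
  then have "u * 1 \<le> (1 + u\<^sup>2) * (1 + u\<^sup>2)" using u p by (intro mult_mono) linarith+
  then have "u \<le> (1 + u\<^sup>2)\<^sup>2" by (simp only: power2_eq_square[of "1 + u\<^sup>2"] mult_1_right)
  moreover have "0 < (1 + u\<^sup>2)\<^sup>2" using p by (intro zero_less_power) linarith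
  ultimately have q: "u / (1 + u\<^sup>2)\<^sup>2 \<le> 1" by (simp only: pos_divide_le_eq mult_1_left)
  have "1 - x / \<alpha> = s / \<alpha> * u" using s \<alpha> by (simp add: u_def field_simps)
  then have "(1 - x / \<alpha>) * (H K x)\<^sup>2 = s / \<alpha> * (K / s ^ 3)\<^sup>2 * (u / (1 + u\<^sup>2)\<^sup>2)"
    unfolding H_def u_def[symmetric] by (simp add: power_divide power_mult_distrib power_mult[symmetric] mult_ac)
  also have "\<dots> \<le> s / \<alpha> * (K / s ^ 3)\<^sup>2 * 1"
    using q s \<alpha> by (intro mult_left_mono) auto
  also have "\<dots> = K\<^sup>2 / (\<alpha> * s ^ 5)" using s by (simp add: power_divide eval_nat_numeral)
  finally show ?thesis .
qed

text \<open>By Cauchy--Schwarz with weight \<open>G\<close> only second moments of increments enter, and these are the distances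
\<open>|z - x / \<alpha>|\<close>. The computation is done for the Riemann sums and passes to the limit by Fatou's lemma, which avoids joint
measurability of the path in time and outcome.\<close>
lemma fluct_second_moment:
  assumes W: "std_brownian_motion M W" and K: "0 \<le> K" and x: "0 \<le> x" "x \<le> \<alpha>"
  shows "(\<integral>\<^sup>+\<omega>. ennreal ((fluct K x (path_of W \<omega>))\<^sup>2) \<partial>M)
    \<le> ennreal (2 * K\<^sup>2 * (pi\<^sup>2 / \<alpha> ^ 3 + 1 / \<alpha>) / s ^ 5)"
proof -
  define z0 where "z0 = x / \<alpha>"
  have z0: "0 \<le> z0" "z0 \<le> 1" using x \<alpha> by (simp_all add: z0_def)
  define zz where "zz n i = real i / real (Suc n)" for n i
  have zz: "0 \<le> zz n i" "zz n i \<le> 1" if "i < Suc n" for n i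
    using that by (simp_all add: zz_def)
  define g where "g n i = G K x (zz n i) / real (Suc n)" for n i
  have g0: "0 \<le> g n i" for n i by (simp add: g_def G_nonneg K)
  define d where "d n i \<omega> = W (1 - zz n i) \<omega> - W (1 - z0) \<omega>" for n i \<omega>
  define e where "e \<omega> = W (1 - z0) \<omega> - W 0 \<omega>" for \<omega>
  define m where "m n \<omega> = (\<Sum>i<Suc n. \<bar>d n i \<omega>\<bar> * g n i) + \<bar>e \<omega>\<bar> * H K x" for n \<omega>
  define b where "b n \<omega> = 2 * ((\<Sum>i<Suc n. g n i) * (\<Sum>i<Suc n. (d n i \<omega>)\<^sup>2 * g n i) + (e \<omega>)\<^sup>2 * (H K x)\<^sup>2)" for n \<omega>
  define B where "B n = 2 * ((\<Sum>i<Suc n. g n i) * (\<Sum>i<Suc n. \<bar>zz n i - z0\<bar> * g n i) + (1 - z0) * (H K x)\<^sup>2)" for n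
  have mb: "(m n \<omega>)\<^sup>2 \<le> b n \<omega>" for n \<omega>
  proof -
    let ?A = "\<Sum>i<Suc n. \<bar>d n i \<omega>\<bar> * g n i" and ?h = "\<bar>e \<omega>\<bar> * H K x"
    have "0 \<le> (?A - ?h)\<^sup>2" by simp
    then have "(?A + ?h)\<^sup>2 \<le> 2 * (?A\<^sup>2 + ?h\<^sup>2)" by (simp add: power2_eq_square algebra_simps)
    also have "?A\<^sup>2 \<le> (\<Sum>i<Suc n. g n i) * (\<Sum>i<Suc n. (d n i \<omega>)\<^sup>2 * g n i)"
      by (rule weighted_sum_squared_le) (rule g0)
    also have "?h\<^sup>2 = (e \<omega>)\<^sup>2 * (H K x)\<^sup>2" by (simp add: power_mult_distrib)
    finally show ?thesis unfolding m_def b_def by simp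
  qed
  have di: "integrable M (\<lambda>\<omega>. (d n i \<omega>)\<^sup>2)" "(\<integral>\<omega>. (d n i \<omega>)\<^sup>2 \<partial>M) = \<bar>zz n i - z0\<bar>" if "i < Suc n" for n i
    using brownian_increment_second_moment[OF W, of "1 - zz n i" "1 - z0"] zz[OF that] z0
    by (simp_all add: d_def abs_minus_commute)
  have ei: "integrable M (\<lambda>\<omega>. (e \<omega>)\<^sup>2)" "(\<integral>\<omega>. (e \<omega>)\<^sup>2 \<partial>M) = 1 - z0"
    using brownian_increment_second_moment[OF W, of "1 - z0" 0] z0 by (simp_all add: e_def)
  have bi: "integrable M (b n)" for n
    unfolding b_def
    by (intro integrable_mult_right Bochner_Integration.integrable_add Bochner_Integration.integrable_sum
        integrable_mult_left di ei) simp
  have bB: "(\<integral>\<omega>. b n \<omega> \<partial>M) = B n" for n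
  proof -
    have "(\<integral>\<omega>. b n \<omega> \<partial>M) = 2 * ((\<Sum>i<Suc n. g n i) * (\<integral>\<omega>. (\<Sum>i<Suc n. (d n i \<omega>)\<^sup>2 * g n i) \<partial>M) + (\<integral>\<omega>. (e \<omega>)\<^sup>2 * (H K x)\<^sup>2 \<partial>M))"
      unfolding b_def integral_mult_right_zero
      by (subst Bochner_Integration.integral_add)
        (auto intro!: integrable_mult_right Bochner_Integration.integrable_sum integrable_mult_left di ei simp del: sum.lessThan_Suc)
    also have "(\<integral>\<omega>. (\<Sum>i<Suc n. (d n i \<omega>)\<^sup>2 * g n i) \<partial>M) = (\<Sum>i<Suc n. \<bar>zz n i - z0\<bar> * g n i)"
      by (subst Bochner_Integration.integral_sum)
        (auto intro!: sum.cong integrable_mult_left di simp: di(2) simp del: sum.lessThan_Suc)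
    also have "(\<integral>\<omega>. (e \<omega>)\<^sup>2 * (H K x)\<^sup>2 \<partial>M) = (1 - z0) * (H K x)\<^sup>2" by (simp add: ei(2))
    finally show ?thesis by (simp add: B_def)
  qed
  have b0: "0 \<le> b n \<omega>" for n \<omega> using order_trans[OF zero_le_power2 mb] .
  have Wm: "W r \<in> borel_measurable M" if "0 \<le> r" "r \<le> 1" for r
    using W that by (auto simp: std_brownian_motion_def)
  have dm: "d n i \<in> borel_measurable M" if "i < Suc n" for n i
    unfolding d_def using zz[OF that] z0 by (intro borel_measurable_diff Wm) auto
  have em: "e \<in> borel_measurable M"
    unfolding e_def using z0 by (intro borel_measurable_diff Wm) auto
  have mm: "m n \<in> borel_measurable M" for n
    unfolding m_def
    by (intro borel_measurable_add borel_measurable_sum borel_measurable_times borel_measurable_abs dm em borel_measurable_const) simp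
  have mB: "(\<integral>\<^sup>+\<omega>. ennreal ((m n \<omega>)\<^sup>2) \<partial>M) \<le> ennreal (B n)" for n
  proof -
    have "(\<integral>\<^sup>+\<omega>. ennreal ((m n \<omega>)\<^sup>2) \<partial>M) \<le> (\<integral>\<^sup>+\<omega>. ennreal (b n \<omega>) \<partial>M)"
      by (intro nn_integral_mono ennreal_leI mb)
    also have "\<dots> = ennreal (B n)"
      using nn_integral_eq_integral[OF bi] b0 by (simp add: bB)
    finally show ?thesis .
  qed
  let ?I = "2 * (integral {0..1} (G K x) * integral {0..1} (\<lambda>z. \<bar>z - z0\<bar> * G K x z) + (1 - z0) * (H K x)\<^sup>2)"
  have lim: "B \<longlonglongrightarrow> ?I"
  proof -
    have "riemann_sum (G K x) \<longlonglongrightarrow> integral {0..1} (G K x)"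
      by (rule riemann_sum_tendsto[OF G_continuous])
    moreover have "riemann_sum (\<lambda>z. \<bar>z - z0\<bar> * G K x z) \<longlonglongrightarrow> integral {0..1} (\<lambda>z. \<bar>z - z0\<bar> * G K x z)"
      by (intro riemann_sum_tendsto continuous_on_mult G_continuous continuous_intros)
    moreover have "B = (\<lambda>n. 2 * (riemann_sum (G K x) n * riemann_sum (\<lambda>z. \<bar>z - z0\<bar> * G K x z) n + (1 - z0) * (H K x)\<^sup>2))"
      by (simp only: B_def riemann_sum_def g_def zz_def times_divide_eq_right fun_eq_iff) simp
    ultimately show ?thesis by (auto intro!: tendsto_intros)
  qed
  have "(\<integral>\<^sup>+\<omega>. ennreal ((fluct K x (path_of W \<omega>))\<^sup>2) \<partial>M) = (\<integral>\<^sup>+\<omega>. liminf (\<lambda>n. ennreal ((m n \<omega>)\<^sup>2)) \<partial>M)"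
  proof (rule nn_integral_cong_AE)
    have "AE \<omega> in M. W 0 \<omega> = 0" using W by (simp add: std_brownian_motion_def)
    then show "AE \<omega> in M. ennreal ((fluct K x (path_of W \<omega>))\<^sup>2) = liminf (\<lambda>n. ennreal ((m n \<omega>)\<^sup>2))"
      using AE_path_continuous[OF W]
    proof eventually_elim
      fix \<omega> assume W0: "W 0 \<omega> = 0" and c: "continuous_on UNIV (path_of W \<omega>)"
      let ?F = "\<lambda>z. \<bar>path_of W \<omega> (1 - z) - path_of W \<omega> (1 - x / \<alpha>)\<bar> * G K x z"
      have "(\<lambda>n. riemann_sum ?F n + \<bar>path_of W \<omega> (1 - x / \<alpha>)\<bar> * H K x) \<longlonglongrightarrow> fluct K x (path_of W \<omega>)"
        unfolding fluct_eq[OF c] by (intro tendsto_intros riemann_sum_tendsto fluct_integrand_continuous c)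
      moreover have "riemann_sum ?F n + \<bar>path_of W \<omega> (1 - x / \<alpha>)\<bar> * H K x = m n \<omega>" for n
      proof -
        have p: "path_of W \<omega> (1 - x / \<alpha>) = W (1 - z0) \<omega>" using z0 by (simp add: path_of_def z0_def)
        have "path_of W \<omega> (1 - zz n i) = W (1 - zz n i) \<omega>" if "i < Suc n" for i
          using zz[OF that] by (simp add: path_of_def)
        then have "riemann_sum ?F n = (\<Sum>i<Suc n. \<bar>d n i \<omega>\<bar> * g n i)"
          unfolding riemann_sum_def zz_def[symmetric] d_def g_def p by (intro sum.cong) auto
        then show ?thesis using W0 by (simp add: m_def e_def p)
      qed
      ultimately have "(\<lambda>n. m n \<omega>) \<longlonglongrightarrow> fluct K x (path_of W \<omega>)" by simp
      then have L: "(\<lambda>n. ennreal ((m n \<omega>)\<^sup>2)) \<longlonglongrightarrow> ennreal ((fluct K x (path_of W \<omega>))\<^sup>2)"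
        by (intro tendsto_ennrealI tendsto_power)
      then show "ennreal ((fluct K x (path_of W \<omega>))\<^sup>2) = liminf (\<lambda>n. ennreal ((m n \<omega>)\<^sup>2))"
        by (intro lim_imp_Liminf[OF _ L, symmetric]) simp
    qed
  qed
  also have "\<dots> \<le> liminf (\<lambda>n. \<integral>\<^sup>+\<omega>. ennreal ((m n \<omega>)\<^sup>2) \<partial>M)"
    by (intro nn_integral_liminf measurable_compose[OF _ measurable_ennreal] borel_measurable_power mm)
  also have "\<dots> \<le> liminf (\<lambda>n. ennreal (B n))"
    by (intro Liminf_mono) (simp add: mB)
  also have "\<dots> = ennreal (?I)"
    by (intro lim_imp_Liminf tendsto_ennrealI lim) simp
  also have "\<dots> \<le> ennreal (2 * K\<^sup>2 * (pi\<^sup>2 / \<alpha> ^ 3 + 1 / \<alpha>) / s ^ 5)"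
  proof (rule ennreal_leI)
    have "0 \<le> integral {0..1} (\<lambda>z. \<bar>z - z0\<bar> * G K x z)"
      by (intro Henstock_Kurzweil_Integration.integral_nonneg integrable_continuous_interval continuous_on_mult G_continuous
          mult_nonneg_nonneg G_nonneg K continuous_intros) auto
    then have "integral {0..1} (G K x) * integral {0..1} (\<lambda>z. \<bar>z - z0\<bar> * G K x z)
        \<le> K * pi / (\<alpha> * s ^ 3) * (K * pi / (\<alpha>\<^sup>2 * s\<^sup>2))"
      using integral_G_le[OF K, of x] K \<alpha> s unfolding z0_def by (intro mult_mono) auto
    also have "\<dots> = K\<^sup>2 * pi\<^sup>2 / (\<alpha> ^ 3 * s ^ 5)" by (simp add: eval_nat_numeral mult_ac)
    finally have "?I
        \<le> 2 * (K\<^sup>2 * pi\<^sup>2 / (\<alpha> ^ 3 * s ^ 5) + K\<^sup>2 / (\<alpha> * s ^ 5))"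
      using H_sq_le[OF K x(2)] unfolding z0_def by (intro mult_left_mono add_mono) auto
    also have "\<dots> = 2 * K\<^sup>2 * (pi\<^sup>2 / \<alpha> ^ 3 + 1 / \<alpha>) / s ^ 5"
      by (simp add: distrib_left add_divide_distrib)
    finally show "?I
        \<le> 2 * K\<^sup>2 * (pi\<^sup>2 / \<alpha> ^ 3 + 1 / \<alpha>) / s ^ 5" .
  qed
  finally show ?thesis .
qed

end

section \<open>Near double zeros\<close>

text \<open>Twice the bound in \<open>fluct_second_moment\<close> plus twice the square of the doubled increase of \<open>fluct\<close> under a
shift, both without the factor \<open>1 / s ^ 5\<close>.\<close>
definition fluct_const :: "real \<Rightarrow> real \<Rightarrow> real" where
  "fluct_const \<alpha> K = 4 * K\<^sup>2 * (pi\<^sup>2 / \<alpha> ^ 3 + 1 / \<alpha>) + 32 * K\<^sup>2 * (pi / \<alpha> + 1)\<^sup>2"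

definition pair_const :: "real \<Rightarrow> real \<Rightarrow> real" where
  "pair_const \<alpha> \<delta> = 32 * (1 + exp (1/2))\<^sup>2 * fluct_const \<alpha> (kernel_const \<delta>) / det_const \<delta>"

lemma ramp_bounds: "a \<le> b \<Longrightarrow> 0 \<le> ramp a b r" "a \<le> b \<Longrightarrow> ramp a b r \<le> b - a"
  by (auto simp: ramp_def)

context conga_kernel
begin

lemma fluct_shift_le:
  assumes w: "continuous_on UNIV w" and d: "continuous_on UNIV d" and K: "0 \<le> K"
    and b: "\<And>r. \<bar>d r\<bar> \<le> B" "\<And>u v. \<bar>d u - d v\<bar> \<le> B"
  shows "fluct K x (\<lambda>r. w r + d r) \<le> fluct K x w + B * (K * (pi / \<alpha> + 1) / s ^ 3)"
proof -
  let ?r = "1 - x / \<alpha>"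
  let ?L = "\<lambda>z. \<bar>(w (1 - z) + d (1 - z)) - (w ?r + d ?r)\<bar> * G K x z"
  have wd: "continuous_on UNIV (\<lambda>r. w r + d r)" using w d by (rule continuous_on_add)
  have B: "0 \<le> B" using b(1)[of 0] by linarith
  have "integral {0..1} ?L
      \<le> integral {0..1} (\<lambda>z. \<bar>w (1 - z) - w ?r\<bar> * G K x z + B * G K x z)"
  proof (rule integral_le)
    show "?L integrable_on {0..1}"
      using fluct_integrand_continuous[OF wd] by (intro integrable_continuous_interval) simp
    show "(\<lambda>z. \<bar>w (1 - z) - w ?r\<bar> * G K x z + B * G K x z) integrable_on {0..1}"
      by (intro integrable_continuous_interval continuous_on_add fluct_integrand_continuous w
          continuous_on_mult continuous_on_const G_continuous)
    fix z :: real
    have "\<bar>(w (1 - z) + d (1 - z)) - (w ?r + d ?r)\<bar> \<le> \<bar>w (1 - z) - w ?r\<bar> + B"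
      using b(2)[of "1 - z" ?r] by linarith
    then show "\<bar>(w (1 - z) + d (1 - z)) - (w ?r + d ?r)\<bar> * G K x z \<le> \<bar>w (1 - z) - w ?r\<bar> * G K x z + B * G K x z"
      unfolding distrib_right[symmetric] by (intro mult_right_mono G_nonneg K)
  qed
  also have "\<dots> = integral {0..1} (\<lambda>z. \<bar>w (1 - z) - w ?r\<bar> * G K x z) + B * integral {0..1} (G K x)"
    by (subst Henstock_Kurzweil_Integration.integral_add)
      (auto intro!: integrable_continuous_interval fluct_integrand_continuous w continuous_on_mult continuous_on_const G_continuous)
  also have "\<dots> \<le> integral {0..1} (\<lambda>z. \<bar>w (1 - z) - w ?r\<bar> * G K x z) + B * (K * pi / (\<alpha> * s ^ 3))"
    using integral_G_le(1)[OF K] B by (intro add_left_mono mult_left_mono)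
  finally have 1: "integral {0..1} ?L
    \<le> integral {0..1} (\<lambda>z. \<bar>w (1 - z) - w ?r\<bar> * G K x z) + B * (K * pi / (\<alpha> * s ^ 3))" .
  have "H K x \<le> K / s ^ 3 / 1"
    unfolding H_def using K s by (intro divide_left_mono) (auto simp: add_pos_nonneg)
  then have HB: "B * H K x \<le> B * (K / s ^ 3)" using B by (intro mult_left_mono) auto
  have "\<bar>w ?r + d ?r\<bar> \<le> \<bar>w ?r\<bar> + B" using b(1)[of ?r] by linarith
  then have "\<bar>w ?r + d ?r\<bar> * H K x \<le> (\<bar>w ?r\<bar> + B) * H K x" by (intro mult_right_mono H_nonneg K)
  then have 2: "\<bar>w ?r + d ?r\<bar> * H K x \<le> \<bar>w ?r\<bar> * H K x + B * (K / s ^ 3)"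
    using HB by (simp add: distrib_right)
  have "K * pi / (\<alpha> * s ^ 3) + K / s ^ 3 = K * (pi / \<alpha> + 1) / s ^ 3"
    by (simp add: distrib_left add_divide_distrib)
  then have 3: "B * (K * pi / (\<alpha> * s ^ 3)) + B * (K / s ^ 3) = B * (K * (pi / \<alpha> + 1) / s ^ 3)"
    by (simp only: distrib_left[symmetric])
  show ?thesis unfolding fluct_eq[OF w] fluct_eq[OF wd] using 1 2 3 by linarith
qed

lemma fluct_shifted_second_moment:
  assumes W: "std_brownian_motion M W" and K: "0 \<le> K" and x: "0 \<le> x" "x \<le> \<alpha>"
  shows "(\<integral>\<^sup>+\<omega>. ennreal ((fluct K x (path_of W \<omega>) + 2 * (2 * sqrt s * (K * (pi / \<alpha> + 1) / s ^ 3)))\<^sup>2) \<partial>M)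
    \<le> ennreal (fluct_const \<alpha> K / s ^ 5)"
proof -
  interpret prob_space M using W by (simp add: std_brownian_motion_def)
  let ?F = "\<lambda>\<omega>. fluct K x (path_of W \<omega>)"
  define b where "b = 2 * (2 * sqrt s * (K * (pi / \<alpha> + 1) / s ^ 3))"
  have F: "?F \<in> borel_measurable M"
    using measurable_comp[OF path_of_measurable[OF W] fluct_measurable] by (simp add: comp_def)
  have le: "(u + b)\<^sup>2 \<le> 2 * u\<^sup>2 + 2 * b\<^sup>2" for u
  proof -
    have "0 \<le> (u - b)\<^sup>2" by simp
    then show ?thesis by (simp add: power2_eq_square algebra_simps)
  qed
  have b2: "2 * b\<^sup>2 = 32 * K\<^sup>2 * (pi / \<alpha> + 1)\<^sup>2 / s ^ 5"
  proof -
    have "b\<^sup>2 = 16 * (sqrt s)\<^sup>2 * (K\<^sup>2 * (pi / \<alpha> + 1)\<^sup>2 / s ^ 6)"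
      by (simp add: b_def power_mult_distrib power_divide power_mult[symmetric])
    also have "\<dots> = 16 * K\<^sup>2 * (pi / \<alpha> + 1)\<^sup>2 / s ^ 5" using s by (simp add: eval_nat_numeral)
    finally show ?thesis by simp
  qed
  have "(\<integral>\<^sup>+\<omega>. ennreal ((?F \<omega> + b)\<^sup>2) \<partial>M) \<le> (\<integral>\<^sup>+\<omega>. 2 * ennreal ((?F \<omega>)\<^sup>2) + ennreal (2 * b\<^sup>2) \<partial>M)"
  proof (rule nn_integral_mono)
    fix \<omega>
    have "ennreal ((?F \<omega> + b)\<^sup>2) \<le> ennreal (2 * (?F \<omega>)\<^sup>2 + 2 * b\<^sup>2)" by (intro ennreal_leI le)
    also have "\<dots> = ennreal (2 * (?F \<omega>)\<^sup>2) + ennreal (2 * b\<^sup>2)" by (intro ennreal_plus) auto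
    also have "ennreal (2 * (?F \<omega>)\<^sup>2) = 2 * ennreal ((?F \<omega>)\<^sup>2)" by (simp add: ennreal_mult)
    finally show "ennreal ((?F \<omega> + b)\<^sup>2) \<le> 2 * ennreal ((?F \<omega>)\<^sup>2) + ennreal (2 * b\<^sup>2)" .
  qed
  also have "\<dots> = 2 * (\<integral>\<^sup>+\<omega>. ennreal ((?F \<omega>)\<^sup>2) \<partial>M) + ennreal (2 * b\<^sup>2)"
    using F by (subst nn_integral_add) (auto simp: nn_integral_cmult emeasure_space_1)
  also have "\<dots> \<le> 2 * ennreal (2 * K\<^sup>2 * (pi\<^sup>2 / \<alpha> ^ 3 + 1 / \<alpha>) / s ^ 5) + ennreal (2 * b\<^sup>2)"
    by (intro add_right_mono mult_left_mono fluct_second_moment assms) simp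
  also have "\<dots> = ennreal (2 * (2 * K\<^sup>2 * (pi\<^sup>2 / \<alpha> ^ 3 + 1 / \<alpha>) / s ^ 5)) + ennreal (2 * b\<^sup>2)"
    using \<alpha> s by (subst ennreal_mult) auto
  also have "\<dots> = ennreal (2 * (2 * K\<^sup>2 * (pi\<^sup>2 / \<alpha> ^ 3 + 1 / \<alpha>) / s ^ 5) + 2 * b\<^sup>2)"
    using \<alpha> s by (intro ennreal_plus[symmetric]) auto
  also have "2 * (2 * K\<^sup>2 * (pi\<^sup>2 / \<alpha> ^ 3 + 1 / \<alpha>) / s ^ 5) + 2 * b\<^sup>2 = fluct_const \<alpha> K / s ^ 5"
    unfolding b2 fluct_const_def by (simp add: add_divide_distrib)
  finally show ?thesis unfolding b_def .
qed

text \<open>The shift directions are ramps over two intervals of length \<open>s\<close> close to the time \<open>1 - x / \<alpha>\<close>. Their height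
\<open>c s\<close>, which is \<open>sqrt s\<close>, is the typical size of a Brownian increment over such an interval, which makes the shift densities of
order one and keeps the change of \<open>fluct\<close> within the order of its standard deviation.\<close>
lemma near_double_zero_probability:
  assumes W: "std_brownian_motion M W" and \<delta>: "0 < \<delta>" "\<delta> \<le> 1" "6 * s \<le> \<delta>" and x: "\<delta> \<le> x" "x \<le> \<alpha>"
    and pq: "x \<le> p" "p < q" "q \<le> x + s" and e: "0 \<le> e"
  defines "Q \<equiv> fluct (kernel_const \<delta>) x"
  shows "emeasure M {\<omega> \<in> space M. \<bar>slope_fun p (path_of W \<omega>)\<bar> \<le> 2 * e * (q - p) * Q (path_of W \<omega>) \<and>
      \<bar>slope_fun q (path_of W \<omega>) - slope_fun p (path_of W \<omega>)\<bar> \<le> 4 * e * (q - p) * Q (path_of W \<omega>)}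
    \<le> ennreal (pair_const \<alpha> \<delta> * e\<^sup>2 * (q - p) / s ^ 3)"
    (is "emeasure M ?S \<le> _")
proof -
  let ?c = "4 * (1 + exp (1/2))\<^sup>2 * (2 * e * (q - p)) * (4 * e * (q - p))"
  define K where "K = kernel_const \<delta>"
  have K: "0 \<le> K" using \<delta> by (simp add: K_def kernel_const_def)
  define z0 where "z0 = x / \<alpha>"
  have "x \<le> x / \<alpha>" using \<alpha> \<delta> x by (simp add: pos_le_divide_eq mult_left_le)
  then have z0: "6 * s \<le> z0" "z0 \<le> 1" using \<delta> x \<alpha> by (auto simp: z0_def)
  define A1 where "A1 y = integral {z0 - 3 * s..z0 - 2 * s} (k0 y)" for y
  define A2 where "A2 y = integral {z0 - s..z0} (k0 y)" for y
  note det = determinant_lower_bound[OF \<delta>(1,3) x pq, folded z0_def, folded A1_def A2_def]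
  have p0: "0 < p" "0 < q" using pq x \<delta> by auto
  define c where "c = 1 / sqrt s"
  have c2: "c\<^sup>2 * s = 1" using s by (simp add: c_def power_divide)
  have cs: "\<bar>c\<bar> * s = sqrt s" using s by (simp add: c_def real_div_sqrt)
  define l1 r1 l2 r2 where "l1 = 1 - z0" and "r1 = 1 - (z0 - s)" and "l2 = 1 - (z0 - 2 * s)" and "r2 = 1 - (z0 - 3 * s)"
  note lr_def = l1_def r1_def l2_def r2_def
  have lr: "0 \<le> l1" "l1 < r1" "r1 \<le> l2" "l2 < r2" "r2 \<le> 1" using z0 s by (auto simp: lr_def)
  have len: "r1 - l1 = s" "r2 - l2 = s" by (auto simp: lr_def)
  let ?\<psi> = "\<lambda>s1 s2 r. s1 * c * ramp l1 r1 r + s2 * c * ramp l2 r2 r"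
  have \<psi>c: "continuous_on A (?\<psi> s1 s2)" for A s1 s2
    by (intro continuous_intros continuous_on_subset[OF ramp_continuous]) auto
  have sub: "continuous_on {0..1} w" if "continuous_on UNIV w" for w :: "real \<Rightarrow> real"
    using that by (rule continuous_on_subset) auto
  have ramp_sl: "slope (ramp l1 r1) y = A2 y" "slope (ramp l2 r2) y = A1 y" if "0 < y" for y
    using slope_ramp[OF that, of "z0 - s" z0] slope_ramp[OF that, of "z0 - 3 * s" "z0 - 2 * s"] z0 s
    by (simp_all add: lr_def A1_def A2_def)
  have X: "slope_fun y (\<lambda>r. w r + ?\<psi> s1 s2 r) = slope_fun y w + s1 * (c * A2 y) + s2 * (c * A1 y)"
    if w: "continuous_on UNIV w" and y: "0 < y" for w s1 s2 y
  proof -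
    have wc: "continuous_on UNIV (\<lambda>r. w r + ?\<psi> s1 s2 r)" using w \<psi>c by (rule continuous_on_add)
    have rc: "continuous_on {0..1} (\<lambda>r. k * ramp a b r)" for k a b
      by (intro continuous_intros continuous_on_subset[OF ramp_continuous]) auto
    have "slope_fun y (\<lambda>r. w r + ?\<psi> s1 s2 r) = slope w y + slope (?\<psi> s1 s2) y"
      unfolding slope_fun_eq[OF wc y] by (rule slope_add[OF sub[OF w] \<psi>c y])
    also have "slope (?\<psi> s1 s2) y = s1 * c * A2 y + s2 * c * A1 y"
      unfolding slope_add[OF rc rc y] slope_cmult ramp_sl[OF y] ..
    finally show ?thesis by (simp add: slope_fun_eq[OF w y])
  qed
  have Y: "(slope_fun q (\<lambda>r. w r + ?\<psi> s1 s2 r) - slope_fun p (\<lambda>r. w r + ?\<psi> s1 s2 r))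
      = (slope_fun q w - slope_fun p w) + s1 * (c * (A2 q - A2 p)) + s2 * (c * (A1 q - A1 p))"
    if w: "continuous_on UNIV w" for w s1 s2
    unfolding X[OF w p0(1)] X[OF w p0(2)] by (simp add: algebra_simps)
  define m where "m = 2 * sqrt s * (K * (pi / \<alpha> + 1) / s ^ 3)"
  have m: "0 \<le> m" using K \<alpha> s by (simp add: m_def)
  have Qs: "Q (\<lambda>r. w r + ?\<psi> s1 s2 r) \<le> Q w + m"
    if w: "continuous_on UNIV w" and s12: "\<bar>s1\<bar> \<le> 1" "\<bar>s2\<bar> \<le> 1" for w s1 s2
    unfolding Q_def K_def[symmetric] m_def
  proof (rule fluct_shift_le[OF w \<psi>c K])
    have scale: "\<bar>k * c * u\<bar> \<le> sqrt s" if "\<bar>k\<bar> \<le> 1" "\<bar>u\<bar> \<le> s" for k u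
    proof -
      have "\<bar>k * c * u\<bar> = \<bar>k\<bar> * (\<bar>c\<bar> * \<bar>u\<bar>)" by (simp add: abs_mult)
      also have "\<dots> \<le> 1 * (\<bar>c\<bar> * s)" using that by (intro mult_mono) (auto intro: mult_nonneg_nonneg)
      finally show ?thesis using cs by simp
    qed
    fix u v :: real
    have rb: "0 \<le> ramp l1 r1 u" "ramp l1 r1 u \<le> s" "0 \<le> ramp l2 r2 u" "ramp l2 r2 u \<le> s"
      "0 \<le> ramp l1 r1 v" "ramp l1 r1 v \<le> s" "0 \<le> ramp l2 r2 v" "ramp l2 r2 v \<le> s"
      using ramp_bounds[of l1 r1] ramp_bounds[of l2 r2] len lr by auto
    show "\<bar>?\<psi> s1 s2 u\<bar> \<le> 2 * sqrt s"
      using scale[OF s12(1), of "ramp l1 r1 u"] scale[OF s12(2), of "ramp l2 r2 u"] rb by linarith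
    have "?\<psi> s1 s2 u - ?\<psi> s1 s2 v = s1 * c * (ramp l1 r1 u - ramp l1 r1 v) + s2 * c * (ramp l2 r2 u - ramp l2 r2 v)"
      by (simp add: algebra_simps)
    then show "\<bar>?\<psi> s1 s2 u - ?\<psi> s1 s2 v\<bar> \<le> 2 * sqrt s"
      using scale[OF s12(1), of "ramp l1 r1 u - ramp l1 r1 v"] scale[OF s12(2), of "ramp l2 r2 u - ramp l2 r2 v"] rb
      by linarith
  qed
  \<comment> \<open>Time runs backwards: the interval next to \<open>x / \<alpha>\<close> in \<open>z\<close> comes first in \<open>r = 1 - z\<close>, which reverses the sign of the determinant.\<close>
  define D where "D = A1 p * A2 q - A2 p * A1 q"
  define dc where "dc = det_const \<delta>"
  have dc: "0 < dc" using \<delta> by (simp add: dc_def det_const_def)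
  have Dlow: "dc * (q - p) / s \<le> D" using det(2) by (simp add: D_def dc_def)
  have D0: "0 < D" using Dlow dc pq s by (intro less_le_trans[OF _ Dlow]) auto
  have Deq: "(c * A2 p) * (c * (A1 q - A1 p)) - (c * A1 p) * (c * (A2 q - A2 p)) = - (c\<^sup>2 * D)"
    by (simp add: D_def power2_eq_square algebra_simps)
  have c0: "0 < c\<^sup>2" using s by (simp add: c_def)
  have a1: "c * A2 p \<noteq> 0" using det(1) c0 by auto
  have fm: "0 \<le> fluct_const \<alpha> K" using \<alpha> by (simp add: fluct_const_def)
  have "emeasure M ?S
    \<le> ennreal (?c
        / \<bar>(c * A2 p) * (c * (A1 q - A1 p)) - (c * A1 p) * (c * (A2 q - A2 p))\<bar>)
      * (\<integral>\<^sup>+\<omega>. ennreal ((Q (path_of W \<omega>) + 2 * m)\<^sup>2) \<partial>M)"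
  proof (rule gaussian_anticoncentration[OF W lr, where c = c and X = "slope_fun p"
        and Y = "\<lambda>w. slope_fun q w - slope_fun p w" and Q = Q])
    show "c\<^sup>2 * (r1 - l1) = 1" "c\<^sup>2 * (r2 - l2) = 1" unfolding len by (rule c2)+
    show "slope_fun p \<in> borel_measurable path_space" by (rule slope_fun_measurable)
    show "(\<lambda>w. slope_fun q w - slope_fun p w) \<in> borel_measurable path_space"
      by (intro borel_measurable_diff slope_fun_measurable)
    show "Q \<in> borel_measurable path_space" unfolding Q_def by (rule fluct_measurable)
    show "(c * A2 p) * (c * (A1 q - A1 p)) - (c * A1 p) * (c * (A2 q - A2 p)) \<noteq> 0"
      unfolding Deq using c0 D0 by simp
    show "0 \<le> Q w" if "continuous_on UNIV w" for w
      unfolding Q_def using that K by (intro fluct_nonneg) (simp_all add: K_def)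
  qed (use X p0 Y Qs m a1 e pq in auto)
  also have "\<dots> \<le> ennreal (?c / (c\<^sup>2 * D))
      * ennreal (fluct_const \<alpha> K / s ^ 5)"
  proof -
    have "\<bar>(c * A2 p) * (c * (A1 q - A1 p)) - (c * A1 p) * (c * (A2 q - A2 p))\<bar> = c\<^sup>2 * D"
      unfolding Deq using D0 c0 by simp
    then show ?thesis
      unfolding Q_def K_def[symmetric] m_def using \<delta> x
      by (simp only:) (intro mult_left_mono fluct_shifted_second_moment W K; simp)
  qed
  also have "\<dots> = ennreal (?c / (c\<^sup>2 * D)
      * (fluct_const \<alpha> K / s ^ 5))"
    using e pq D0 c0 fm s by (intro ennreal_mult[symmetric]) auto
  also have "\<dots> \<le> ennreal (pair_const \<alpha> \<delta> * e\<^sup>2 * (q - p) / s ^ 3)"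
  proof (rule ennreal_leI)
    have "dc * (q - p) / s\<^sup>2 = c\<^sup>2 * (dc * (q - p) / s)"
      using s by (simp add: c_def power_divide power2_eq_square)
    also have "\<dots> \<le> c\<^sup>2 * D" using Dlow c0 by (intro mult_left_mono) auto
    finally have cD: "dc * (q - p) / s\<^sup>2 \<le> c\<^sup>2 * D" .
    have "?c / (c\<^sup>2 * D) * (fluct_const \<alpha> K / s ^ 5)
      \<le> ?c / (dc * (q - p) / s\<^sup>2) * (fluct_const \<alpha> K / s ^ 5)"
      using cD e pq dc s c0 D0 fm by (intro mult_right_mono divide_left_mono mult_nonneg_nonneg mult_pos_pos divide_pos_pos) auto
    also have "\<dots> = pair_const \<alpha> \<delta> * e\<^sup>2 * (q - p) / s ^ 3"
    proof -
      have "4 * E * (2 * e * d) * (4 * e * d) / (dc * d / s\<^sup>2) * (F / s ^ 5) = 32 * E * F / dc * e\<^sup>2 * d / s ^ 3"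
        if "0 < d" for d E F :: real
        using that s dc by (simp add: field_simps eval_nat_numeral)
      from this[of "q - p"] show ?thesis using pq by (simp add: pair_const_def dc_def K_def)
    qed
    finally show "?c / (c\<^sup>2 * D) * (fluct_const \<alpha> K / s ^ 5)
      \<le> pair_const \<alpha> \<delta> * e\<^sup>2 * (q - p) / s ^ 3" .
  qed
  finally show ?thesis .
qed

end

text \<open>Between the zeros \<open>f'\<close> vanishes somewhere, so \<open>|f'|\<close> is at most \<open>M\<close> times the length \<open>q + e - p\<close>, which is
at most \<open>2 (q - p)\<close>. Both \<open>p\<close> and \<open>q\<close> are within \<open>e\<close> of a zero.\<close>
lemma two_zeros_small_values:
  fixes f f' f'' :: "real \<Rightarrow> real"
  assumes f: "\<And>u. u \<in> {p..q + e} \<Longrightarrow> (f has_real_derivative f' u) (at u)"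
    and f': "\<And>u. u \<in> {p..q + e} \<Longrightarrow> (f' has_real_derivative f'' u) (at u)"
    and M: "\<And>u. u \<in> {p..q + e} \<Longrightarrow> \<bar>f'' u\<bar> \<le> M"
    and pq: "p + e \<le> q" "0 \<le> e"
    and y: "y1 \<in> {p..p + e}" "y2 \<in> {q..q + e}" "y1 \<noteq> y2" "f y1 = 0" "f y2 = 0"
  shows "\<bar>f p\<bar> \<le> 2 * e * (q - p) * M" "\<bar>f q - f p\<bar> \<le> 4 * e * (q - p) * M"
proof -
  have M0: "0 \<le> M" using M[of p] pq by auto
  have lip: "\<bar>g u - g v\<bar> \<le> B * \<bar>u - v\<bar>"
    if d: "\<And>u. u \<in> {p..q + e} \<Longrightarrow> (g has_real_derivative g' u) (at u)"
      and B: "\<And>u. u \<in> {p..q + e} \<Longrightarrow> \<bar>g' u\<bar> \<le> B" and uv: "u \<in> {p..q + e}" "v \<in> {p..q + e}"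
    for g g' :: "real \<Rightarrow> real" and B u v
  proof -
    have "norm (g u - g v) \<le> B * norm (u - v)"
      by (rule field_differentiable_bound[of "{p..q + e}" g g'])
        (use d B uv in \<open>auto intro: has_field_derivative_at_within\<close>)
    then show ?thesis by simp
  qed
  have lt: "y1 < y2" using y pq by auto
  obtain z where z: "y1 < z" "z < y2" "f' z = 0"
  proof -
    have "\<exists>z. y1 < z \<and> z < y2 \<and> f y2 - f y1 = (y2 - y1) * f' z"
      using lt y pq by (intro MVT2 f) auto
    then show ?thesis using that y lt by auto
  qed
  have b': "\<bar>f' u\<bar> \<le> M * (2 * (q - p))" if u: "u \<in> {p..q + e}" for u
  proof -
    have zin: "z \<in> {p..q + e}" using z y pq by auto
    have "\<bar>f' u\<bar> \<le> M * \<bar>u - z\<bar>" using lip[OF f' M u zin] z by simp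
    also have "\<dots> \<le> M * (2 * (q - p))" using u zin M0 pq by (intro mult_left_mono) auto
    finally show ?thesis .
  qed
  have small: "\<bar>f u\<bar> \<le> M * (2 * (q - p)) * e"
    if "u \<in> {p..q + e}" "v \<in> {p..q + e}" "\<bar>u - v\<bar> \<le> e" "f v = 0" for u v
  proof -
    have "\<bar>f u\<bar> \<le> M * (2 * (q - p)) * \<bar>u - v\<bar>" using lip[OF f b' that(1,2)] that(4) by simp
    also have "\<dots> \<le> M * (2 * (q - p)) * e" using that M0 pq by (intro mult_left_mono mult_nonneg_nonneg) auto
    finally show ?thesis .
  qed
  have p: "\<bar>f p\<bar> \<le> M * (2 * (q - p)) * e" by (rule small[of _ y1]) (use y pq in auto)
  have q: "\<bar>f q\<bar> \<le> M * (2 * (q - p)) * e" by (rule small[of _ y2]) (use y pq in auto)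
  have eq: "2 * e * (q - p) * M = M * (2 * (q - p)) * e" "4 * e * (q - p) * M = 2 * (M * (2 * (q - p)) * e)"
    by simp_all
  show "\<bar>f p\<bar> \<le> 2 * e * (q - p) * M" unfolding eq by (rule p)
  have "\<bar>f q - f p\<bar> \<le> 2 * b" if "\<bar>f p\<bar> \<le> b" "\<bar>f q\<bar> \<le> b" for b using that by linarith
  from this[OF p q] show "\<bar>f q - f p\<bar> \<le> 4 * e * (q - p) * M" unfolding eq .
qed

section \<open>Counting critical points by cells\<close>

text \<open>Neighbouring cells share an end point. A zero that lies there occupies both cells, which is why the lemmas below
ask for two different points in the two cells.\<close>
definition cell :: "real \<Rightarrow> real \<Rightarrow> nat \<Rightarrow> nat \<Rightarrow> real set" where
  "cell x h n i = {x + real i * (h / real (Suc n))..x + real i * (h / real (Suc n)) + h / real (Suc n)}"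

definition ordered_pairs :: "nat \<Rightarrow> (nat \<times> nat) set" where
  "ordered_pairs n = {(i, j). i \<le> n \<and> j \<le> n \<and> i \<noteq> j}"

lemma finite_ordered_pairs: "finite (ordered_pairs n)"
  by (rule finite_subset[of _ "{..n} \<times> {..n}"]) (auto simp: ordered_pairs_def)

lemma card_ordered_pairs_le: "card (ordered_pairs n) \<le> Suc n * Suc n"
proof -
  have "card (ordered_pairs n) \<le> card ({..n} \<times> {..n})"
    by (rule card_mono) (auto simp: ordered_pairs_def)
  then show ?thesis by (simp add: card_cartesian_product)
qed

lemma in_some_cell:
  assumes h: "0 < h" and y: "y \<in> {x..x + h}"
  shows "\<exists>i\<le>n. y \<in> cell x h n i"
proof -
  define e where "e = h / real (Suc n)"
  have e: "0 < e" using h by (simp add: e_def)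
  have he: "h = real (Suc n) * e" by (simp add: e_def)
  have ce: "cell x h n i = {x + real i * e..x + real i * e + e}" for i by (simp only: cell_def e_def)
  define k where "k = nat \<lfloor>(y - x) / e\<rfloor>"
  have f0: "0 \<le> \<lfloor>(y - x) / e\<rfloor>" using y e by simp
  then have rk: "real k = of_int \<lfloor>(y - x) / e\<rfloor>" by (simp add: k_def)
  have k: "real k \<le> (y - x) / e" "(y - x) / e < real k + 1" unfolding rk by linarith+
  then have k': "real k * e \<le> y - x" "y - x < (real k + 1) * e"
    using e by (simp_all add: pos_le_divide_eq pos_divide_less_eq)
  show ?thesis
  proof (cases "k \<le> n")
    case True
    moreover have "y \<in> cell x h n k" using k' by (simp add: ce distrib_right)
    ultimately show ?thesis by blast
  next
    case False
    then have "real (Suc n) * e \<le> real k * e" using e by (intro mult_right_mono) auto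
    then have "y - x = real (Suc n) * e" using k' y he by simp
    then have "y \<in> cell x h n n" using e by (simp add: ce distrib_right)
    then show ?thesis by blast
  qed
qed

lemma card_off_diagonal:
  assumes "finite T"
  shows "card {(y, y'). y \<in> T \<and> y' \<in> T \<and> y \<noteq> y'} = card T * card T - card T"
proof -
  have "{(y, y'). y \<in> T \<and> y' \<in> T \<and> y \<noteq> y'} = T \<times> T - (\<lambda>y. (y, y)) ` T" by auto
  moreover have "card ((\<lambda>y. (y, y)) ` T) = card T" by (rule card_image) (auto simp: inj_on_def)
  moreover have "card (T \<times> T - (\<lambda>y. (y, y)) ` T) = card (T \<times> T) - card ((\<lambda>y. (y, y)) ` T)"
    using assms by (intro card_Diff_subset) auto
  ultimately show ?thesis by (simp add: card_cartesian_product)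
qed

text \<open>Once the mesh is smaller than all gaps between the points, different points have different cells.\<close>
lemma finite_pairs_le_cell_pairs:
  fixes X :: "nat \<Rightarrow> nat \<Rightarrow> nat \<Rightarrow> ennreal"
  assumes T: "finite T" "T \<subseteq> {x..x + h}" and h: "0 < h"
    and X: "\<And>n i j y y'. i \<le> n \<Longrightarrow> j \<le> n \<Longrightarrow> i \<noteq> j \<Longrightarrow> y \<in> T \<Longrightarrow> y' \<in> T \<Longrightarrow> y \<noteq> y' \<Longrightarrow>
      y \<in> cell x h n i \<Longrightarrow> y' \<in> cell x h n j \<Longrightarrow> 1 \<le> X n i j"
  shows "\<forall>\<^sub>F n in sequentially. of_nat (card T * card T - card T) \<le> (\<Sum>(i, j)\<in>ordered_pairs n. X n i j)"
proof -
  define \<eta> where "\<eta> = Min (insert 1 ((\<lambda>(y, y'). \<bar>y - y'\<bar>) ` {(y, y'). y \<in> T \<and> y' \<in> T \<and> y \<noteq> y'}))"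
  have fin: "finite {(y, y'). y \<in> T \<and> y' \<in> T \<and> y \<noteq> y'}"
    by (rule finite_subset[of _ "T \<times> T"]) (use T in auto)
  have \<eta>: "0 < \<eta>" unfolding \<eta>_def using fin by (subst Min_gr_iff) auto
  have gap: "\<eta> \<le> \<bar>y - y'\<bar>" if "y \<in> T" "y' \<in> T" "y \<noteq> y'" for y y'
    unfolding \<eta>_def using fin that by (intro Min_le) (auto intro!: rev_image_eqI[of "(y, y')"])
  have "(\<lambda>n. h / real (Suc n)) \<longlonglongrightarrow> 0" by (rule LIMSEQ_Suc[OF lim_const_over_n])
  then have "\<forall>\<^sub>F n in sequentially. h / real (Suc n) < \<eta>" using \<eta> by (rule order_tendstoD)
  then show ?thesis
  proof (rule eventually_mono)
    fix n assume n: "h / real (Suc n) < \<eta>"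
    have "\<forall>y\<in>T. \<exists>i\<le>n. y \<in> cell x h n i" using in_some_cell[OF h] T by blast
    then obtain c where c: "\<And>y. y \<in> T \<Longrightarrow> c y \<le> n" "\<And>y. y \<in> T \<Longrightarrow> y \<in> cell x h n (c y)" by metis
    have inj: "c y \<noteq> c y'" if "y \<in> T" "y' \<in> T" "y \<noteq> y'" for y y'
    proof
      assume "c y = c y'"
      then have "\<bar>y - y'\<bar> \<le> h / real (Suc n)" using c(2)[OF that(1)] c(2)[OF that(2)] by (auto simp: cell_def)
      then show False using gap[OF that] n by linarith
    qed
    let ?D = "{(y, y'). y \<in> T \<and> y' \<in> T \<and> y \<noteq> y'}"
    let ?f = "\<lambda>(y, y'). (c y, c y')"
    have injf: "inj_on ?f ?D" using inj by (auto simp: inj_on_def)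
    have sub: "?f ` ?D \<subseteq> ordered_pairs n" using c inj by (auto simp: ordered_pairs_def)
    have "of_nat (card T * card T - card T) = (\<Sum>p\<in>?f ` ?D. 1 :: ennreal)"
      using card_off_diagonal[OF T(1)] card_image[OF injf] by simp
    also have "\<dots> \<le> (\<Sum>(i, j)\<in>?f ` ?D. X n i j)"
    proof (rule sum_mono)
      fix p assume "p \<in> ?f ` ?D"
      then obtain y y' where p: "p = (c y, c y')" "y \<in> T" "y' \<in> T" "y \<noteq> y'" by auto
      have "1 \<le> X n (c y) (c y')" by (rule X[of _ _ _ y y']) (use p c inj in auto)
      then show "1 \<le> (case p of (i, j) \<Rightarrow> X n i j)" by (simp add: p)
    qed
    also have "\<dots> \<le> (\<Sum>(i, j)\<in>ordered_pairs n. X n i j)"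
      by (rule sum_mono2[OF finite_ordered_pairs sub]) auto
    finally show "of_nat (card T * card T - card T) \<le> (\<Sum>(i, j)\<in>ordered_pairs n. X n i j)" .
  qed
qed

text \<open>Finite subsets of \<open>S\<close> are separated by fine meshes; if \<open>S\<close> is infinite, its finite subsets of arbitrary size push the lower
limit to \<open>\<top>\<close>, which is then also the left-hand side.\<close>
lemma factorial_count_le_liminf:
  fixes X :: "nat \<Rightarrow> nat \<Rightarrow> nat \<Rightarrow> ennreal"
  assumes S: "S \<subseteq> {x..x + h}" and h: "0 < h"
    and X: "\<And>n i j y y'. i \<le> n \<Longrightarrow> j \<le> n \<Longrightarrow> i \<noteq> j \<Longrightarrow> y \<in> S \<Longrightarrow> y' \<in> S \<Longrightarrow> y \<noteq> y' \<Longrightarrow>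
      y \<in> cell x h n i \<Longrightarrow> y' \<in> cell x h n j \<Longrightarrow> 1 \<le> X n i j"
  shows "(emeasure (count_space UNIV) S)\<^sup>2 - emeasure (count_space UNIV) S
    \<le> liminf (\<lambda>n. \<Sum>(i, j)\<in>ordered_pairs n. X n i j)" (is "_ \<le> ?L")
proof -
  have le: "of_nat (card T * card T - card T) \<le> ?L" if T: "finite T" "T \<subseteq> S" for T
  proof (rule Liminf_bounded, rule finite_pairs_le_cell_pairs[OF T(1) _ h])
    show "T \<subseteq> {x..x + h}" using T S by auto
    fix n i j y y'
    assume "i \<le> n" "j \<le> n" "i \<noteq> j" "y \<in> T" "y' \<in> T" "y \<noteq> y'" "y \<in> cell x h n i" "y' \<in> cell x h n j"
    then show "1 \<le> X n i j" using T by (intro X[of i n j y y']) auto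
  qed
  show ?thesis
  proof (cases "finite S")
    case True
    let ?m = "card S"
    have "(of_nat ?m :: ennreal)\<^sup>2 - of_nat ?m = of_nat (?m * ?m - ?m)"
    proof -
      have "?m \<le> ?m * ?m" by simp
      then have "real (?m * ?m - ?m) = real ?m * real ?m - real ?m" by (simp add: of_nat_diff)
      then show ?thesis
        by (simp only: ennreal_of_nat_eq_real_of_nat power2_eq_square) (simp add: ennreal_mult[symmetric] ennreal_minus)
    qed
    then show ?thesis using le[OF True order_refl] True by (simp add: emeasure_count_space_finite)
  next
    case False
    have "of_nat m \<le> ?L" for m
    proof -
      obtain T where T: "finite T" "card T = m + 2" "T \<subseteq> S"
        using infinite_arbitrarily_large[OF False, of "m + 2"] by auto
      have "m \<le> card T * card T - card T" unfolding T(2) by simp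
      then have "(of_nat m :: ennreal) \<le> of_nat (card T * card T - card T)" by (rule of_nat_mono)
      also have "\<dots> \<le> ?L" by (rule le) (use T in auto)
      finally show ?thesis .
    qed
    then have "?L = \<top>" using ennreal_Ex_less_of_nat[of ?L] by (meson linorder_not_less top.not_eq_extremum)
    then show ?thesis by simp
  qed
qed

lemma ennreal_le_factorial_moment:
  fixes N :: ennreal
  assumes "2 \<le> N"
  shows "N \<le> N\<^sup>2 - N"
proof (cases N)
  case (real r)
  then have r: "2 \<le> r" using assms by (metis ennreal_le_iff ennreal_numeral)
  have "2 * r \<le> r * r" using r by (intro mult_right_mono) auto
  then have "r \<le> r\<^sup>2 - r" by (simp add: power2_eq_square)
  then have "ennreal r \<le> ennreal (r\<^sup>2 - r)" by (rule ennreal_leI)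
  also have "\<dots> = N\<^sup>2 - N" using real by (simp add: ennreal_power ennreal_minus)
  finally show ?thesis using real by simp
next
  case top
  then show ?thesis by (simp add: ennreal_top_power2_minus_top)
qed

context conga_kernel
begin

text \<open>For each pair of cells, the presence of two critical points implies the event \<open>Ev\<close> of
\<open>near_double_zero_probability\<close>. The number of such events that occur is measurable, unlike possibly the number of occupied
pairs of cells, so Fatou's lemma is applied to it.\<close>
theorem critical_pair_moment_le:
  assumes W: "std_brownian_motion M W" and t: "conga_sigma \<alpha> t = s"
    and \<delta>: "0 < \<delta>" "\<delta> \<le> 1" "6 * s \<le> \<delta>" and x: "\<delta> \<le> x" "x + h \<le> \<alpha>" and h: "0 < h" "h \<le> s"
  defines "N \<equiv> \<lambda>\<omega>. num_critical \<alpha> t (\<lambda>r. W r \<omega>) {x..x + h}"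
  shows "(\<integral>\<^sup>+\<omega>. ((N \<omega>)\<^sup>2 - N \<omega>) \<partial>M) \<le> ennreal (pair_const \<alpha> \<delta> * h ^ 3 / s ^ 3)"
proof -
  define Q where "Q = fluct (kernel_const \<delta>) x"
  define e where "e n = h / real (Suc n)" for n
  define pt where "pt n i = x + real i * e n" for n i
  define Ev where "Ev n i j = {\<omega> \<in> space M. let p = pt n (min i j); q = pt n (max i j) in
      \<bar>slope_fun p (path_of W \<omega>)\<bar> \<le> 2 * e n * (q - p) * Q (path_of W \<omega>) \<and>
      \<bar>slope_fun q (path_of W \<omega>) - slope_fun p (path_of W \<omega>)\<bar> \<le> 4 * e n * (q - p) * Q (path_of W \<omega>)}" for n i j
  have e: "0 < e n" for n using h by (simp add: e_def)
  have pt_le: "pt n (Suc i) \<le> x + h" if "i \<le> n" for n i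
  proof -
    have "real (Suc i) * e n \<le> real (Suc n) * e n" using that e[of n] by (intro mult_right_mono) auto
    then show ?thesis by (simp add: pt_def e_def)
  qed
  have pt_Suc: "pt n (Suc i) = pt n i + e n" for n i by (simp add: pt_def distrib_right)
  have x_pt: "x \<le> pt n i" for n i using e[of n] by (simp add: pt_def)
  have step: "pt n i + e n \<le> pt n j" if "i < j" for n i j
  proof -
    have "real (Suc i) * e n \<le> real j * e n" using that e[of n] by (intro mult_right_mono) auto
    then show ?thesis by (simp add: pt_def distrib_right)
  qed
  have x0: "0 < x" "x \<le> \<alpha>" "x + h \<le> 1" using x \<delta> h \<alpha> by auto
  have Evm: "Ev n i j \<in> sets M" for n i j
  proof -
    have m: "(\<lambda>\<omega>. slope_fun y (path_of W \<omega>)) \<in> borel_measurable M" "(\<lambda>\<omega>. Q (path_of W \<omega>)) \<in> borel_measurable M" for y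
      using measurable_comp[OF path_of_measurable[OF W] slope_fun_measurable[of y]]
        measurable_comp[OF path_of_measurable[OF W] fluct_measurable[of "kernel_const \<delta>" x]]
      by (simp_all add: comp_def Q_def)
    show ?thesis unfolding Ev_def Let_def
      by (intro sets.sets_Collect_conj borel_measurable_le borel_measurable_abs borel_measurable_diff
          borel_measurable_times borel_measurable_const m)
  qed
  have Evp: "emeasure M (Ev n i j) \<le> ennreal (pair_const \<alpha> \<delta> * (e n)\<^sup>2 * h / s ^ 3)"
    if ij: "(i, j) \<in> ordered_pairs n" for n i j
  proof -
    define p q where "p = pt n (min i j)" and "q = pt n (max i j)"
    have lt: "min i j < max i j" and mx: "max i j \<le> n" using ij by (auto simp: ordered_pairs_def)
    have pq: "x \<le> p" "p < q" "q \<le> x + h"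
      using x_pt step[OF lt, of n] e[of n] pt_le[OF mx] pt_Suc[of n "max i j"] by (auto simp: p_def q_def)
    have "emeasure M (Ev n i j) \<le> ennreal (pair_const \<alpha> \<delta> * (e n)\<^sup>2 * (q - p) / s ^ 3)"
      unfolding Ev_def Let_def p_def[symmetric] q_def[symmetric] Q_def
      by (rule near_double_zero_probability[OF W \<delta> x(1) x0(2)]) (use pq h e[of n] in auto)
    also have "\<dots> \<le> ennreal (pair_const \<alpha> \<delta> * (e n)\<^sup>2 * h / s ^ 3)"
    proof -
      have "0 \<le> pair_const \<alpha> \<delta>" using \<delta> \<alpha> by (simp add: pair_const_def fluct_const_def det_const_def)
      then show ?thesis using pq s by (intro ennreal_leI divide_right_mono mult_left_mono) auto
    qed
    finally show ?thesis .
  qed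
  let ?count = "\<lambda>\<omega> n. \<Sum>(i, j)\<in>ordered_pairs n. indicator (Ev n i j) \<omega>"
  have "AE \<omega> in M. (N \<omega>)\<^sup>2 - N \<omega> \<le> liminf (?count \<omega>)"
  proof -
    have "AE \<omega> in M. continuous_on {0..1} (\<lambda>r. W r \<omega>)" using W by (simp add: std_brownian_motion_def)
    then show ?thesis
      using AE_path_continuous[OF W] AE_space
    proof eventually_elim
      fix \<omega> assume c: "continuous_on {0..1} (\<lambda>r. W r \<omega>)" and cp: "continuous_on UNIV (path_of W \<omega>)" and sp: "\<omega> \<in> space M"
      let ?w = "path_of W \<omega>"
      have cp01: "continuous_on {0..1} ?w" using cp by (rule continuous_on_subset) auto
      define S where "S = {y \<in> {x..x + h}. (conga_line \<alpha> t (\<lambda>r. W r \<omega>) has_real_derivative 0) (at y)}"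
      have zero: "slope ?w y = 0" if "y \<in> S" for y
      proof -
        have "0 < y" using that x0 by (auto simp: S_def)
        then have "slope (\<lambda>r. W r \<omega>) y = 0"
          using that conga_line_derivative[OF c _ t] DERIV_unique unfolding S_def by blast
        moreover have "slope ?w y = slope (\<lambda>r. W r \<omega>) y"
          unfolding slope_def by (rule integral_cong) (simp add: path_of_def)
        ultimately show ?thesis by simp
      qed
      have "(emeasure (count_space UNIV) S)\<^sup>2 - emeasure (count_space UNIV) S
          \<le> liminf (?count \<omega>)"
      proof (rule factorial_count_le_liminf[OF _ h(1)])
        show "S \<subseteq> {x..x + h}" by (auto simp: S_def)
        fix n i j y y'
        assume ij: "i \<le> n" "j \<le> n" "i \<noteq> j" and y: "y \<in> S" "y' \<in> S" "y \<noteq> y'" "y \<in> cell x h n i" "y' \<in> cell x h n j"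
        define p q where "p = pt n (min i j)" and "q = pt n (max i j)"
        have lt: "min i j < max i j" and mx: "max i j \<le> n" using ij by auto
        have pq: "x \<le> p" "p + e n \<le> q" "q + e n \<le> x + h"
          using x_pt step[OF lt, of n] pt_le[OF mx] pt_Suc[of n "max i j"] by (auto simp: p_def q_def)
        have cl: "cell x h n k = {pt n k..pt n k + e n}" for k by (simp add: cell_def pt_def e_def)
        have "\<exists>y1 y2. y1 \<in> {p..p + e n} \<and> y2 \<in> {q..q + e n} \<and> y1 \<noteq> y2 \<and> y1 \<in> S \<and> y2 \<in> S"
        proof (cases "i < j")
          case True
          then show ?thesis using y unfolding cl p_def q_def by (intro exI[of _ y] exI[of _ y']) auto
        next
          case False
          then show ?thesis using y unfolding cl p_def q_def by (intro exI[of _ y'] exI[of _ y]) (auto simp: min_def max_def)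
        qed
        then obtain y1 y2 where y12: "y1 \<in> {p..p + e n}" "y2 \<in> {q..q + e n}" "y1 \<noteq> y2" "y1 \<in> S" "y2 \<in> S" by blast
        let ?base = "?w (1 - x / \<alpha>)"
        have range: "0 < u" "x \<le> u" "u \<le> x + s" "\<delta> \<le> u" "u \<le> 1" if "u \<in> {p..q + e n}" for u
          using that pq x0 x h by auto
        have d1: "(slope ?w has_real_derivative slope' ?w ?base u) (at u)" if "u \<in> {p..q + e n}" for u
          by (rule slope_derivs(1)[OF cp01 range(1)[OF that]])
        have d2: "(slope' ?w ?base has_real_derivative slope'' ?w ?base u) (at u)" if "u \<in> {p..q + e n}" for u
          by (rule slope_derivs(2)[OF cp01 range(1)[OF that]])
        have d3: "\<bar>slope'' ?w ?base u\<bar> \<le> Q ?w" if "u \<in> {p..q + e n}" for u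
          unfolding Q_def by (rule slope''_le_fluct[OF cp \<delta>(1,2)]) (use range[OF that] in auto)
        note small = two_zeros_small_values[OF d1 d2 d3 pq(2) less_imp_le[OF e] y12(1-3) zero[OF y12(4)] zero[OF y12(5)]]
        have "0 < p" "0 < q" using pq x0 e[of n] by auto
        then have "\<omega> \<in> Ev n i j"
          unfolding Ev_def Let_def p_def[symmetric] q_def[symmetric] using small sp by (simp add: slope_fun_eq[OF cp])
        then show "1 \<le> (indicator (Ev n i j) \<omega> :: ennreal)" by simp
      qed
      then show "(N \<omega>)\<^sup>2 - N \<omega> \<le> liminf (?count \<omega>)"
        by (simp add: N_def num_critical_def S_def)
    qed
  qed
  then have "(\<integral>\<^sup>+\<omega>. ((N \<omega>)\<^sup>2 - N \<omega>) \<partial>M) \<le> (\<integral>\<^sup>+\<omega>. liminf (?count \<omega>) \<partial>M)"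
    by (rule nn_integral_mono_AE)
  also have "\<dots> \<le> liminf (\<lambda>n. \<integral>\<^sup>+\<omega>. (\<Sum>(i, j)\<in>ordered_pairs n. indicator (Ev n i j) \<omega>) \<partial>M)"
    by (rule nn_integral_liminf) (auto intro!: borel_measurable_sum borel_measurable_indicator Evm simp: case_prod_beta)
  also have "\<dots> \<le> liminf (\<lambda>n. ennreal (pair_const \<alpha> \<delta> * h ^ 3 / s ^ 3))"
  proof (rule Liminf_mono, rule always_eventually, rule allI)
    fix n
    let ?b = "pair_const \<alpha> \<delta> * (e n)\<^sup>2 * h / s ^ 3"
    have b0: "0 \<le> ?b" using \<delta> \<alpha> h s by (simp add: pair_const_def fluct_const_def det_const_def)
    have "(\<integral>\<^sup>+\<omega>. (\<Sum>(i, j)\<in>ordered_pairs n. indicator (Ev n i j) \<omega>) \<partial>M) = (\<Sum>(i, j)\<in>ordered_pairs n. emeasure M (Ev n i j))"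
      by (subst nn_integral_sum) (auto intro!: sum.cong borel_measurable_indicator Evm
        simp: case_prod_beta nn_integral_indicator[OF Evm])
    also have "\<dots> \<le> (\<Sum>(i, j)\<in>ordered_pairs n. ennreal ?b)"
      by (intro sum_mono) (auto intro: Evp)
    also have "\<dots> = of_nat (card (ordered_pairs n)) * ennreal ?b" by (simp add: case_prod_beta)
    also have "\<dots> \<le> of_nat (Suc n * Suc n) * ennreal ?b"
      by (intro mult_right_mono of_nat_mono card_ordered_pairs_le) auto
    also have "\<dots> = ennreal (real (Suc n * Suc n) * ?b)"
      by (simp only: ennreal_of_nat_eq_real_of_nat) (rule ennreal_mult[symmetric], use b0 in auto)
    also have "real (Suc n * Suc n) * ?b = pair_const \<alpha> \<delta> * h ^ 3 / s ^ 3"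
    proof -
      have "real (Suc n) * e n = h" by (simp add: e_def)
      then have "(real (Suc n))\<^sup>2 * (e n)\<^sup>2 = h\<^sup>2" by (simp only: power_mult_distrib[symmetric])
      moreover have "real (Suc n * Suc n) * ?b = pair_const \<alpha> \<delta> * ((real (Suc n))\<^sup>2 * (e n)\<^sup>2) * h / s ^ 3"
        by (simp only: of_nat_mult power2_eq_square) (simp only: mult_ac times_divide_eq_right)
      ultimately show ?thesis by (simp add: eval_nat_numeral)
    qed
    finally show "(\<integral>\<^sup>+\<omega>. (\<Sum>(i, j)\<in>ordered_pairs n. indicator (Ev n i j) \<omega>) \<partial>M) \<le> ennreal (pair_const \<alpha> \<delta> * h ^ 3 / s ^ 3)" .
  qed
  also have "\<dots> = ennreal (pair_const \<alpha> \<delta> * h ^ 3 / s ^ 3)" by (simp add: Liminf_const)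
  finally show ?thesis .
qed

end

section \<open>The factorial moment bound\<close>

theorem lemma10:
  fixes \<alpha> :: real
  assumes "0 < \<alpha>" and "\<alpha> < 1"
  shows "\<exists>Cstar>0. \<forall>\<delta>. 0 < \<delta> \<and> \<delta> < \<alpha> \<longrightarrow> (\<exists>C>0.
    \<forall>(M::'a measure) (W::real \<Rightarrow> 'a \<Rightarrow> real). std_brownian_motion M W \<longrightarrow>
    (\<forall>(t::real) (h::real) (x::real).
       t > 4 * (1 + sqrt 2)\<^sup>2 / (2 * \<delta>\<^sup>2) \<and> 0 < h \<and> h \<le> Cstar * t powr (-1/2) \<and>
       {x..x+h} \<subseteq> {\<delta>..\<alpha>} \<longrightarrow>
       (let N = (\<lambda>\<omega>. num_critical \<alpha> t (\<lambda>s. W s \<omega>) {x..x+h}) in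
         (\<integral>\<^sup>+ \<omega>. ((N \<omega>)\<^sup>2 - N \<omega>) \<partial>M) \<le> ennreal (C * h ^ 3 * t powr (3/2)) \<and>
         (\<integral>\<^sup>+ \<omega>. (N \<omega> * indicator {\<omega>. N \<omega> \<ge> 2} \<omega>) \<partial>M)
           \<le> ennreal (C * h ^ 3 * t powr (3/2)))))"
proof -
  define \<sigma> where "\<sigma> = sqrt (\<alpha> * (1 - \<alpha>))"
  have \<sigma>: "0 < \<sigma>" "\<sigma> \<le> 1 / 2"
  proof -
    show "0 < \<sigma>" using assms by (simp add: \<sigma>_def)
    have "0 \<le> (\<alpha> - 1/2)\<^sup>2" by simp
    then have "\<alpha> * (1 - \<alpha>) \<le> (1 / 2)\<^sup>2" by (simp add: power2_eq_square algebra_simps)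
    then show "\<sigma> \<le> 1 / 2" unfolding \<sigma>_def by (intro real_le_lsqrt) auto
  qed
  let "\<exists>Cstar>0. \<forall>\<delta>. _ \<delta> \<longrightarrow> (\<exists>C>0. ?P Cstar \<delta> C)" = ?thesis
  show ?thesis
  proof (rule exI[of _ \<sigma>], intro conjI allI impI)
    show "0 < \<sigma>" by (rule \<sigma>)
    fix \<delta> assume \<delta>: "0 < \<delta> \<and> \<delta> < \<alpha>"
    define C where "C = pair_const \<alpha> \<delta> / \<sigma> ^ 3"
    have pc: "0 < pair_const \<alpha> \<delta>"
    proof -
      have "0 < kernel_const \<delta>" using \<delta> by (simp add: kernel_const_def)
      then have "0 < fluct_const \<alpha> (kernel_const \<delta>)"
        unfolding fluct_const_def using assms by (intro add_pos_pos mult_pos_pos zero_less_power divide_pos_pos) auto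
      moreover have "0 < (1 + exp (1/2 :: real))\<^sup>2" by (intro zero_less_power add_pos_pos) auto
      ultimately show ?thesis using \<delta> by (simp add: pair_const_def det_const_def)
    qed
    show "\<exists>C>0. ?P \<sigma> \<delta> C"
    proof (rule exI[of _ C], intro conjI allI impI)
      show "0 < C" using pc \<sigma> by (simp add: C_def)
      fix M :: "'a measure" and W :: "real \<Rightarrow> 'a \<Rightarrow> real" and t h x :: real
      assume W: "std_brownian_motion M W"
        and a: "t > 4 * (1 + sqrt 2)\<^sup>2 / (2 * \<delta>\<^sup>2) \<and> 0 < h \<and> h \<le> \<sigma> * t powr (-1/2) \<and> {x..x+h} \<subseteq> {\<delta>..\<alpha>}"
      define s where "s = \<sigma> / sqrt t"
      have "0 \<le> 4 * (1 + sqrt 2)\<^sup>2 / (2 * \<delta>\<^sup>2)" by simp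
      then have t0: "0 < t" using a by linarith
      \<comment> \<open>The lower bound on \<open>t\<close> gives \<open>6 s \<le> \<delta>\<close>, which keeps the shift intervals, at most \<open>3 s\<close> to the left of \<open>x / \<alpha>\<close>, inside \<open>[\<delta> / 2, 1]\<close>.\<close>
      have "(3 / \<delta>)\<^sup>2 \<le> t"
      proof -
        have "3\<^sup>2 \<le> 2 * (1 + sqrt 2 :: real)\<^sup>2"
        proof -
          have "(1.2 :: real) \<le> sqrt 2" by (rule real_le_rsqrt) (simp add: power2_eq_square)
          then have "(2.2 :: real)\<^sup>2 \<le> (1 + sqrt 2)\<^sup>2" by (intro power_mono) auto
          then show ?thesis by (simp add: power2_eq_square)
        qed
        then have "3\<^sup>2 / \<delta>\<^sup>2 \<le> 2 * (1 + sqrt 2)\<^sup>2 / \<delta>\<^sup>2" by (rule divide_right_mono) simp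
        then show ?thesis using a by (simp add: power_divide)
      qed
      then have st: "3 / \<delta> \<le> sqrt t" by (rule real_le_rsqrt)
      have s6: "6 * s \<le> \<delta>"
      proof -
        have "3 \<le> \<delta> * sqrt t" using st \<delta> by (simp add: pos_divide_le_eq mult.commute)
        then have "6 * \<sigma> \<le> \<delta> * sqrt t" using \<sigma> by linarith
        then show ?thesis using t0 by (simp add: s_def pos_divide_le_eq)
      qed
      have s0: "0 < s" using \<sigma> t0 by (simp add: s_def)
      have s1: "s \<le> 1" using s6 \<delta> assms by linarith
      interpret conga_kernel \<alpha> s using assms s0 s1 by unfold_locales
      have "t powr (-1/2) = 1 / sqrt t" using t0 by (simp add: powr_minus_divide powr_half_sqrt)
      then have hs: "h \<le> s" using a by (simp add: s_def)
      have xh: "\<delta> \<le> x" "x + h \<le> \<alpha>"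
      proof -
        have "x \<in> {\<delta>..\<alpha>}" "x + h \<in> {\<delta>..\<alpha>}" using a by auto
        then show "\<delta> \<le> x" "x + h \<le> \<alpha>" by auto
      qed
      define N where "N \<omega> = num_critical \<alpha> t (\<lambda>s. W s \<omega>) {x..x+h}" for \<omega>
      have "(\<integral>\<^sup>+\<omega>. ((N \<omega>)\<^sup>2 - N \<omega>) \<partial>M) \<le> ennreal (pair_const \<alpha> \<delta> * h ^ 3 / s ^ 3)"
        unfolding N_def
        by (rule critical_pair_moment_le[OF W _ _ _ s6 xh]) (use a \<delta> assms hs in \<open>auto simp: conga_sigma_def s_def \<sigma>_def\<close>)
      also have "pair_const \<alpha> \<delta> * h ^ 3 / s ^ 3 = C * h ^ 3 * t powr (3/2)"
      proof -
        have "t powr (1 + 1/2) = t powr 1 * t powr (1/2)" by (rule powr_add)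
        then have "t powr (3/2) = (sqrt t) ^ 3" using t0 by (simp add: powr_half_sqrt power3_eq_cube)
        then show ?thesis by (simp add: C_def s_def power_divide)
      qed
      finally have 1: "(\<integral>\<^sup>+\<omega>. ((N \<omega>)\<^sup>2 - N \<omega>) \<partial>M) \<le> ennreal (C * h ^ 3 * t powr (3/2))" .
      have "(\<integral>\<^sup>+\<omega>. (N \<omega> * indicator {\<omega>. N \<omega> \<ge> 2} \<omega>) \<partial>M) \<le> (\<integral>\<^sup>+\<omega>. ((N \<omega>)\<^sup>2 - N \<omega>) \<partial>M)"
        by (rule nn_integral_mono) (auto simp: indicator_def ennreal_le_factorial_moment)
      then have 2: "(\<integral>\<^sup>+\<omega>. (N \<omega> * indicator {\<omega>. N \<omega> \<ge> 2} \<omega>) \<partial>M) \<le> ennreal (C * h ^ 3 * t powr (3/2))"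
        using 1 by (rule order_trans)
      show "let N = (\<lambda>\<omega>. num_critical \<alpha> t (\<lambda>s. W s \<omega>) {x..x+h}) in
         (\<integral>\<^sup>+ \<omega>. ((N \<omega>)\<^sup>2 - N \<omega>) \<partial>M) \<le> ennreal (C * h ^ 3 * t powr (3/2)) \<and>
         (\<integral>\<^sup>+ \<omega>. (N \<omega> * indicator {\<omega>. N \<omega> \<ge> 2} \<omega>) \<partial>M)
           \<le> ennreal (C * h ^ 3 * t powr (3/2))"
        using 1 2 unfolding N_def Let_def by blast
    qed
  qed
qed

end
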